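(* Let $k$ be an algebraically closed field, let $d\ge 1$ be an integer, and let $\mathcal{C}$ be an essentially small, $k$-linear, Hom-finite, Krull–Schmidt $(d+2)$-angulated category with $d$-suspension functor $\Sigma^d$. Let $\phi\colon K_0(\mathcal{C},0)\to K_0(\mathcal{C})$ be the canonical epimorphism from the split Grothendieck group of $\mathcal{C}$ to the Grothendieck group of $\mathcal{C}$. If $\mathcal{C}$ is locally finite, then $\operatorname{Ker}\phi$ is generated (as an abelian group) by the elements $[A_\bullet]$ of $K_0(\mathcal{C},0)$, where $$A_\bullet:\ A_0\xrightarrow{\alpha_0}A_1\xrightarrow{\alpha_1}A_2\xrightarrow{\alpha_2}\cdots\xrightarrow{\alpha_{d-1}}A_d\xrightarrow{\alpha_d}A_{d+1}\xrightarrow{\alpha_{d+1}}\Sigma^dA_0$$ runs through all Auslander–Reiten $(d+2)$-angles in $\mathcal{C}$.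
   Context: **$(d+2)$-angulated categories.** Let $\mathcal{C}$ be an additive category with an automorphism $\Sigma^d\colon\mathcal{C}\to\mathcal{C}$, where $d\ge1$ is an integer ($\Sigma^d$ is a single symbol). A $(d+2)$-$\Sigma^d$-sequence is a sequence of morphisms $A_0\xrightarrow{f_0}A_1\xrightarrow{f_1}\cdots\xrightarrow{f_d}A_{d+1}\xrightarrow{f_{d+1}}\Sigma^dA_0$. Its left rotation is $A_1\xrightarrow{f_1}A_2\xrightarrow{f_2}\cdots\xrightarrow{f_d}A_{d+1}\xrightarrow{f_{d+1}}\Sigma^dA_0\xrightarrow{(-1)^d\Sigma^df_0}\Sigma^dA_1$. A morphism from $(A_i,f_i)$ to $(B_i,g_i)$ is a tuple $(\varphi_0,\dots,\varphi_{d+1})$, $\varphi_i\colon A_i\to B_i$, with $\varphi_{i+1}f_i=g_i\varphi_i$ for $0\le i\le d$ and $(\Sigma^d\varphi_0)f_{d+1}=g_{d+1}\varphi_{d+1}$; it is an isomorphism if all $\varphi_i$ are isomorphisms. A $(d+2)$-angulated category is a triple $(\mathcal{C},\Sigma^d,\Theta)$ with $\Theta$ a class of $(d+2)$-$\Sigma^d$-sequences (called $(d+2)$-angles) such that: - (N1) (a) $\Theta$ is closed under isomorphisms, direct sums and direct summands; (b) for each object $A$ the sequence $A\xrightarrow{1_A}A\to0\to\cdots\to0\to\Sigma^dA$ is in $\Theta$; (c) each morphism $f_0\colon A_0\to A_1$ is the first morphism of some $(d+2)$-angle. - (N2) A $(d+2)$-$\Sigma^d$-sequence is in $\Theta$ if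 and only if its left rotation is in $\Theta$. - (N3) Given two $(d+2)$-angles $(A_i,f_i)$, $(B_i,g_i)$ and $\varphi_0\colon A_0\to B_0$, $\varphi_1\colon A_1\to B_1$ with $\varphi_1f_0=g_0\varphi_0$, there are $\varphi_2,\dots,\varphi_{d+1}$ making $(\varphi_0,\dots,\varphi_{d+1})$ a morphism of $(d+2)$-$\Sigma^d$-sequences. - (N4) In (N3), $\varphi_2,\dots,\varphi_{d+1}$ can be chosen so that the mapping cone $$A_1\oplus B_0\xrightarrow{\left(\begin{smallmatrix}-f_1&0\\ \varphi_1&g_0\end{smallmatrix}\right)}A_2\oplus B_1\xrightarrow{\left(\begin{smallmatrix}-f_2&0\\ \varphi_2&g_1\end{smallmatrix}\right)}\cdots\xrightarrow{\left(\begin{smallmatrix}-f_{d+1}&0\\ \varphi_{d+1}&g_d\end{smallmatrix}\right)}\Sigma^dA_0\oplus B_{d+1}\xrightarrow{\left(\begin{smallmatrix}-\Sigma^df_0&0\\ \Sigma^d\varphi_0&g_{d+1}\end{smallmatrix}\right)}\Sigma^dA_1\oplus\Sigma^dB_0$$ is in $\Theta$. **Split $(d+2)$-angles.** A $(d+2)$-angle $A_0\xrightarrow{\alpha_0}A_1\to\cdots\xrightarrow{\alpha_d}A_{d+1}\xrightarrow{\alpha_{d+1}}\Sigma^dA_0$ is called split if it satisfies one of the following equivalent conditions: $\alpha_0$ is a section (split monomorphism); $\alpha_d$ is a retraction (split epimorphism); $\alpha_{d+1}=0$. **Auslander–Reiten $(d+2)$-angles.** Let $\mathrm{rad}_{\mathcal{C}}$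 be the Jacobson radical of $\mathcal{C}$. A morphism $f\colon A\to B$ is left almost split if it is not a section and every morphism $A\to Y$ that is not a section factors through $f$; right almost split is dual (not a retraction, and every non-retraction $Y\to B$ factors through $f$). A $(d+2)$-angle $A_0\xrightarrow{\alpha_0}A_1\xrightarrow{\alpha_1}A_2\xrightarrow{\alpha_2}\cdots\xrightarrow{\alpha_{d-1}}A_d\xrightarrow{\alpha_d}A_{d+1}\xrightarrow{\alpha_{d+1}}\Sigma^dA_0$ is an Auslander–Reiten $(d+2)$-angle if $\alpha_0$ is left almost split, $\alpha_d$ is right almost split and, when $d\ge2$, also $\alpha_1,\dots,\alpha_{d-1}$ are in $\mathrm{rad}_{\mathcal{C}}$. **Locally finite.** Let $\mathrm{ind}(\mathcal{C})$ be the set of isomorphism classes of indecomposable objects of $\mathcal{C}$. $\mathcal{C}$ is locally finite if for every $X\in\mathrm{ind}(\mathcal{C})$ there are only finitely many $Y\in\mathrm{ind}(\mathcal{C})$ with $\mathrm{Hom}_{\mathcal{C}}(X,Y)\ne0$ and only finitely many $Y\in\mathrm{ind}(\mathcal{C})$ with $\mathrm{Hom}_{\mathcal{C}}(Y,X)\neq0$. **Grothendieck groups.** Let $F(\mathcal{C})$ be the free abelian group on the set of isomorphism classes $\langle A\rangle$ of objects of $\mathcal{C}$. For a $(d+2)$-angle $A_\bullet$ with terms $A_0,\dots,A_{d+1}$ put $\chi(A_\bullet)=\sum_{i=0}^{d+1}(-1)^i\langle A_i\rangle\in F(\mathcal{C})$. Let $R(\mathcal{C})$ be the subgroup generated by all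 $\chi(A_\bullet)$ with $A_\bullet$ a $(d+2)$-angle, and $R'(\mathcal{C})$ the subgroup generated by all $\chi(A_\bullet)$ with $A_\bullet$ a split $(d+2)$-angle. The Grothendieck group is $K_0(\mathcal{C})=F(\mathcal{C})/R(\mathcal{C})$, the split Grothendieck group is $K_0(\mathcal{C},0)=F(\mathcal{C})/R'(\mathcal{C})$, and $\phi\colon K_0(\mathcal{C},0)\to K_0(\mathcal{C})$ is the canonical epimorphism. $[A]$ denotes the class of $\langle A\rangle$ in $K_0(\mathcal{C},0)$, and for a $(d+2)$-angle $A_\bullet$, $[A_\bullet]=\sum_{i=0}^{d+1}(-1)^i[A_i]\in K_0(\mathcal{C},0)$. *)

theory Defs
  imports "HOL-Algebra.Algebra"
begin

section \<open>Linear and additive categories\<close>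

text \<open>
  The morphisms from \<open>A\<close> to \<open>B\<close> form a \<open>K\<close>-module \<open>Hom C A B\<close>; the ring multiplication and unit
  that the library's \<^type>\<open>module\<close> record also carries are never used.
  \<open>g \<bullet>\<^bsub>C\<^esub> f\<close> is \<open>g\<close> after \<open>f\<close>.
\<close>

record ('k, 'o, 'm) linear_cat =
  Ob :: "'o set"
  Hom :: "'o \<Rightarrow> 'o \<Rightarrow> ('k, 'm) module"
  cmp :: "'m \<Rightarrow> 'm \<Rightarrow> 'm"  (infixr \<open>\<bullet>\<index>\<close> 75)
  idt :: "'o \<Rightarrow> 'm"

abbreviation mor :: "('k, 'o, 'm, 'z) linear_cat_scheme \<Rightarrow> 'o \<Rightarrow> 'o \<Rightarrow> 'm set" where
  "mor C A B \<equiv> carrier (Hom C A B)"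

locale linear_category =
  field K for K :: "('k, 'r) ring_scheme" +
  fixes C :: "('k, 'o, 'm, 'z) linear_cat_scheme"
  assumes hom_module: "\<lbrakk>A \<in> Ob C; B \<in> Ob C\<rbrakk> \<Longrightarrow> module K (Hom C A B)"
    and hom_disjoint:
      "\<lbrakk>A \<in> Ob C; B \<in> Ob C; A' \<in> Ob C; B' \<in> Ob C; f \<in> mor C A B; f \<in> mor C A' B'\<rbrakk>
        \<Longrightarrow> A = A' \<and> B = B'"
    and idt_closed: "A \<in> Ob C \<Longrightarrow> idt C A \<in> mor C A A"
    and cmp_closed:
      "\<lbrakk>A \<in> Ob C; B \<in> Ob C; D \<in> Ob C; f \<in> mor C A B; g \<in> mor C B D\<rbrakk>
        \<Longrightarrow> g \<bullet>\<^bsub>C\<^esub> f \<in> mor C A D"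
    and cmp_idt_right: "\<lbrakk>A \<in> Ob C; B \<in> Ob C; f \<in> mor C A B\<rbrakk> \<Longrightarrow> f \<bullet>\<^bsub>C\<^esub> idt C A = f"
    and cmp_idt_left: "\<lbrakk>A \<in> Ob C; B \<in> Ob C; f \<in> mor C A B\<rbrakk> \<Longrightarrow> idt C B \<bullet>\<^bsub>C\<^esub> f = f"
    and cmp_assoc:
      "\<lbrakk>A \<in> Ob C; B \<in> Ob C; D \<in> Ob C; E \<in> Ob C;
        f \<in> mor C A B; g \<in> mor C B D; h \<in> mor C D E\<rbrakk>
        \<Longrightarrow> (h \<bullet>\<^bsub>C\<^esub> g) \<bullet>\<^bsub>C\<^esub> f = h \<bullet>\<^bsub>C\<^esub> (g \<bullet>\<^bsub>C\<^esub> f)"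
    and cmp_add_right:
      "\<lbrakk>A \<in> Ob C; B \<in> Ob C; D \<in> Ob C; f \<in> mor C A B; f' \<in> mor C A B; g \<in> mor C B D\<rbrakk>
        \<Longrightarrow> g \<bullet>\<^bsub>C\<^esub> (f \<oplus>\<^bsub>Hom C A B\<^esub> f') = g \<bullet>\<^bsub>C\<^esub> f \<oplus>\<^bsub>Hom C A D\<^esub> g \<bullet>\<^bsub>C\<^esub> f'"
    and cmp_add_left:
      "\<lbrakk>A \<in> Ob C; B \<in> Ob C; D \<in> Ob C; f \<in> mor C A B; g \<in> mor C B D; g' \<in> mor C B D\<rbrakk>
        \<Longrightarrow> (g \<oplus>\<^bsub>Hom C B D\<^esub> g') \<bullet>\<^bsub>C\<^esub> f = g \<bullet>\<^bsub>C\<^esub> f \<oplus>\<^bsub>Hom C A D\<^esub> g' \<bullet>\<^bsub>C\<^esub> f"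
    and cmp_smult_right:
      "\<lbrakk>A \<in> Ob C; B \<in> Ob C; D \<in> Ob C; c \<in> carrier K; f \<in> mor C A B; g \<in> mor C B D\<rbrakk>
        \<Longrightarrow> g \<bullet>\<^bsub>C\<^esub> (c \<odot>\<^bsub>Hom C A B\<^esub> f) = c \<odot>\<^bsub>Hom C A D\<^esub> (g \<bullet>\<^bsub>C\<^esub> f)"
    and cmp_smult_left:
      "\<lbrakk>A \<in> Ob C; B \<in> Ob C; D \<in> Ob C; c \<in> carrier K; f \<in> mor C A B; g \<in> mor C B D\<rbrakk>
        \<Longrightarrow> (c \<odot>\<^bsub>Hom C B D\<^esub> g) \<bullet>\<^bsub>C\<^esub> f = c \<odot>\<^bsub>Hom C A D\<^esub> (g \<bullet>\<^bsub>C\<^esub> f)"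

definition zero_object :: "('k, 'o, 'm, 'z) linear_cat_scheme \<Rightarrow> 'o \<Rightarrow> bool" where
  "zero_object C Z \<longleftrightarrow> Z \<in> Ob C \<and>
    (\<forall>A \<in> Ob C. mor C Z A = {\<zero>\<^bsub>Hom C Z A\<^esub>} \<and> mor C A Z = {\<zero>\<^bsub>Hom C A Z\<^esub>})"

definition biproduct ::
  "('k, 'o, 'm, 'z) linear_cat_scheme \<Rightarrow> 'o \<Rightarrow> 'o \<Rightarrow> 'o \<Rightarrow> 'm \<Rightarrow> 'm \<Rightarrow> 'm \<Rightarrow> 'm \<Rightarrow> bool" where
  "biproduct C A B P i1 i2 p1 p2 \<longleftrightarrow>
    A \<in> Ob C \<and> B \<in> Ob C \<and> P \<in> Ob C \<and>
    i1 \<in> mor C A P \<and> i2 \<in> mor C B P \<and> p1 \<in> mor C P A \<and> p2 \<in> mor C P B \<and>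
    p1 \<bullet>\<^bsub>C\<^esub> i1 = idt C A \<and> p2 \<bullet>\<^bsub>C\<^esub> i2 = idt C B \<and>
    p1 \<bullet>\<^bsub>C\<^esub> i2 = \<zero>\<^bsub>Hom C B A\<^esub> \<and> p2 \<bullet>\<^bsub>C\<^esub> i1 = \<zero>\<^bsub>Hom C A B\<^esub> \<and>
    i1 \<bullet>\<^bsub>C\<^esub> p1 \<oplus>\<^bsub>Hom C P P\<^esub> i2 \<bullet>\<^bsub>C\<^esub> p2 = idt C P"

definition finite_biproduct ::
  "('k, 'o, 'm, 'z) linear_cat_scheme \<Rightarrow> nat \<Rightarrow> (nat \<Rightarrow> 'o) \<Rightarrow> 'o \<Rightarrow> (nat \<Rightarrow> 'm) \<Rightarrow> (nat \<Rightarrow> 'm) \<Rightarrow> bool"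
where
  "finite_biproduct C n Q P i p \<longleftrightarrow>
    P \<in> Ob C \<and> (\<forall>j<n. Q j \<in> Ob C \<and> i j \<in> mor C (Q j) P \<and> p j \<in> mor C P (Q j)) \<and>
    (\<forall>j<n. \<forall>l<n. p l \<bullet>\<^bsub>C\<^esub> i j = (if j = l then idt C (Q j) else \<zero>\<^bsub>Hom C (Q j) (Q l)\<^esub>)) \<and>
    (\<Oplus>\<^bsub>Hom C P P\<^esub>j\<in>{..<n}. i j \<bullet>\<^bsub>C\<^esub> p j) = idt C P"

locale additive_category = linear_category +
  assumes ex_zero_object: "\<exists>Z. zero_object C Z"
    and ex_biproduct:
      "\<lbrakk>A \<in> Ob C; B \<in> Ob C\<rbrakk> \<Longrightarrow> \<exists>P i1 i2 p1 p2. biproduct C A B P i1 i2 p1 p2"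

definition is_section :: "('k, 'o, 'm, 'z) linear_cat_scheme \<Rightarrow> 'o \<Rightarrow> 'o \<Rightarrow> 'm \<Rightarrow> bool" where
  "is_section C A B f \<longleftrightarrow> f \<in> mor C A B \<and> (\<exists>r \<in> mor C B A. r \<bullet>\<^bsub>C\<^esub> f = idt C A)"

definition is_retraction :: "('k, 'o, 'm, 'z) linear_cat_scheme \<Rightarrow> 'o \<Rightarrow> 'o \<Rightarrow> 'm \<Rightarrow> bool" where
  "is_retraction C A B f \<longleftrightarrow> f \<in> mor C A B \<and> (\<exists>s \<in> mor C B A. f \<bullet>\<^bsub>C\<^esub> s = idt C B)"

definition is_isomorphism :: "('k, 'o, 'm, 'z) linear_cat_scheme \<Rightarrow> 'o \<Rightarrow> 'o \<Rightarrow> 'm \<Rightarrow> bool" where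
  "is_isomorphism C A B f \<longleftrightarrow> f \<in> mor C A B \<and>
    (\<exists>g \<in> mor C B A. g \<bullet>\<^bsub>C\<^esub> f = idt C A \<and> f \<bullet>\<^bsub>C\<^esub> g = idt C B)"

definition radical :: "('k, 'o, 'm, 'z) linear_cat_scheme \<Rightarrow> 'o \<Rightarrow> 'o \<Rightarrow> 'm set" where
  "radical C A B =
    {f \<in> mor C A B. \<forall>g \<in> mor C B A. is_isomorphism C A A (idt C A \<ominus>\<^bsub>Hom C A A\<^esub> g \<bullet>\<^bsub>C\<^esub> f)}"

definition left_almost_split :: "('k, 'o, 'm, 'z) linear_cat_scheme \<Rightarrow> 'o \<Rightarrow> 'o \<Rightarrow> 'm \<Rightarrow> bool" where
  "left_almost_split C A B f \<longleftrightarrow> f \<in> mor C A B \<and> \<not> is_section C A B f \<and>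
    (\<forall>Y \<in> Ob C. \<forall>g \<in> mor C A Y. \<not> is_section C A Y g \<longrightarrow> (\<exists>h \<in> mor C B Y. g = h \<bullet>\<^bsub>C\<^esub> f))"

definition right_almost_split :: "('k, 'o, 'm, 'z) linear_cat_scheme \<Rightarrow> 'o \<Rightarrow> 'o \<Rightarrow> 'm \<Rightarrow> bool" where
  "right_almost_split C A B f \<longleftrightarrow> f \<in> mor C A B \<and> \<not> is_retraction C A B f \<and>
    (\<forall>Y \<in> Ob C. \<forall>g \<in> mor C Y B. \<not> is_retraction C Y B g \<longrightarrow> (\<exists>h \<in> mor C Y A. g = f \<bullet>\<^bsub>C\<^esub> h))"

section \<open>Finiteness conditions\<close>

definition iso_class :: "('k, 'o, 'm, 'z) linear_cat_scheme \<Rightarrow> 'o \<Rightarrow> 'o set" where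
  "iso_class C A = {B \<in> Ob C. \<exists>f. is_isomorphism C A B f}"

definition indecomposable :: "('k, 'o, 'm, 'z) linear_cat_scheme \<Rightarrow> 'o \<Rightarrow> bool" where
  "indecomposable C M \<longleftrightarrow> M \<in> Ob C \<and> \<not> zero_object C M \<and>
    (\<forall>A B i1 i2 p1 p2. biproduct C A B M i1 i2 p1 p2 \<longrightarrow> zero_object C A \<or> zero_object C B)"

definition locally_finite :: "('k, 'o, 'm, 'z) linear_cat_scheme \<Rightarrow> bool" where
  "locally_finite C \<longleftrightarrow> (\<forall>M. indecomposable C M \<longrightarrow>
    finite {iso_class C Y | Y. indecomposable C Y \<and> mor C M Y \<noteq> {\<zero>\<^bsub>Hom C M Y\<^esub>}} \<and>
    finite {iso_class C Y | Y. indecomposable C Y \<and> mor C Y M \<noteq> {\<zero>\<^bsub>Hom C Y M\<^esub>}})"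

definition finite_dimensional :: "('k, 'r) ring_scheme \<Rightarrow> ('k, 'm, 's) module_scheme \<Rightarrow> bool" where
  "finite_dimensional K M \<longleftrightarrow> (\<exists>S. finite S \<and> S \<subseteq> carrier M \<and>
    (\<forall>x \<in> carrier M. \<exists>a \<in> S \<rightarrow> carrier K. x = (\<Oplus>\<^bsub>M\<^esub>s\<in>S. a s \<odot>\<^bsub>M\<^esub> s)))"

definition hom_finite ::
  "('k, 'r) ring_scheme \<Rightarrow> ('k, 'o, 'm, 'z) linear_cat_scheme \<Rightarrow> bool" where
  "hom_finite K C \<longleftrightarrow> (\<forall>A \<in> Ob C. \<forall>B \<in> Ob C. finite_dimensional K (Hom C A B))"

text \<open>A ring is local iff it is nonzero and its non-units are closed under addition.\<close>

definition local_endomorphism_ring :: "('k, 'o, 'm, 'z) linear_cat_scheme \<Rightarrow> 'o \<Rightarrow> bool" where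
  "local_endomorphism_ring C M \<longleftrightarrow> idt C M \<noteq> \<zero>\<^bsub>Hom C M M\<^esub> \<and>
    (\<forall>f \<in> mor C M M. \<forall>g \<in> mor C M M.
      \<not> is_isomorphism C M M f \<longrightarrow> \<not> is_isomorphism C M M g \<longrightarrow>
      \<not> is_isomorphism C M M (f \<oplus>\<^bsub>Hom C M M\<^esub> g))"

definition krull_schmidt :: "('k, 'o, 'm, 'z) linear_cat_scheme \<Rightarrow> bool" where
  "krull_schmidt C \<longleftrightarrow> (\<forall>A \<in> Ob C. \<exists>n Q i p.
    finite_biproduct C n Q A i p \<and> (\<forall>j<n. local_endomorphism_ring C (Q j)))"

section \<open>Angulated categories\<close>

text \<open>
  A sequence \<open>A\<^sub>0 \<rightarrow> A\<^sub>1 \<rightarrow> \<dots> \<rightarrow> A\<^bsub>d+1\<^esub> \<rightarrow> \<Sigma>A\<^sub>0\<close> is given by its objects and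
  morphisms at the indices \<open>0, \<dots>, d + 1\<close>; values at larger indices are irrelevant.
\<close>

record ('o, 'm) susp_seq =
  vtx :: "nat \<Rightarrow> 'o"
  arr :: "nat \<Rightarrow> 'm"

record ('k, 'o, 'm) angulated_cat = "('k, 'o, 'm) linear_cat" +
  susp_ob :: "'o \<Rightarrow> 'o"
  susp_mor :: "'m \<Rightarrow> 'm"
  angles :: "('o, 'm) susp_seq set"

text \<open>
  \<open>wrap\<close> continues a family indexed by \<open>0, \<dots>, d + 1\<close> past \<open>d + 1\<close> by applying the suspension,
  without a sign: index \<open>d + 2 + j\<close> carries the suspension of the entry at \<open>j\<close>. It lets the
  last square of a morphism and the last map of a mapping cone be written like the others.
\<close>

definition wrap :: "nat \<Rightarrow> ('a \<Rightarrow> 'a) \<Rightarrow> (nat \<Rightarrow> 'a) \<Rightarrow> nat \<Rightarrow> 'a" where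
  "wrap d S x i = (if i \<le> d + 1 then x i else S (x (i - (d + 2))))"

abbreviation wob :: "('k, 'o, 'm, 'z) angulated_cat_scheme \<Rightarrow> nat \<Rightarrow> ('o, 'm) susp_seq \<Rightarrow> nat \<Rightarrow> 'o" where
  "wob C d U \<equiv> wrap d (susp_ob C) (vtx U)"

abbreviation wmor :: "('k, 'o, 'm, 'z) angulated_cat_scheme \<Rightarrow> nat \<Rightarrow> (nat \<Rightarrow> 'm) \<Rightarrow> nat \<Rightarrow> 'm" where
  "wmor C d f \<equiv> wrap d (susp_mor C) f"

definition is_seq :: "('k, 'o, 'm, 'z) angulated_cat_scheme \<Rightarrow> nat \<Rightarrow> ('o, 'm) susp_seq \<Rightarrow> bool" where
  "is_seq C d U \<longleftrightarrow>
    (\<forall>i \<le> d + 1. vtx U i \<in> Ob C \<and> arr U i \<in> mor C (vtx U i) (wob C d U (i + 1)))"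

definition rotate_seq ::
  "('k, 'o, 'm, 'z) angulated_cat_scheme \<Rightarrow> nat \<Rightarrow> ('o, 'm) susp_seq \<Rightarrow> ('o, 'm) susp_seq" where
  "rotate_seq C d U =
    \<lparr>vtx = (\<lambda>i. wob C d U (i + 1)),
     arr = (\<lambda>i. if i \<le> d then arr U (i + 1)
       else if even d then susp_mor C (arr U 0)
       else \<ominus>\<^bsub>Hom C (susp_ob C (vtx U 0)) (susp_ob C (vtx U 1))\<^esub> susp_mor C (arr U 0))\<rparr>"

definition seq_morphism ::
  "('k, 'o, 'm, 'z) angulated_cat_scheme \<Rightarrow> nat \<Rightarrow> ('o, 'm) susp_seq \<Rightarrow> ('o, 'm) susp_seq \<Rightarrow>
    (nat \<Rightarrow> 'm) \<Rightarrow> bool" where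
  "seq_morphism C d U V \<phi> \<longleftrightarrow>
    (\<forall>i \<le> d + 1. \<phi> i \<in> mor C (vtx U i) (vtx V i) \<and>
      wmor C d \<phi> (i + 1) \<bullet>\<^bsub>C\<^esub> arr U i = arr V i \<bullet>\<^bsub>C\<^esub> \<phi> i)"

definition seq_isomorphic ::
  "('k, 'o, 'm, 'z) angulated_cat_scheme \<Rightarrow> nat \<Rightarrow> ('o, 'm) susp_seq \<Rightarrow> ('o, 'm) susp_seq \<Rightarrow> bool"
where
  "seq_isomorphic C d U V \<longleftrightarrow> (\<exists>\<phi>. seq_morphism C d U V \<phi> \<and>
    (\<forall>i \<le> d + 1. is_isomorphism C (vtx U i) (vtx V i) (\<phi> i)))"

text \<open>\<open>W\<close> is a direct sum of \<open>U\<close> and \<open>V\<close> in the category of sequences.\<close>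

definition seq_direct_sum ::
  "('k, 'o, 'm, 'z) angulated_cat_scheme \<Rightarrow> nat \<Rightarrow> ('o, 'm) susp_seq \<Rightarrow> ('o, 'm) susp_seq \<Rightarrow>
    ('o, 'm) susp_seq \<Rightarrow> bool" where
  "seq_direct_sum C d U V W \<longleftrightarrow> (\<exists>i1 i2 p1 p2.
    seq_morphism C d U W i1 \<and> seq_morphism C d V W i2 \<and>
    seq_morphism C d W U p1 \<and> seq_morphism C d W V p2 \<and>
    (\<forall>i \<le> d + 1. biproduct C (vtx U i) (vtx V i) (vtx W i) (i1 i) (i2 i) (p1 i) (p2 i)))"

text \<open>
  \<open>W\<close> is a mapping cone of \<open>\<phi>\<close>: its \<open>i\<close>-th object is a biproduct of \<open>A\<^bsub>i+1\<^esub>\<close> and \<open>B\<^sub>i\<close>, where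
  \<open>A\<^bsub>d+2\<^esub> = \<Sigma>A\<^sub>0\<close>, and its \<open>i\<close>-th morphism has the matrix with rows \<open>(-f\<^bsub>i+1\<^esub>, 0)\<close> and
  \<open>(\<phi>\<^bsub>i+1\<^esub>, g\<^sub>i)\<close>. The target \<open>\<Sigma>(A\<^sub>1 \<oplus> B\<^sub>0)\<close> of the last morphism is identified with
  \<open>\<Sigma>A\<^sub>1 \<oplus> \<Sigma>B\<^sub>0\<close> through the suspended injections.
\<close>

definition mapping_cone ::
  "('k, 'o, 'm, 'z) angulated_cat_scheme \<Rightarrow> nat \<Rightarrow> ('o, 'm) susp_seq \<Rightarrow> ('o, 'm) susp_seq \<Rightarrow>
    (nat \<Rightarrow> 'm) \<Rightarrow> ('o, 'm) susp_seq \<Rightarrow> bool" where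
  "mapping_cone C d U V \<phi> W \<longleftrightarrow> (\<exists>i1 i2 p1 p2. \<forall>i \<le> d + 1.
    biproduct C (wob C d U (i + 1)) (vtx V i) (vtx W i) (i1 i) (i2 i) (p1 i) (p2 i) \<and>
    arr W i =
      wmor C d i1 (i + 1) \<bullet>\<^bsub>C\<^esub>
        (\<ominus>\<^bsub>Hom C (wob C d U (i + 1)) (wob C d U (i + 2))\<^esub> wmor C d (arr U) (i + 1)) \<bullet>\<^bsub>C\<^esub> p1 i
      \<oplus>\<^bsub>Hom C (vtx W i) (wob C d W (i + 1))\<^esub>
      wmor C d i2 (i + 1) \<bullet>\<^bsub>C\<^esub>
        (wmor C d \<phi> (i + 1) \<bullet>\<^bsub>C\<^esub> p1 i
          \<oplus>\<^bsub>Hom C (vtx W i) (wob C d V (i + 1))\<^esub> arr V i \<bullet>\<^bsub>C\<^esub> p2 i))"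

text \<open>
  Zero objects and direct sums are not chosen: (N1)(b) is stated for all zero objects at the
  indices \<open>2, \<dots>, d + 1\<close> (the remaining morphisms are then forced to be zero), and (N4) asks for
  some mapping cone; closure under isomorphism makes these choices immaterial. Additivity of the
  automorphism is automatic, \<open>K\<close>-linearity is not assumed.
\<close>

locale angulated_category = additive_category K C
  for K :: "('k, 'r) ring_scheme" and C :: "('k, 'o, 'm, 'z) angulated_cat_scheme" +
  fixes d :: nat
  assumes d_pos: "1 \<le> d"
    and susp_ob_bij: "bij_betw (susp_ob C) (Ob C) (Ob C)"
    and susp_mor_bij:
      "\<lbrakk>A \<in> Ob C; B \<in> Ob C\<rbrakk>
        \<Longrightarrow> bij_betw (susp_mor C) (mor C A B) (mor C (susp_ob C A) (susp_ob C B))"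
    and susp_idt: "A \<in> Ob C \<Longrightarrow> susp_mor C (idt C A) = idt C (susp_ob C A)"
    and susp_cmp:
      "\<lbrakk>A \<in> Ob C; B \<in> Ob C; D \<in> Ob C; f \<in> mor C A B; g \<in> mor C B D\<rbrakk>
        \<Longrightarrow> susp_mor C (g \<bullet>\<^bsub>C\<^esub> f) = susp_mor C g \<bullet>\<^bsub>C\<^esub> susp_mor C f"
    and susp_add:
      "\<lbrakk>A \<in> Ob C; B \<in> Ob C; f \<in> mor C A B; g \<in> mor C A B\<rbrakk>
        \<Longrightarrow> susp_mor C (f \<oplus>\<^bsub>Hom C A B\<^esub> g) =
          susp_mor C f \<oplus>\<^bsub>Hom C (susp_ob C A) (susp_ob C B)\<^esub> susp_mor C g"
    and angles_seq: "U \<in> angles C \<Longrightarrow> is_seq C d U"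
    and N1a_iso:
      "\<lbrakk>U \<in> angles C; is_seq C d V; seq_isomorphic C d U V\<rbrakk> \<Longrightarrow> V \<in> angles C"
    and N1a_direct_sum:
      "\<lbrakk>U \<in> angles C; V \<in> angles C; is_seq C d W; seq_direct_sum C d U V W\<rbrakk> \<Longrightarrow> W \<in> angles C"
    and N1a_direct_summand:
      "\<lbrakk>W \<in> angles C; is_seq C d U; is_seq C d V; seq_direct_sum C d U V W\<rbrakk>
        \<Longrightarrow> U \<in> angles C \<and> V \<in> angles C"
    and N1b:
      "\<lbrakk>A \<in> Ob C; is_seq C d U; vtx U 0 = A; vtx U 1 = A; arr U 0 = idt C A;
        \<And>i. \<lbrakk>2 \<le> i; i \<le> d + 1\<rbrakk> \<Longrightarrow> zero_object C (vtx U i)\<rbrakk> \<Longrightarrow> U \<in> angles C"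
    and N1c:
      "\<lbrakk>A \<in> Ob C; B \<in> Ob C; f \<in> mor C A B\<rbrakk>
        \<Longrightarrow> \<exists>U \<in> angles C. vtx U 0 = A \<and> vtx U 1 = B \<and> arr U 0 = f"
    and N2: "is_seq C d U \<Longrightarrow> U \<in> angles C \<longleftrightarrow> rotate_seq C d U \<in> angles C"
    and N3:
      "\<lbrakk>U \<in> angles C; V \<in> angles C;
        \<phi>0 \<in> mor C (vtx U 0) (vtx V 0); \<phi>1 \<in> mor C (vtx U 1) (vtx V 1);
        \<phi>1 \<bullet>\<^bsub>C\<^esub> arr U 0 = arr V 0 \<bullet>\<^bsub>C\<^esub> \<phi>0\<rbrakk>
        \<Longrightarrow> \<exists>\<phi>. \<phi> 0 = \<phi>0 \<and> \<phi> 1 = \<phi>1 \<and> seq_morphism C d U V \<phi>"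
    and N4:
      "\<lbrakk>U \<in> angles C; V \<in> angles C;
        \<phi>0 \<in> mor C (vtx U 0) (vtx V 0); \<phi>1 \<in> mor C (vtx U 1) (vtx V 1);
        \<phi>1 \<bullet>\<^bsub>C\<^esub> arr U 0 = arr V 0 \<bullet>\<^bsub>C\<^esub> \<phi>0\<rbrakk>
        \<Longrightarrow> \<exists>\<phi>. \<phi> 0 = \<phi>0 \<and> \<phi> 1 = \<phi>1 \<and> seq_morphism C d U V \<phi> \<and>
          (\<exists>W. mapping_cone C d U V \<phi> W \<and> W \<in> angles C)"

text \<open>The first map being a section is equivalent to \<open>\<alpha>\<^sub>d\<close> being a retraction and to \<open>\<alpha>\<^bsub>d+1\<^esub> = 0\<close>.\<close>

definition split_angle :: "('k, 'o, 'm, 'z) angulated_cat_scheme \<Rightarrow> ('o, 'm) susp_seq \<Rightarrow> bool" where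
  "split_angle C U \<longleftrightarrow> U \<in> angles C \<and> is_section C (vtx U 0) (vtx U 1) (arr U 0)"

definition AR_angle ::
  "('k, 'o, 'm, 'z) angulated_cat_scheme \<Rightarrow> nat \<Rightarrow> ('o, 'm) susp_seq \<Rightarrow> bool" where
  "AR_angle C d U \<longleftrightarrow> U \<in> angles C \<and>
    left_almost_split C (vtx U 0) (vtx U 1) (arr U 0) \<and>
    right_almost_split C (vtx U d) (vtx U (d + 1)) (arr U d) \<and>
    (\<forall>i. 1 \<le> i \<and> i < d \<longrightarrow> arr U i \<in> radical C (vtx U i) (vtx U (i + 1)))"

section \<open>Grothendieck groups\<close>

text \<open>
  These groups are written multiplicatively in the library, so that \<open>(-1)\<^sup>i [A]\<close> becomes
  a power with exponent \<open>(-1)\<^sup>i\<close>; inside \<open>free_ab C\<close> the operation is \<^term>\<open>(+)\<close> on \<open>\<Rightarrow>\<^sub>0\<close>.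
\<close>

definition free_ab :: "('k, 'o, 'm, 'z) linear_cat_scheme \<Rightarrow> ('o set \<Rightarrow>\<^sub>0 int) monoid" where
  "free_ab C = free_Abelian_group (iso_class C ` Ob C)"

definition euler_char ::
  "('k, 'o, 'm, 'z) linear_cat_scheme \<Rightarrow> nat \<Rightarrow> ('o, 'm) susp_seq \<Rightarrow> 'o set \<Rightarrow>\<^sub>0 int" where
  "euler_char C d U = (\<Sum>i\<le>d + 1. frag_cmul ((-1) ^ i) (frag_of (iso_class C (vtx U i))))"

definition relations ::
  "('k, 'o, 'm, 'z) angulated_cat_scheme \<Rightarrow> nat \<Rightarrow> ('o set \<Rightarrow>\<^sub>0 int) set" where
  "relations C d = generate (free_ab C) {euler_char C d U | U. U \<in> angles C}"

definition split_relations ::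
  "('k, 'o, 'm, 'z) angulated_cat_scheme \<Rightarrow> nat \<Rightarrow> ('o set \<Rightarrow>\<^sub>0 int) set" where
  "split_relations C d = generate (free_ab C) {euler_char C d U | U. split_angle C U}"

definition K0 :: "('k, 'o, 'm, 'z) angulated_cat_scheme \<Rightarrow> nat \<Rightarrow> ('o set \<Rightarrow>\<^sub>0 int) set monoid" where
  "K0 C d = free_ab C Mod relations C d"

definition K0_split ::
  "('k, 'o, 'm, 'z) angulated_cat_scheme \<Rightarrow> nat \<Rightarrow> ('o set \<Rightarrow>\<^sub>0 int) set monoid" where
  "K0_split C d = free_ab C Mod split_relations C d"

text \<open>
  The canonical epimorphism sends the coset of \<open>x\<close> modulo \<open>split_relations\<close> to the coset of \<open>x\<close>
  modulo \<open>relations\<close>, see \<open>canonical_epi_coset\<close> below.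
\<close>

definition canonical_epi ::
  "('k, 'o, 'm, 'z) angulated_cat_scheme \<Rightarrow> nat \<Rightarrow> ('o set \<Rightarrow>\<^sub>0 int) set \<Rightarrow> ('o set \<Rightarrow>\<^sub>0 int) set" where
  "canonical_epi C d c = (\<Union>x\<in>c. relations C d #>\<^bsub>free_ab C\<^esub> x)"

definition ob_class ::
  "('k, 'o, 'm, 'z) angulated_cat_scheme \<Rightarrow> nat \<Rightarrow> 'o \<Rightarrow> ('o set \<Rightarrow>\<^sub>0 int) set" where
  "ob_class C d A = split_relations C d #>\<^bsub>free_ab C\<^esub> frag_of (iso_class C A)"

definition angle_class ::
  "('k, 'o, 'm, 'z) angulated_cat_scheme \<Rightarrow> nat \<Rightarrow> ('o, 'm) susp_seq \<Rightarrow> ('o set \<Rightarrow>\<^sub>0 int) set" where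
  "angle_class C d U =
    (\<Otimes>\<^bsub>K0_split C d\<^esub>i\<in>{..d + 1}. ob_class C d (vtx U i) [^]\<^bsub>K0_split C d\<^esub> ((-1) ^ i :: int))"

context angulated_category
begin

lemma comm_group_free_ab: "comm_group (free_ab C)"
  by (simp add: free_ab_def abelian_free_Abelian_group)

lemma frag_of_closed: "A \<in> Ob C \<Longrightarrow> frag_of (iso_class C A) \<in> carrier (free_ab C)"
  by (simp add: free_ab_def)

lemma euler_char_closed:
  assumes "\<And>i. i \<le> d + 1 \<Longrightarrow> vtx U i \<in> Ob C"
  shows "euler_char C d U \<in> carrier (free_ab C)"
  unfolding euler_char_def free_ab_def
  by (rule sum_closed_free_Abelian_group)
    (use assms in \<open>auto intro!: order_trans[OF keys_cmul]\<close>)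

lemma angle_vtx: "\<lbrakk>U \<in> angles C; i \<le> d + 1\<rbrakk> \<Longrightarrow> vtx U i \<in> Ob C"
  using angles_seq unfolding is_seq_def by blast

lemma relations_normal: "relations C d \<lhd> free_ab C"
proof -
  interpret F: comm_group "free_ab C" by (rule comm_group_free_ab)
  show ?thesis
    unfolding relations_def
    by (rule F.subgroup_imp_normal, rule F.generate_is_subgroup)
      (use euler_char_closed angle_vtx in blast)
qed

lemma split_relations_normal: "split_relations C d \<lhd> free_ab C"
proof -
  interpret F: comm_group "free_ab C" by (rule comm_group_free_ab)
  show ?thesis
    unfolding split_relations_def split_angle_def
    by (rule F.subgroup_imp_normal, rule F.generate_is_subgroup)
      (use euler_char_closed angle_vtx in blast)
qed

lemma split_relations_le: "split_relations C d \<subseteq> relations C d"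
proof -
  interpret F: comm_group "free_ab C" by (rule comm_group_free_ab)
  show ?thesis
    unfolding relations_def split_relations_def split_angle_def
    by (rule F.mono_generate) blast
qed

lemma comm_group_K0_split: "comm_group (K0_split C d)"
proof -
  interpret F: comm_group "free_ab C" by (rule comm_group_free_ab)
  show ?thesis
    unfolding K0_split_def
    by (rule F.abelian_FactGroup) (rule normal_imp_subgroup[OF split_relations_normal])
qed

lemma canonical_epi_coset:
  assumes x: "x \<in> carrier (free_ab C)"
  shows "canonical_epi C d (split_relations C d #>\<^bsub>free_ab C\<^esub> x) = relations C d #>\<^bsub>free_ab C\<^esub> x"
proof -
  interpret F: comm_group "free_ab C" by (rule comm_group_free_ab)
  interpret R: normal "relations C d" "free_ab C" by (rule relations_normal)
  interpret R': normal "split_relations C d" "free_ab C" by (rule split_relations_normal)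
  have *: "relations C d #>\<^bsub>free_ab C\<^esub> y = relations C d #>\<^bsub>free_ab C\<^esub> x"
    if "y \<in> split_relations C d #>\<^bsub>free_ab C\<^esub> x" for y
    using that split_relations_le
    by (intro F.repr_independence[symmetric] x R.subgroup_axioms) (auto simp: r_coset_def)
  have "x \<in> split_relations C d #>\<^bsub>free_ab C\<^esub> x"
    by (rule F.rcos_self[OF x R'.subgroup_axioms])
  with * show ?thesis
    unfolding canonical_epi_def by blast
qed

lemma canonical_epi_epi: "canonical_epi C d \<in> Group.epi (K0_split C d) (K0 C d)"
proof -
  interpret F: comm_group "free_ab C" by (rule comm_group_free_ab)
  interpret R: normal "relations C d" "free_ab C" by (rule relations_normal)
  interpret R': normal "split_relations C d" "free_ab C" by (rule split_relations_normal)
  show ?thesis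
    unfolding Group.epi_def hom_def K0_split_def K0_def carrier_FactGroup
    by (auto simp: canonical_epi_coset R.rcos_sum R'.rcos_sum image_image cong: image_cong_simp)
qed

lemma angle_class_eq_coset:
  assumes U: "U \<in> angles C"
  shows "angle_class C d U = split_relations C d #>\<^bsub>free_ab C\<^esub> euler_char C d U"
proof -
  interpret F: comm_group "free_ab C" by (rule comm_group_free_ab)
  interpret R': normal "split_relations C d" "free_ab C" by (rule split_relations_normal)
  interpret S: comm_group "K0_split C d" by (rule comm_group_K0_split)
  let ?q = "\<lambda>x. split_relations C d #>\<^bsub>free_ab C\<^esub> x"
  let ?t = "\<lambda>i. frag_cmul ((-1) ^ i) (frag_of (iso_class C (vtx U i)))"
  interpret Q: group_hom "free_ab C" "K0_split C d" ?q
    unfolding K0_split_def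
    by (intro group_hom.intro group_hom_axioms.intro R'.r_coset_hom_Mod R'.factorgroup_is_group)
      (rule F.group_axioms)
  have t: "?t i \<in> carrier (free_ab C)" if "i \<le> d + 1" for i
    using frag_of_closed[OF angle_vtx[OF U that]]
    unfolding free_ab_def by (auto intro: order_trans[OF keys_cmul])
  have q: "ob_class C d (vtx U i) [^]\<^bsub>K0_split C d\<^esub> ((-1) ^ i :: int) = ?q (?t i)"
    if "i \<le> d + 1" for i
  proof -
    have a: "frag_of (iso_class C (vtx U i)) \<in> carrier (free_ab C)"
      by (rule frag_of_closed[OF angle_vtx[OF U that]])
    have "?q (frag_of (iso_class C (vtx U i)) [^]\<^bsub>free_ab C\<^esub> ((-1) ^ i :: int)) =
        ?q (frag_of (iso_class C (vtx U i))) [^]\<^bsub>K0_split C d\<^esub> ((-1) ^ i :: int)"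
      by (rule Q.hom_int_pow[OF a])
    moreover have "frag_of (iso_class C (vtx U i)) [^]\<^bsub>free_ab C\<^esub> ((-1) ^ i :: int) = ?t i"
      using a unfolding free_ab_def by (subst int_pow_free_Abelian_group) auto
    ultimately show ?thesis by (simp add: ob_class_def)
  qed
  have "(\<Otimes>\<^bsub>K0_split C d\<^esub>i\<in>I. ob_class C d (vtx U i) [^]\<^bsub>K0_split C d\<^esub> ((-1) ^ i :: int)) =
      ?q (\<Sum>i\<in>I. ?t i)" if "finite I" "I \<subseteq> {..d + 1}" for I
    using that
  proof (induction I rule: finite_induct)
    case empty
    show ?case using Q.hom_one by (simp add: free_ab_def)
  next
    case (insert j I)
    have m: "ob_class C d (vtx U i) [^]\<^bsub>K0_split C d\<^esub> ((-1) ^ i :: int) \<in> carrier (K0_split C d)"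
      if "i \<le> d + 1" for i
      using q[OF that] Q.hom_closed[OF t[OF that]] by simp
    have s: "(\<Sum>i\<in>I. ?t i) \<in> carrier (free_ab C)"
      unfolding free_ab_def
      by (rule sum_closed_free_Abelian_group) (use t insert.prems in \<open>auto simp: free_ab_def\<close>)
    have "?q (?t j) \<otimes>\<^bsub>K0_split C d\<^esub> ?q (\<Sum>i\<in>I. ?t i) = ?q (?t j + (\<Sum>i\<in>I. ?t i))"
      using Q.hom_mult[OF t s] insert.prems by (simp add: free_ab_def)
    then show ?case
      using insert m q by (subst S.finprod_insert) (auto simp: Pi_def)
  qed
  from this[of "{..d + 1}"] show ?thesis
    unfolding angle_class_def euler_char_def by simp
qed

end

end

theory Submission
  imports Defs
begin

text \<open>
  One inclusion is immediate: the class of an Auslander-Reiten angle is the class of an angle.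
  For the other, the Euler characteristic of every angle has to be shown to lie in the group
  generated by the Euler characteristics of split angles and of Auslander-Reiten angles.

  Every angle is the rotation of an angle \<open>U : Z \<rightarrow> A \<rightarrow> \<dots>\<close> with first morphism \<open>c\<close>, and the
  induction is on the kernel of \<open>Hom(-, c)\<close>, a subfunctor of \<open>Hom(-, Z)\<close>. Because the category is
  locally finite and Hom-finite, \<open>Hom(-, Z)\<close> has finite length (\<open>ex_subfunctor_length\<close>), so this
  kernel can grow only finitely often. If \<open>c = 0\<close>, the rotation of \<open>U\<close> is split. If \<open>c \<noteq> 0\<close>, finite
  length yields \<open>g : E \<rightarrow> Z\<close> with \<open>E\<close> local such that \<open>c g \<noteq> 0\<close> is annihilated by all non-retractions
  into \<open>E\<close> (\<open>ex_socle_element\<close>) and dually \<open>h : A \<rightarrow> B\<close> with \<open>B\<close> local such that \<open>v = h c g \<noteq> 0\<close> is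
  annihilated by all non-sections out of \<open>B\<close> (\<open>ex_cosocle_element\<close>). An angle \<open>V\<close> that starts with
  \<open>v\<close> and has no superfluous trivial summands (\<open>minimal_angle\<close>) rotates to an Auslander-Reiten
  angle (\<open>ex_AR_angle\<close>). Exactness gives \<open>t : B \<rightarrow> A\<close> with \<open>t v = c g\<close>, and \<open>t\<close> is a section because
  \<open>h t v = v\<close> and \<open>B\<close> is local. So the mapping cone of \<open>(g, t) : V \<rightarrow> U\<close> contains a trivial summand
  \<open>1 : B \<rightarrow> B\<close>; removing it leaves an angle \<open>W'\<close> that starts at \<open>Z\<close>, whose kernel subfunctor contains
  that of \<open>U\<close> and also \<open>g\<close> (\<open>cone_step\<close>). Modulo split relations, the Euler characteristic of the
  rotation of \<open>U\<close> is the sum of those of the rotations of \<open>V\<close> and \<open>W'\<close> (\<open>euler_cone_step\<close>).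

  The removal of trivial summands rests on the closure of angles under direct summands and on
  the splitting of idempotents, which follows from the Krull-Schmidt property and
  Hom-finiteness (\<open>split_idempotent\<close>).
\<close>

section \<open>Arrows with domain and codomain\<close>

context linear_category
begin

abbreviation comp (infixr \<open>\<star>\<close> 75) where "g \<star> f \<equiv> g \<bullet>\<^bsub>C\<^esub> f"

text \<open>The zero morphism from \<open>A\<close> to \<open>B\<close>.\<close>

abbreviation zr where "zr A B \<equiv> \<zero>\<^bsub>Hom C A B\<^esub>"

abbreviation one where "one A \<equiv> idt C A"

text \<open>
  Hom-sets of distinct pairs of objects are disjoint, so an arrow determines its domain and
  codomain. Stating the laws with conditions on \<open>dm\<close> and \<open>cd\<close>, and with sum and negative
  that read the Hom-module off the arrow, turns them into conditional rewrite rules.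
\<close>

definition ar :: "'m \<Rightarrow> bool" where
  "ar f \<longleftrightarrow> (\<exists>A \<in> Ob C. \<exists>B \<in> Ob C. f \<in> mor C A B)"

definition dm :: "'m \<Rightarrow> 'o" where
  "dm f = (THE A. A \<in> Ob C \<and> (\<exists>B \<in> Ob C. f \<in> mor C A B))"

definition cd :: "'m \<Rightarrow> 'o" where
  "cd f = (THE B. B \<in> Ob C \<and> (\<exists>A \<in> Ob C. f \<in> mor C A B))"

definition pl :: "'m \<Rightarrow> 'm \<Rightarrow> 'm" (infixl \<open>\<boxplus>\<close> 65) where
  "f \<boxplus> g = f \<oplus>\<^bsub>Hom C (dm f) (cd f)\<^esub> g"

definition ng :: "'m \<Rightarrow> 'm" where
  "ng f = \<ominus>\<^bsub>Hom C (dm f) (cd f)\<^esub> f"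

lemma dm_eq: "\<lbrakk>A \<in> Ob C; B \<in> Ob C; f \<in> mor C A B\<rbrakk> \<Longrightarrow> dm f = A"
  unfolding dm_def by (rule the_equality) (use hom_disjoint in blast)+

lemma cd_eq: "\<lbrakk>A \<in> Ob C; B \<in> Ob C; f \<in> mor C A B\<rbrakk> \<Longrightarrow> cd f = B"
  unfolding cd_def by (rule the_equality) (use hom_disjoint in blast)+

lemma ar_cases:
  assumes "ar f"
  obtains A B where "A \<in> Ob C" "B \<in> Ob C" "f \<in> mor C A B" "dm f = A" "cd f = B"
  using assms dm_eq cd_eq unfolding ar_def by blast

lemma mor_iff: "\<lbrakk>A \<in> Ob C; B \<in> Ob C\<rbrakk> \<Longrightarrow> f \<in> mor C A B \<longleftrightarrow> ar f \<and> dm f = A \<and> cd f = B"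
  by (metis ar_cases ar_def dm_eq cd_eq)

lemma arD [simp]: "ar f \<Longrightarrow> dm f \<in> Ob C" "ar f \<Longrightarrow> cd f \<in> Ob C"
  by (auto elim: ar_cases)

lemma ar_mor: "ar f \<Longrightarrow> f \<in> mor C (dm f) (cd f)"
  by (auto elim: ar_cases)

lemma hom_group: "\<lbrakk>A \<in> Ob C; B \<in> Ob C\<rbrakk> \<Longrightarrow> abelian_group (Hom C A B)"
  using hom_module module.axioms(2) by blast

lemma one_ar [simp]: "A \<in> Ob C \<Longrightarrow> ar (one A)" "A \<in> Ob C \<Longrightarrow> dm (one A) = A"
  "A \<in> Ob C \<Longrightarrow> cd (one A) = A"
  using mor_iff idt_closed by blast+

lemma zr_closed: "\<lbrakk>A \<in> Ob C; B \<in> Ob C\<rbrakk> \<Longrightarrow> zr A B \<in> mor C A B"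
  using abelian_monoid.zero_closed abelian_group.axioms(1) hom_group by blast

lemma zr_ar [simp]: assumes "A \<in> Ob C" "B \<in> Ob C"
  shows "ar (zr A B)" "dm (zr A B) = A" "cd (zr A B) = B"
  using mor_iff zr_closed assms by blast+

lemma cmp_ar [simp]:
  assumes "ar f" "ar g" "cd f = dm g"
  shows "ar (g \<star> f)" "dm (g \<star> f) = dm f" "cd (g \<star> f) = cd g"
proof -
  have "g \<star> f \<in> mor C (dm f) (cd g)"
    by (rule cmp_closed[of _ "dm g"]) (use assms ar_mor[of f] ar_mor[of g] in auto)
  then show "ar (g \<star> f)" "dm (g \<star> f) = dm f" "cd (g \<star> f) = cd g"
    using assms mor_iff by auto
qed

lemma pl_eq: "\<lbrakk>A \<in> Ob C; B \<in> Ob C; f \<in> mor C A B\<rbrakk> \<Longrightarrow> f \<oplus>\<^bsub>Hom C A B\<^esub> g = f \<boxplus> g"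
  by (simp add: pl_def dm_eq cd_eq)

lemma ng_eq: "\<lbrakk>A \<in> Ob C; B \<in> Ob C; f \<in> mor C A B\<rbrakk> \<Longrightarrow> \<ominus>\<^bsub>Hom C A B\<^esub> f = ng f"
  by (simp add: ng_def dm_eq cd_eq)

lemma pl_ar [simp]:
  assumes "ar f" "ar g" "dm f = dm g" "cd f = cd g"
  shows "ar (f \<boxplus> g)" "dm (f \<boxplus> g) = dm g" "cd (f \<boxplus> g) = cd g"
proof -
  interpret M: abelian_group "Hom C (dm g) (cd g)" using assms hom_group by simp
  have "f \<boxplus> g \<in> mor C (dm g) (cd g)"
    unfolding pl_def using assms ar_mor[of f] ar_mor[of g] by simp
  then show "ar (f \<boxplus> g)" "dm (f \<boxplus> g) = dm g" "cd (f \<boxplus> g) = cd g"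
    using assms mor_iff by auto
qed

lemma ng_ar [simp]:
  assumes "ar f"
  shows "ar (ng f)" "dm (ng f) = dm f" "cd (ng f) = cd f"
proof -
  interpret M: abelian_group "Hom C (dm f) (cd f)" using assms hom_group by simp
  have "ng f \<in> mor C (dm f) (cd f)"
    unfolding ng_def using assms ar_mor[of f] by simp
  then show "ar (ng f)" "dm (ng f) = dm f" "cd (ng f) = cd f"
    using assms mor_iff by auto
qed

lemma assoc [simp]:
  assumes "ar f" "ar g" "ar h" "cd f = dm g" "cd g = dm h"
  shows "(h \<star> g) \<star> f = h \<star> (g \<star> f)"
  by (rule cmp_assoc[of "dm f" "dm g" "dm h" "cd h"])
    (use assms ar_mor[of f] ar_mor[of g] ar_mor[of h] in auto)

lemma cmp_one [simp]:
  "\<lbrakk>ar f; dm f = A\<rbrakk> \<Longrightarrow> f \<star> one A = f" "\<lbrakk>ar f; cd f = A\<rbrakk> \<Longrightarrow> one A \<star> f = f"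
  using ar_mor[of f] cmp_idt_left[of "dm f" "cd f"] cmp_idt_right[of "dm f" "cd f"] by auto

lemma pl_assoc:
  assumes "ar f" "ar g" "ar h" "dm f = dm g" "cd f = cd g" "dm g = dm h" "cd g = cd h"
  shows "(f \<boxplus> g) \<boxplus> h = f \<boxplus> (g \<boxplus> h)"
proof -
  interpret M: abelian_group "Hom C (dm h) (cd h)" by (rule hom_group) (simp_all add: assms)
  have "f \<in> mor C (dm h) (cd h)" "g \<in> mor C (dm h) (cd h)" "h \<in> mor C (dm h) (cd h)"
    using ar_mor[of f] ar_mor[of g] ar_mor[of h] assms by simp_all
  moreover from this have fg: "f \<oplus>\<^bsub>Hom C (dm h) (cd h)\<^esub> g \<in> mor C (dm h) (cd h)" by simp
  moreover have "dm (f \<oplus>\<^bsub>Hom C (dm h) (cd h)\<^esub> g) = dm h" "cd (f \<oplus>\<^bsub>Hom C (dm h) (cd h)\<^esub> g) = cd h"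
    using dm_eq[OF _ _ fg] cd_eq[OF _ _ fg] assms(3) by simp_all
  ultimately show ?thesis using M.a_assoc[of f g h] assms
    by (simp add: pl_def[of f] pl_def[of g] pl_def[of "f \<oplus>\<^bsub>Hom C (dm h) (cd h)\<^esub> g"])
qed

lemma pl_comm:
  assumes "ar f" "ar g" "dm f = dm g" "cd f = cd g"
  shows "f \<boxplus> g = g \<boxplus> f"
proof -
  interpret M: abelian_group "Hom C (dm g) (cd g)" by (rule hom_group) (simp_all add: assms)
  have "f \<in> mor C (dm g) (cd g)" "g \<in> mor C (dm g) (cd g)"
    using ar_mor[of f] ar_mor[of g] assms by simp_all
  then show ?thesis unfolding pl_def assms by (rule M.a_comm)
qed

lemma pl_lcomm:
  assumes "ar f" "ar g" "ar h" "dm f = dm g" "cd f = cd g" "dm g = dm h" "cd g = cd h"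
  shows "f \<boxplus> (g \<boxplus> h) = g \<boxplus> (f \<boxplus> h)"
proof -
  have "f \<boxplus> (g \<boxplus> h) = (f \<boxplus> g) \<boxplus> h" by (rule pl_assoc[symmetric]) (use assms in auto)
  also have "f \<boxplus> g = g \<boxplus> f" by (rule pl_comm) (use assms in auto)
  also have "(g \<boxplus> f) \<boxplus> h = g \<boxplus> (f \<boxplus> h)" by (rule pl_assoc) (use assms in auto)
  finally show ?thesis .
qed

lemmas pl_ac = pl_assoc pl_comm pl_lcomm

lemma pl_zr [simp]:
  assumes "ar f" "dm f = A" "cd f = B"
  shows "f \<boxplus> zr A B = f" "zr A B \<boxplus> f = f"
proof -
  interpret M: abelian_group "Hom C (dm f) (cd f)" using assms(1) by (simp add: hom_group)
  show "f \<boxplus> zr A B = f" using ar_mor[of f] assms by (auto simp: pl_def)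
  moreover have "zr A B \<boxplus> f = f \<boxplus> zr A B"
    by (rule pl_comm) (use assms arD[OF assms(1)] in auto)
  ultimately show "zr A B \<boxplus> f = f" by simp
qed

lemma pl_ng [simp]:
  assumes "ar f"
  shows "f \<boxplus> ng f = zr (dm f) (cd f)" "ng f \<boxplus> f = zr (dm f) (cd f)"
proof -
  interpret M: abelian_group "Hom C (dm f) (cd f)" using assms hom_group by simp
  show "f \<boxplus> ng f = zr (dm f) (cd f)" using ar_mor[of f] assms M.r_neg by (auto simp: pl_def ng_def)
  moreover have "ng f \<boxplus> f = f \<boxplus> ng f" by (rule pl_comm) (use assms in auto)
  ultimately show "ng f \<boxplus> f = zr (dm f) (cd f)" by simp
qed

lemma pl_ng_cancel [simp]:
  assumes "ar f" "ar g" "dm f = dm g" "cd f = cd g"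
  shows "f \<boxplus> (ng f \<boxplus> g) = g" "ng f \<boxplus> (f \<boxplus> g) = g"
  by (subst pl_assoc[symmetric]; use assms arD in simp)+

lemma pl_cancel:
  assumes "f \<boxplus> g = f \<boxplus> h" "ar f" "ar g" "ar h" "dm f = dm g" "cd f = cd g" "dm g = dm h" "cd g = cd h"
  shows "g = h"
proof -
  have "g = ng f \<boxplus> (f \<boxplus> g)" by (rule pl_ng_cancel(2)[symmetric]) (use assms(2-) in auto)
  also have "\<dots> = h" unfolding assms(1) by (rule pl_ng_cancel(2)) (use assms(2-) in auto)
  finally show ?thesis .
qed

lemma ng_unique:
  assumes "f \<boxplus> g = zr (dm f) (cd f)" "ar f" "ar g" "dm f = dm g" "cd f = cd g"
  shows "g = ng f"
  by (rule pl_cancel[of f]) (use assms in auto)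

lemma ng_ng [simp]: "ar f \<Longrightarrow> ng (ng f) = f"
  by (rule ng_unique[symmetric]) auto

lemma ng_zr [simp]: "\<lbrakk>A \<in> Ob C; B \<in> Ob C\<rbrakk> \<Longrightarrow> ng (zr A B) = zr A B"
  by (rule ng_unique[symmetric]) auto

lemma cmp_pl [simp]:
  assumes "ar f" "ar f'" "ar g" "dm f = dm f'" "cd f = cd f'" "cd f = dm g"
  shows "g \<star> (f \<boxplus> f') = g \<star> f \<boxplus> g \<star> f'"
  using assms cmp_add_right[of "dm f" "cd f" "cd g" f f' g] ar_mor[of f] ar_mor[of f'] ar_mor[of g]
  by (simp add: pl_def)

lemma pl_cmp [simp]:
  assumes "ar f" "ar g" "ar g'" "dm g = dm g'" "cd g = cd g'" "cd f = dm g"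
  shows "(g \<boxplus> g') \<star> f = g \<star> f \<boxplus> g' \<star> f"
  using assms cmp_add_left[of "dm f" "cd f" "cd g" f g g'] ar_mor[of f] ar_mor[of g] ar_mor[of g']
  by (simp add: pl_def)

lemma pl_idem: "\<lbrakk>f \<boxplus> f = f; ar f; dm f = A; cd f = B\<rbrakk> \<Longrightarrow> f = zr A B"
  by (rule pl_cancel[of f]) auto

lemma cmp_zr [simp]:
  assumes "ar f"
  shows "\<lbrakk>A \<in> Ob C; dm f = B\<rbrakk> \<Longrightarrow> f \<star> zr A B = zr A (cd f)"
    and "\<lbrakk>B \<in> Ob C; cd f = A\<rbrakk> \<Longrightarrow> zr A B \<star> f = zr (dm f) B"
proof -
  assume A: "A \<in> Ob C" and B: "dm f = B"
  have "f \<star> zr A (dm f) \<boxplus> f \<star> zr A (dm f) = f \<star> (zr A (dm f) \<boxplus> zr A (dm f))"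
    by (rule cmp_pl[symmetric]) (simp_all add: assms A)
  also have "\<dots> = f \<star> zr A (dm f)" by (simp add: assms A)
  finally have "f \<star> zr A (dm f) = zr A (cd f)" by (rule pl_idem) (simp_all add: assms A)
  then show "f \<star> zr A B = zr A (cd f)" unfolding B .
next
  assume B: "B \<in> Ob C" and A: "cd f = A"
  have "zr (cd f) B \<star> f \<boxplus> zr (cd f) B \<star> f = (zr (cd f) B \<boxplus> zr (cd f) B) \<star> f"
    by (rule pl_cmp[symmetric]) (simp_all add: assms B)
  also have "\<dots> = zr (cd f) B \<star> f" by (simp add: assms B)
  finally have "zr (cd f) B \<star> f = zr (dm f) B" by (rule pl_idem) (simp_all add: assms B)
  then show "zr A B \<star> f = zr (dm f) B" unfolding A .
qed

lemma cmp_ng [simp]: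
  assumes "ar f" "ar g" "cd f = dm g"
  shows "g \<star> ng f = ng (g \<star> f)" "ng g \<star> f = ng (g \<star> f)"
proof -
  have "g \<star> f \<boxplus> g \<star> ng f = zr (dm f) (cd g)"
    using assms by (subst cmp_pl[symmetric]) (simp_all del: cmp_pl)
  then show "g \<star> ng f = ng (g \<star> f)" using assms by (intro ng_unique) auto
  have "g \<star> f \<boxplus> ng g \<star> f = zr (dm f) (cd g)"
    using assms by (subst pl_cmp[symmetric]) (simp_all del: pl_cmp)
  then show "ng g \<star> f = ng (g \<star> f)" using assms by (intro ng_unique) auto
qed

lemma ng_pl [simp]:
  assumes "ar f" "ar g" "dm f = dm g" "cd f = cd g"
  shows "ng (f \<boxplus> g) = ng f \<boxplus> ng g"
  by (rule ng_unique[symmetric]) (use assms in \<open>simp_all add: pl_ac\<close>)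

lemma ng_inj: "\<lbrakk>ng f = ng g; ar f; ar g\<rbrakk> \<Longrightarrow> f = g"
  using ng_ng by metis

lemma minus_zr_iff:
  assumes "ar f" "ar g" "dm f = dm g" "cd f = cd g"
  shows "f \<boxplus> ng g = zr (dm f) (cd f) \<longleftrightarrow> f = g"
proof
  assume "f \<boxplus> ng g = zr (dm f) (cd f)"
  then have "ng g = ng f" by (rule ng_unique) (use assms in auto)
  then show "f = g" using ng_inj assms by metis
next
  assume e: "f = g"
  show "f \<boxplus> ng g = zr (dm f) (cd f)" unfolding e using assms(2) by simp
qed

text \<open>A composite equation may be used inside a longer composite.\<close>

lemma reassoc:
  assumes "p \<star> i = e" "ar x" "ar i" "ar p" "cd x = dm i" "cd i = dm p"
  shows "p \<star> (i \<star> x) = e \<star> x"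
  using assms assoc[of x i p] by simp

lemma is_section_iff:
  assumes "A \<in> Ob C" "B \<in> Ob C" "ar f" "dm f = A" "cd f = B"
  shows "is_section C A B f \<longleftrightarrow> (\<exists>r. ar r \<and> dm r = B \<and> cd r = A \<and> r \<star> f = one A)"
  using assms by (auto simp: is_section_def mor_iff)

lemma is_retraction_iff:
  assumes "A \<in> Ob C" "B \<in> Ob C" "ar f" "dm f = A" "cd f = B"
  shows "is_retraction C A B f \<longleftrightarrow> (\<exists>r. ar r \<and> dm r = B \<and> cd r = A \<and> f \<star> r = one B)"
  using assms by (auto simp: is_retraction_def mor_iff)

lemma is_isomorphism_iff:
  assumes "A \<in> Ob C" "B \<in> Ob C" "ar f" "dm f = A" "cd f = B"
  shows "is_isomorphism C A B f \<longleftrightarrow>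
    (\<exists>r. ar r \<and> dm r = B \<and> cd r = A \<and> f \<star> r = one B \<and> r \<star> f = one A)"
  using assms by (auto simp: is_isomorphism_def mor_iff)

lemma biproduct_iff:
  "biproduct C A B P i1 i2 p1 p2 \<longleftrightarrow>
    A \<in> Ob C \<and> B \<in> Ob C \<and> P \<in> Ob C \<and>
    (ar i1 \<and> dm i1 = A \<and> cd i1 = P) \<and> (ar i2 \<and> dm i2 = B \<and> cd i2 = P) \<and>
    (ar p1 \<and> dm p1 = P \<and> cd p1 = A) \<and> (ar p2 \<and> dm p2 = P \<and> cd p2 = B) \<and>
    p1 \<star> i1 = one A \<and> p2 \<star> i2 = one B \<and> p1 \<star> i2 = zr B A \<and> p2 \<star> i1 = zr A B \<and>
    i1 \<star> p1 \<boxplus> i2 \<star> p2 = one P"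
  unfolding biproduct_def by (auto simp: mor_iff pl_def)

text \<open>All consequences of a biproduct that serve as rewrite rules.\<close>

lemma biproductD:
  assumes "biproduct C A B P i1 i2 p1 p2"
  shows "A \<in> Ob C" "B \<in> Ob C" "P \<in> Ob C"
    "ar i1" "dm i1 = A" "cd i1 = P" "ar i2" "dm i2 = B" "cd i2 = P"
    "ar p1" "dm p1 = P" "cd p1 = A" "ar p2" "dm p2 = P" "cd p2 = B"
    "p1 \<star> i1 = one A" "p2 \<star> i2 = one B" "p1 \<star> i2 = zr B A" "p2 \<star> i1 = zr A B"
    "\<And>x. \<lbrakk>ar x; cd x = A\<rbrakk> \<Longrightarrow> p1 \<star> (i1 \<star> x) = x"
    "\<And>x. \<lbrakk>ar x; cd x = B\<rbrakk> \<Longrightarrow> p2 \<star> (i2 \<star> x) = x"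
    "\<And>x. \<lbrakk>ar x; cd x = B\<rbrakk> \<Longrightarrow> p1 \<star> (i2 \<star> x) = zr (dm x) A"
    "\<And>x. \<lbrakk>ar x; cd x = A\<rbrakk> \<Longrightarrow> p2 \<star> (i1 \<star> x) = zr (dm x) B"
proof -
  note b = assms[unfolded biproduct_iff]
  show "A \<in> Ob C" "B \<in> Ob C" "P \<in> Ob C"
    "ar i1" "dm i1 = A" "cd i1 = P" "ar i2" "dm i2 = B" "cd i2 = P"
    "ar p1" "dm p1 = P" "cd p1 = A" "ar p2" "dm p2 = P" "cd p2 = B"
    "p1 \<star> i1 = one A" "p2 \<star> i2 = one B" "p1 \<star> i2 = zr B A" "p2 \<star> i1 = zr A B"
    using b by auto
  fix x
  show "\<lbrakk>ar x; cd x = A\<rbrakk> \<Longrightarrow> p1 \<star> (i1 \<star> x) = x"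
    "\<lbrakk>ar x; cd x = B\<rbrakk> \<Longrightarrow> p2 \<star> (i2 \<star> x) = x"
    "\<lbrakk>ar x; cd x = B\<rbrakk> \<Longrightarrow> p1 \<star> (i2 \<star> x) = zr (dm x) A"
    "\<lbrakk>ar x; cd x = A\<rbrakk> \<Longrightarrow> p2 \<star> (i1 \<star> x) = zr (dm x) B"
    using b by (auto simp: reassoc[of p1 i1] reassoc[of p1 i2] reassoc[of p2 i1] reassoc[of p2 i2])
qed

lemma biproduct_expand:
  assumes "biproduct C A B P i1 i2 p1 p2" "ar x"
  shows "cd x = P \<Longrightarrow> x = i1 \<star> (p1 \<star> x) \<boxplus> i2 \<star> (p2 \<star> x)"
    and "dm x = P \<Longrightarrow> x = (x \<star> i1) \<star> p1 \<boxplus> (x \<star> i2) \<star> p2"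
proof -
  note [simp] = biproductD[OF assms(1)] assms(2)
  have e: "i1 \<star> p1 \<boxplus> i2 \<star> p2 = one P" using assms(1) biproduct_iff by blast
  show "x = i1 \<star> (p1 \<star> x) \<boxplus> i2 \<star> (p2 \<star> x)" if [simp]: "cd x = P"
    using arg_cong[OF e, of "\<lambda>y. y \<star> x"] by simp
  show "x = (x \<star> i1) \<star> p1 \<boxplus> (x \<star> i2) \<star> p2" if [simp]: "dm x = P"
    using arg_cong[OF e, of "\<lambda>y. x \<star> y"] by simp
qed

lemma biproduct_eqI:
  assumes "biproduct C A B P i1 i2 p1 p2" "ar x" "cd x = P" "ar y" "cd y = P"
    "p1 \<star> x = p1 \<star> y" "p2 \<star> x = p2 \<star> y"
  shows "x = y"
  using biproduct_expand(1)[OF assms(1)] assms by metis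

lemma biproduct_coeqI:
  assumes "biproduct C A B P i1 i2 p1 p2" "ar x" "dm x = P" "ar y" "dm y = P"
    "x \<star> i1 = y \<star> i1" "x \<star> i2 = y \<star> i2"
  shows "x = y"
  using biproduct_expand(2)[OF assms(1)] assms by metis

lemma zero_object_eq:
  assumes "zero_object C Z" "ar f" "ar g" "dm f = dm g" "cd f = cd g" "dm f = Z \<or> cd f = Z"
  shows "f = g"
proof -
  have f: "f \<in> mor C (dm f) (cd f)" "g \<in> mor C (dm f) (cd f)"
    using ar_mor[OF assms(2)] ar_mor[OF assms(3)] assms(4,5) by auto
  show ?thesis
  proof (cases "dm f = Z")
    case True
    then have "mor C (dm f) (cd f) = {zr Z (cd f)}" using assms(1,2) unfolding zero_object_def by simp
    then show ?thesis using f by simp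
  next
    case False
    then have "mor C (dm f) (cd f) = {zr (dm f) Z}"
      using assms(1,2,6) unfolding zero_object_def by simp
    then show ?thesis using f by simp
  qed
qed

lemma zero_objectI:
  assumes "Z \<in> Ob C" "one Z = zr Z Z"
  shows "zero_object C Z"
proof -
  have "f = zr Z A" if "A \<in> Ob C" "f \<in> mor C Z A" for f A
  proof -
    have f: "ar f" "dm f = Z" "cd f = A" using that mor_iff assms(1) by blast+
    have "f = f \<star> one Z" using f by simp
    also have "\<dots> = zr Z A" unfolding assms(2) using f assms(1) by simp
    finally show ?thesis .
  qed
  moreover have "f = zr A Z" if "A \<in> Ob C" "f \<in> mor C A Z" for f A
  proof -
    have f: "ar f" "dm f = A" "cd f = Z" using that mor_iff assms(1) by blast+
    have "f = one Z \<star> f" using f by simp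
    also have "\<dots> = zr A Z" unfolding assms(2) using f assms(1) by simp
    finally show ?thesis .
  qed
  ultimately show ?thesis unfolding zero_object_def using assms(1) zr_closed by blast
qed

lemma zero_biproduct:
  assumes "zero_object C Z" "A \<in> Ob C"
  shows "biproduct C Z A A (zr Z A) (one A) (zr A Z) (one A)"
proof -
  have Z: "Z \<in> Ob C" using assms(1) by (simp add: zero_object_def)
  have "zr Z Z = one Z" by (rule zero_object_eq[OF assms(1)]) (use Z in auto)
  then show ?thesis using Z assms(2) by (simp add: biproduct_iff)
qed

end

section \<open>Length functions\<close>

text \<open>
  A stand-in for dimension: a function on submodules that strictly increases along strict
  inclusions.
\<close>

definition submodule_length ::
  "('k, 'r) ring_scheme \<Rightarrow> ('k, 'm, 's) module_scheme \<Rightarrow> ('m set \<Rightarrow> nat) \<Rightarrow> bool" where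
  "submodule_length K M \<mu> \<longleftrightarrow>
    (\<forall>N N'. submodule N K M \<longrightarrow> submodule N' K M \<longrightarrow> N \<subset> N' \<longrightarrow> \<mu> N < \<mu> N')"

lemma submodule_length_mono:
  assumes "submodule_length K M \<mu>" "submodule N K M" "submodule N' K M" "N \<subseteq> N'"
  shows "\<mu> N \<le> \<mu> N'"
  using assms unfolding submodule_length_def by (cases "N = N'") (auto intro: less_imp_le)

lemma (in module) submodule_zero: "submodule N R M \<Longrightarrow> \<zero>\<^bsub>M\<^esub> \<in> N"
  using subgroup.one_closed[OF submodule.axioms(1), of N R M] by simp

lemma (in module) submodule_Int:
  "\<lbrakk>submodule N R M; submodule N' R M\<rbrakk> \<Longrightarrow> submodule (N \<inter> N') R M"
  by (rule submoduleI)
    (simp_all add: submoduleE(3-5) submodule_zero le_infI1 submoduleE(1))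

lemma (in module) submodule_zero_set: "submodule {\<zero>\<^bsub>M\<^esub>} R M"
  by (rule submoduleI) auto

lemma (in module) submodule_add_cyclic:
  assumes V: "submodule V R M" and s: "s \<in> carrier M"
  shows "submodule {a \<odot>\<^bsub>M\<^esub> s \<oplus>\<^bsub>M\<^esub> v | a v. a \<in> carrier R \<and> v \<in> V} R M" (is "submodule ?S R M")
proof -
  note Vc = subsetD[OF submoduleE(1)[OF V]]
  note Vs = submoduleE[OF V]
  show ?thesis
  proof (rule submoduleI)
    show "?S \<subseteq> carrier M"
      using Vc s by auto
    show "\<zero>\<^bsub>M\<^esub> \<in> ?S"
      using submodule_zero[OF V] s by (intro CollectI exI[of _ \<zero>] exI[of _ "\<zero>\<^bsub>M\<^esub>"]) auto
  next
    fix x assume "x \<in> ?S"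
    then obtain a v where x: "x = a \<odot>\<^bsub>M\<^esub> s \<oplus>\<^bsub>M\<^esub> v" "a \<in> carrier R" "v \<in> V" by blast
    have "\<ominus>\<^bsub>M\<^esub> x = (\<ominus> a) \<odot>\<^bsub>M\<^esub> s \<oplus>\<^bsub>M\<^esub> (\<ominus>\<^bsub>M\<^esub> v)"
      using x Vc s by (simp add: smult_l_minus M.minus_add)
    then show "\<ominus>\<^bsub>M\<^esub> x \<in> ?S"
      unfolding mem_Collect_eq using x(2,3) Vs(3)[OF x(3)] by (metis R.a_inv_closed)
  next
    fix x y assume "x \<in> ?S"
      "y \<in> ?S"
    then obtain a v b w where x: "x = a \<odot>\<^bsub>M\<^esub> s \<oplus>\<^bsub>M\<^esub> v" "a \<in> carrier R" "v \<in> V"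
      and y: "y = b \<odot>\<^bsub>M\<^esub> s \<oplus>\<^bsub>M\<^esub> w" "b \<in> carrier R" "w \<in> V" by blast
    have "x \<oplus>\<^bsub>M\<^esub> y = (a \<oplus> b) \<odot>\<^bsub>M\<^esub> s \<oplus>\<^bsub>M\<^esub> (v \<oplus>\<^bsub>M\<^esub> w)"
      using x y Vc s by (simp add: smult_l_distr M.a_ac)
    then show "x \<oplus>\<^bsub>M\<^esub> y \<in> ?S"
      unfolding mem_Collect_eq using x(2,3) y(2,3) Vs(5)[OF x(3) y(3)] by (metis R.a_closed)
  next
    fix c x assume c: "c \<in> carrier R" and "x \<in> ?S"
    then obtain a v where x: "x = a \<odot>\<^bsub>M\<^esub> s \<oplus>\<^bsub>M\<^esub> v" "a \<in> carrier R" "v \<in> V" by blast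
    have "c \<odot>\<^bsub>M\<^esub> x = (c \<otimes> a) \<odot>\<^bsub>M\<^esub> s \<oplus>\<^bsub>M\<^esub> (c \<odot>\<^bsub>M\<^esub> v)"
      using x c Vc s by (simp add: smult_r_distr smult_assoc1)
    then show "c \<odot>\<^bsub>M\<^esub> x \<in> ?S"
      unfolding mem_Collect_eq using x(2,3) Vs(4)[OF c x(3)] c by (metis R.m_closed)
  qed
qed

text \<open>
  The length function is built by adding one generator \<open>s\<close> at a time: a submodule of
  \<open>K s + V\<close> gets the length of its intersection with \<open>V\<close>, plus one if it is not contained in \<open>V\<close>.
\<close>

lemma ex_submodule_length:
  assumes "field K" and "module K M" and "finite_dimensional K M"
  shows "\<exists>\<mu>. submodule_length K M \<mu>"
proof -
  interpret K: field K by fact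
  interpret module K M by fact
  have "\<exists>V (\<mu> :: _ \<Rightarrow> nat). submodule V K M \<and>
      (\<forall>a \<in> S \<rightarrow> carrier K. (\<Oplus>\<^bsub>M\<^esub>s\<in>S. a s \<odot>\<^bsub>M\<^esub> s) \<in> V) \<and>
      (\<forall>N N'. submodule N K M \<longrightarrow> submodule N' K M \<longrightarrow> N \<subset> N' \<longrightarrow> N' \<subseteq> V \<longrightarrow> \<mu> N < \<mu> N')"
    if "finite S" "S \<subseteq> carrier M" for S
    using that
  proof (induction S rule: finite_induct)
    case empty
    show ?case
    proof (intro exI[of _ "{\<zero>\<^bsub>M\<^esub>}"] exI[of _ "\<lambda>_. 0"] conjI allI impI submodule_zero_set)
      fix N N' assume "submodule N K M" "N \<subset> N'" "N' \<subseteq> {\<zero>\<^bsub>M\<^esub>}"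
      then show "(0 :: nat) < 0" using submodule_zero by blast
    qed simp
  next
    case (insert s S)
    then have "S \<subseteq> carrier M" by simp
    from insert.IH[OF this] obtain V and \<mu> :: "_ \<Rightarrow> nat" where V: "submodule V K M"
      and sums: "\<forall>a \<in> S \<rightarrow> carrier K. (\<Oplus>\<^bsub>M\<^esub>s\<in>S. a s \<odot>\<^bsub>M\<^esub> s) \<in> V"
      and \<mu>: "\<forall>N N'. submodule N K M \<longrightarrow> submodule N' K M \<longrightarrow> N \<subset> N' \<longrightarrow> N' \<subseteq> V \<longrightarrow> \<mu> N < \<mu> N'"
      by blast
    have s: "s \<in> carrier M" using insert.prems by simp
    let ?V = "{a \<odot>\<^bsub>M\<^esub> s \<oplus>\<^bsub>M\<^esub> v | a v. a \<in> carrier K \<and> v \<in> V}"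
    let ?\<mu> = "\<lambda>N. \<mu> (N \<inter> V) + (if N \<subseteq> V then 0 else 1 :: nat)"
    note Vc = subsetD[OF submoduleE(1)[OF V]]
    show ?case
    proof (intro exI[of _ ?V] exI[of _ ?\<mu>] conjI allI impI ballI)
      show "submodule ?V K M" by (rule submodule_add_cyclic[OF V s])
    next
      fix a assume a: "a \<in> insert s S \<rightarrow> carrier K"
      have t: "a t \<odot>\<^bsub>M\<^esub> t \<in> carrier M" if "t \<in> insert s S" for t
        using that a insert.prems by auto
      have "(\<Oplus>\<^bsub>M\<^esub>s\<in>insert s S. a s \<odot>\<^bsub>M\<^esub> s) = a s \<odot>\<^bsub>M\<^esub> s \<oplus>\<^bsub>M\<^esub> (\<Oplus>\<^bsub>M\<^esub>s\<in>S. a s \<odot>\<^bsub>M\<^esub> s)"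
        using insert.hyps t by (intro M.finsum_insert) auto
      then show "(\<Oplus>\<^bsub>M\<^esub>s\<in>insert s S. a s \<odot>\<^bsub>M\<^esub> s) \<in> ?V"
        using sums a by blast
    next
      fix N N' assume N: "submodule N K M" "submodule N' K M" and lt: "N \<subset> N'" and le: "N' \<subseteq> ?V"
      have i: "submodule (N \<inter> V) K M" "submodule (N' \<inter> V) K M"
        using N V submodule_Int by blast+
      show "?\<mu> N < ?\<mu> N'"
      proof (cases "N \<inter> V = N' \<inter> V")
        case False
        then have "\<mu> (N \<inter> V) < \<mu> (N' \<inter> V)" using lt \<mu> i by blast
        moreover have "N \<subseteq> V" if "N' \<subseteq> V" using that lt by blast
        ultimately show ?thesis by auto
      next
        case True
        have "\<not> N' \<subseteq> V" using True lt by blast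
        moreover have "N \<subseteq> V"
        proof (rule ccontr)
          assume "\<not> N \<subseteq> V"
          then obtain y where y: "y \<in> N" "y \<notin> V" by blast
          obtain x where x: "x \<in> N'" "x \<notin> N" using lt by blast
          obtain a u where au: "y = a \<odot>\<^bsub>M\<^esub> s \<oplus>\<^bsub>M\<^esub> u" "a \<in> carrier K" "u \<in> V" using y lt le by blast
          obtain b v where bv: "x = b \<odot>\<^bsub>M\<^esub> s \<oplus>\<^bsub>M\<^esub> v" "b \<in> carrier K" "v \<in> V" using x le by blast
          have "a \<noteq> \<zero>\<^bsub>K\<^esub>" using au y s Vc by auto
          then have "a \<in> Units K" using au by (simp add: K.field_Units)
          define c where "c = b \<otimes>\<^bsub>K\<^esub> inv\<^bsub>K\<^esub> a"
          have c: "c \<in> carrier K" "c \<otimes>\<^bsub>K\<^esub> a = b"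
            using \<open>a \<in> Units K\<close> au bv by (simp_all add: c_def K.m_assoc)
          have cu: "c \<odot>\<^bsub>M\<^esub> u \<in> V" using c au submoduleE(4)[OF V] by blast
          have cy: "c \<odot>\<^bsub>M\<^esub> y \<in> N" using c y submoduleE(4)[OF N(1)] by blast
          \<comment> \<open>Subtracting the multiple \<open>c y\<close> removes the component of \<open>x\<close> along \<open>s\<close>.\<close>
          have cys: "c \<odot>\<^bsub>M\<^esub> y = b \<odot>\<^bsub>M\<^esub> s \<oplus>\<^bsub>M\<^esub> c \<odot>\<^bsub>M\<^esub> u"
            using c au s Vc by (simp add: smult_r_distr flip: smult_assoc1)
          have car: "v \<in> carrier M" "c \<odot>\<^bsub>M\<^esub> u \<in> carrier M" "b \<odot>\<^bsub>M\<^esub> s \<in> carrier M" "x \<in> carrier M"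
            "c \<odot>\<^bsub>M\<^esub> y \<in> carrier M"
            using bv cu Vc s x submoduleE(1)[OF N(2)] submoduleE(1)[OF N(1)] cy by auto
          have e: "x \<ominus>\<^bsub>M\<^esub> c \<odot>\<^bsub>M\<^esub> y = v \<ominus>\<^bsub>M\<^esub> c \<odot>\<^bsub>M\<^esub> u"
          proof -
            have "x \<ominus>\<^bsub>M\<^esub> c \<odot>\<^bsub>M\<^esub> y =
                (b \<odot>\<^bsub>M\<^esub> s \<oplus>\<^bsub>M\<^esub> \<ominus>\<^bsub>M\<^esub> (b \<odot>\<^bsub>M\<^esub> s)) \<oplus>\<^bsub>M\<^esub> (v \<ominus>\<^bsub>M\<^esub> c \<odot>\<^bsub>M\<^esub> u)"
              unfolding cys bv(1) M.minus_eq using car by (simp add: M.minus_add M.a_ac)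
            also have "\<dots> = v \<ominus>\<^bsub>M\<^esub> c \<odot>\<^bsub>M\<^esub> u" using car by (simp add: M.r_neg)
            finally show ?thesis .
          qed
          have "v \<ominus>\<^bsub>M\<^esub> c \<odot>\<^bsub>M\<^esub> u \<in> V"
            using bv cu submoduleE(3,5)[OF V] by (simp add: M.minus_eq)
          moreover have "x \<ominus>\<^bsub>M\<^esub> c \<odot>\<^bsub>M\<^esub> y \<in> N'"
            using x cy lt submoduleE(3,5)[OF N(2)] by (auto simp: M.minus_eq)
          ultimately have "x \<ominus>\<^bsub>M\<^esub> c \<odot>\<^bsub>M\<^esub> y \<in> N" using e True by auto
          then have "(x \<ominus>\<^bsub>M\<^esub> c \<odot>\<^bsub>M\<^esub> y) \<oplus>\<^bsub>M\<^esub> c \<odot>\<^bsub>M\<^esub> y \<in> N" using cy submoduleE(5)[OF N(1)] by blast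
          then show False using x(2) car by (simp add: M.minus_eq M.a_assoc M.l_neg)
        qed
        ultimately show ?thesis using True by simp
      qed
    qed
  qed note step = this
  obtain S where S: "finite S" "S \<subseteq> carrier M"
    "\<And>x. x \<in> carrier M \<Longrightarrow> \<exists>a \<in> S \<rightarrow> carrier K. x = (\<Oplus>\<^bsub>M\<^esub>s\<in>S. a s \<odot>\<^bsub>M\<^esub> s)"
    using assms(3) unfolding finite_dimensional_def by blast
  from step[OF S(1,2)] obtain V and \<mu> :: "_ \<Rightarrow> nat" where V:
      "\<forall>a \<in> S \<rightarrow> carrier K. (\<Oplus>\<^bsub>M\<^esub>s\<in>S. a s \<odot>\<^bsub>M\<^esub> s) \<in> V"
    and \<mu>: "\<forall>N N'. submodule N K M \<longrightarrow> submodule N' K M \<longrightarrow> N \<subset> N' \<longrightarrow> N' \<subseteq> V \<longrightarrow> \<mu> N < \<mu> N'"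
    by blast
  have "carrier M \<subseteq> V" using S(3) V by blast
  then have "submodule_length K M \<mu>"
    unfolding submodule_length_def using \<mu> submoduleE(1) by (meson order_trans)
  then show ?thesis by blast
qed

section \<open>Krull-Schmidt categories of finite length\<close>

locale krull_schmidt_category = linear_category K C
  for K :: "('k, 'r) ring_scheme" and C :: "('k, 'o, 'm, 'z) linear_cat_scheme" +
  assumes hf: "hom_finite K C" and ks: "krull_schmidt C" and lf: "locally_finite C"

context linear_category
begin

text \<open>
  The identity is the sum of the idempotents of a finite biproduct; what is closed under sums
  and contains these idempotents contains it.
\<close>

lemma one_in_by_biproduct:
  assumes fb: "finite_biproduct C n Q A i p"
    and z: "zr A A \<in> T"
    and pl: "\<And>x y. \<lbrakk>x \<in> T; y \<in> T; x \<in> mor C A A; y \<in> mor C A A\<rbrakk> \<Longrightarrow> x \<boxplus> y \<in> T"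
    and t: "\<And>j. j < n \<Longrightarrow> i j \<star> p j \<in> T"
  shows "one A \<in> T"
proof -
  have A: "A \<in> Ob C" using fb by (simp add: finite_biproduct_def)
  interpret M: abelian_group "Hom C A A" using hom_group A by blast
  have ip: "i j \<star> p j \<in> mor C A A" if "j < n" for j
    using fb that A by (auto simp: finite_biproduct_def mor_iff)
  have "m \<le> n \<Longrightarrow> (\<Oplus>\<^bsub>Hom C A A\<^esub>j\<in>{..<m}. i j \<star> p j) \<in> T \<inter> mor C A A" for m
  proof (induction m)
    case 0
    show ?case using z by simp
  next
    case (Suc m)
    have "(\<Oplus>\<^bsub>Hom C A A\<^esub>j\<in>{..<Suc m}. i j \<star> p j) =
        i m \<star> p m \<oplus>\<^bsub>Hom C A A\<^esub> (\<Oplus>\<^bsub>Hom C A A\<^esub>j\<in>{..<m}. i j \<star> p j)"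
      unfolding lessThan_Suc using ip Suc.prems by (intro M.finsum_insert) auto
    also have "\<dots> = i m \<star> p m \<boxplus> (\<Oplus>\<^bsub>Hom C A A\<^esub>j\<in>{..<m}. i j \<star> p j)"
      using pl_eq[OF A A] ip Suc.prems by simp
    finally have e: "(\<Oplus>\<^bsub>Hom C A A\<^esub>j\<in>{..<Suc m}. i j \<star> p j) =
        i m \<star> p m \<boxplus> (\<Oplus>\<^bsub>Hom C A A\<^esub>j\<in>{..<m}. i j \<star> p j)" .
    have "i m \<star> p m \<boxplus> (\<Oplus>\<^bsub>Hom C A A\<^esub>j\<in>{..<m}. i j \<star> p j) \<in> T"
      using Suc ip[of m] t[of m] by (intro pl) auto
    moreover have "i m \<star> p m \<boxplus> (\<Oplus>\<^bsub>Hom C A A\<^esub>j\<in>{..<m}. i j \<star> p j) \<in> mor C A A"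
      using Suc ip[of m] A by (simp add: mor_iff)
    ultimately show ?case unfolding e by blast
  qed
  from this[of n] show ?thesis using fb by (simp add: finite_biproduct_def)
qed

lemma finite_biproductD:
  assumes "finite_biproduct C n Q A i p" "j < n"
  shows "Q j \<in> Ob C" "ar (i j)" "dm (i j) = Q j" "cd (i j) = A" "ar (p j)" "dm (p j) = A"
    "cd (p j) = Q j" "p j \<star> i j = one (Q j)"
  using assms by (auto simp: finite_biproduct_def mor_iff)

lemma nonzero_by_biproduct:
  assumes fb: "finite_biproduct C n Q A i p"
    and f: "ar f" "dm f = A" "cd f = B" "f \<noteq> zr A B"
  shows "\<exists>j<n. f \<star> i j \<noteq> zr (Q j) B"
proof (rule ccontr)
  assume n: "\<not> (\<exists>j<n. f \<star> i j \<noteq> zr (Q j) B)"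
  have A: "A \<in> Ob C" and B: "B \<in> Ob C" using arD[OF f(1)] f by auto
  have "one A \<in> {x. ar x \<and> dm x = A \<and> cd x = A \<and> f \<star> x = zr A B}"
  proof (rule one_in_by_biproduct[OF fb])
    fix j assume j: "j < n"
    note d = finite_biproductD[OF fb j]
    have "f \<star> (i j \<star> p j) = (f \<star> i j) \<star> p j" using d f by simp
    also have "\<dots> = zr A B" using n j d B by simp
    finally show "i j \<star> p j \<in> {x. ar x \<and> dm x = A \<and> cd x = A \<and> f \<star> x = zr A B}"
      using d by simp
  qed (use A B f in auto)
  then show False using f A by simp
qed

lemma iso_sym:
  assumes "A \<in> Ob C" "B \<in> Ob C" "is_isomorphism C A B f"
  shows "\<exists>g. is_isomorphism C B A g"
  using assms unfolding is_isomorphism_def by blast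

lemma iso_class_self: "A \<in> Ob C \<Longrightarrow> A \<in> iso_class C A"
  unfolding iso_class_def
  by (auto simp: is_isomorphism_iff intro!: exI[of _ "one A"])

lemma local_cases:
  assumes E: "E \<in> Ob C" "local_endomorphism_ring C E" and f: "ar f" "dm f = E" "cd f = E"
  obtains r where "ar r" "dm r = E" "cd r = E" "f \<star> r = one E" "r \<star> f = one E"
  | r where "ar r" "dm r = E" "cd r = E" "(one E \<boxplus> ng f) \<star> r = one E"
      "r \<star> (one E \<boxplus> ng f) = one E"
proof -
  let ?g = "one E \<boxplus> ng f"
  have g: "ar ?g" "dm ?g = E" "cd ?g = E" using f E by simp_all
  have m: "f \<in> mor C E E" "?g \<in> mor C E E" using f g E mor_iff by blast+
  have "f \<boxplus> ?g = one E \<boxplus> (f \<boxplus> ng f)" by (rule pl_lcomm) (use f E in auto)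
  also have "\<dots> = one E" using f E by simp
  finally have "f \<oplus>\<^bsub>Hom C E E\<^esub> ?g = one E" using pl_eq[OF E(1) E(1)] m by simp
  moreover have "is_isomorphism C E E (one E)"
    using E by (auto simp: is_isomorphism_iff intro!: exI[of _ "one E"])
  ultimately have "is_isomorphism C E E f \<or> is_isomorphism C E E ?g"
    using E(2) m unfolding local_endomorphism_ring_def by metis
  then show ?thesis
    using that is_isomorphism_iff[OF E(1) E(1) f] is_isomorphism_iff[OF E(1) E(1) g] by blast
qed

text \<open>
  If \<open>c f = c\<close> with \<open>c\<close> nonzero and \<open>f\<close> in a local endomorphism ring, then \<open>f\<close> is invertible;
  otherwise \<open>1 - f\<close> would be, although it is annihilated by \<open>c\<close>.
\<close>

lemma local_absorb:
  assumes E: "E \<in> Ob C" "local_endomorphism_ring C E"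
    and c: "ar c" "dm c = E" "cd c = A" "c \<noteq> zr E A"
    and f: "ar f" "dm f = E" "cd f = E" "c \<star> f = c"
  obtains r where "ar r" "dm r = E" "cd r = E" "f \<star> r = one E" "r \<star> f = one E"
proof -
  have A: "A \<in> Ob C" using c by auto
  show ?thesis
  proof (rule local_cases[OF E f(1-3)])
    fix r assume r: "ar r" "dm r = E" "cd r = E" "(one E \<boxplus> ng f) \<star> r = one E"
    have "c = c \<star> ((one E \<boxplus> ng f) \<star> r)" using c r by simp
    also have "\<dots> = (c \<star> (one E \<boxplus> ng f)) \<star> r" using c r f E by (intro assoc[symmetric]) auto
    also have "c \<star> (one E \<boxplus> ng f) = zr E A" using c f E by simp
    also have "zr E A \<star> r = zr E A" using r A by simp
    finally show ?thesis using c by blast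
  qed (use that in blast)
qed

lemma local_absorb_left:
  assumes E: "E \<in> Ob C" "local_endomorphism_ring C E"
    and c: "ar c" "cd c = E" "dm c = A" "c \<noteq> zr A E"
    and f: "ar f" "dm f = E" "cd f = E" "f \<star> c = c"
  obtains r where "ar r" "dm r = E" "cd r = E" "f \<star> r = one E" "r \<star> f = one E"
proof -
  have A: "A \<in> Ob C" using c by auto
  show ?thesis
  proof (rule local_cases[OF E f(1-3)])
    fix r assume r: "ar r" "dm r = E" "cd r = E" "r \<star> (one E \<boxplus> ng f) = one E"
    have "c = (r \<star> (one E \<boxplus> ng f)) \<star> c" using c r by simp
    also have "\<dots> = r \<star> ((one E \<boxplus> ng f) \<star> c)" using c r f E by (intro assoc) auto
    also have "(one E \<boxplus> ng f) \<star> c = zr A E" using c f E by simp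
    also have "r \<star> zr A E = zr A E" using r A by simp
    finally show ?thesis using c by blast
  qed (use that in blast)
qed

lemma local_indecomposable:
  assumes E: "E \<in> Ob C" "local_endomorphism_ring C E"
  shows "indecomposable C E"
  unfolding indecomposable_def
proof (intro conjI allI impI notI)
  show "E \<in> Ob C" by fact
  assume "zero_object C E"
  then show False using E zero_object_eq[of E "one E" "zr E E"]
    unfolding local_endomorphism_ring_def by simp
next
  fix A B i1 i2 p1 p2 assume b: "biproduct C A B E i1 i2 p1 p2"
  note [simp] = biproductD[OF b]
  have s: "i1 \<star> p1 \<boxplus> i2 \<star> p2 = one E" using b by (simp add: biproduct_iff)
  have "is_isomorphism C E E (i1 \<star> p1) \<or> is_isomorphism C E E (i2 \<star> p2)"
  proof (rule ccontr)
    assume "\<not> ?thesis"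
    moreover have "i1 \<star> p1 \<in> mor C E E" "i2 \<star> p2 \<in> mor C E E" by (simp_all add: mor_iff)
    ultimately have "\<not> is_isomorphism C E E (one E)"
      using E(2) s pl_eq[OF E(1) E(1)] unfolding local_endomorphism_ring_def by metis
    moreover have "is_isomorphism C E E (one E)"
      using E by (auto simp: is_isomorphism_iff intro!: exI[of _ "one E"])
    ultimately show False by blast
  qed
  then show "zero_object C A \<or> zero_object C B"
  proof
    assume "is_isomorphism C E E (i1 \<star> p1)"
    then obtain r where r: "ar r" "dm r = E" "cd r = E" "(i1 \<star> p1) \<star> r = one E"
      using is_isomorphism_iff[of E E "i1 \<star> p1"] by auto
    have "p2 = p2 \<star> ((i1 \<star> p1) \<star> r)" unfolding r(4) by simp
    also have "\<dots> = zr E B" using r(1-3) by simp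
    finally have p: "p2 = zr E B" .
    have "one B = p2 \<star> i2" by simp
    also have "\<dots> = zr B B" unfolding p by simp
    finally show ?thesis using zero_objectI by simp
  next
    assume "is_isomorphism C E E (i2 \<star> p2)"
    then obtain r where r: "ar r" "dm r = E" "cd r = E" "(i2 \<star> p2) \<star> r = one E"
      using is_isomorphism_iff[of E E "i2 \<star> p2"] by auto
    have "p1 = p1 \<star> ((i2 \<star> p2) \<star> r)" unfolding r(4) by simp
    also have "\<dots> = zr E A" using r(1-3) by simp
    finally have p: "p1 = zr E A" .
    have "one A = p1 \<star> i1" by simp
    also have "\<dots> = zr A A" unfolding p by simp
    finally show ?thesis using zero_objectI by simp
  qed
qed

text \<open>\<open>N\<close> is a subfunctor of \<open>Hom(-, A)\<close> with values in \<open>K\<close>-modules.\<close>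

definition subfunctor :: "'o \<Rightarrow> ('o \<Rightarrow> 'm set) \<Rightarrow> bool" where
  "subfunctor A N \<longleftrightarrow> (\<forall>Y \<in> Ob C. submodule (N Y) K (Hom C Y A)) \<and>
    (\<forall>f g. ar f \<longrightarrow> ar g \<longrightarrow> cd g = dm f \<longrightarrow> f \<in> N (dm f) \<longrightarrow> f \<star> g \<in> N (dm g))"

lemma hom_submoduleI:
  assumes "Y \<in> Ob C" "A \<in> Ob C"
    and "\<And>f. f \<in> N \<Longrightarrow> ar f \<and> dm f = Y \<and> cd f = A" "zr Y A \<in> N"
    and "\<And>f g. \<lbrakk>f \<in> N; g \<in> N\<rbrakk> \<Longrightarrow> f \<boxplus> g \<in> N"
    and "\<And>f. f \<in> N \<Longrightarrow> ng f \<in> N"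
    and "\<And>a f. \<lbrakk>a \<in> carrier K; f \<in> N\<rbrakk> \<Longrightarrow> a \<odot>\<^bsub>Hom C Y A\<^esub> f \<in> N"
  shows "submodule N K (Hom C Y A)"
proof -
  interpret M: module K "Hom C Y A" using hom_module assms by blast
  have m: "f \<in> mor C Y A" if "f \<in> N" for f using assms(1-3) that mor_iff by blast
  show ?thesis
    by (rule M.submoduleI)
      (use m assms(4-7) pl_eq[OF assms(1,2)] ng_eq[OF assms(1,2)] in auto)
qed

lemma smult_ar:
  assumes "Y \<in> Ob C" "A \<in> Ob C" "a \<in> carrier K" "f \<in> mor C Y A"
  shows "ar (a \<odot>\<^bsub>Hom C Y A\<^esub> f)" "dm (a \<odot>\<^bsub>Hom C Y A\<^esub> f) = Y" "cd (a \<odot>\<^bsub>Hom C Y A\<^esub> f) = A"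
proof -
  interpret M: module K "Hom C Y A" using hom_module assms by blast
  have "a \<odot>\<^bsub>Hom C Y A\<^esub> f \<in> mor C Y A" using assms by simp
  then show "ar (a \<odot>\<^bsub>Hom C Y A\<^esub> f)" "dm (a \<odot>\<^bsub>Hom C Y A\<^esub> f) = Y" "cd (a \<odot>\<^bsub>Hom C Y A\<^esub> f) = A"
    using mor_iff assms by blast+
qed

lemma submodule_kernel:
  assumes c: "ar c" "dm c = Z" and Y: "Y \<in> Ob C"
  shows "submodule {f. ar f \<and> dm f = Y \<and> cd f = Z \<and> c \<star> f = zr Y (cd c)} K (Hom C Y Z)"
    (is "submodule ?S _ _")
proof -
  have Z: "Z \<in> Ob C" using arD c by auto
  show ?thesis
  proof (rule hom_submoduleI[OF Y Z])
    fix a f assume a: "a \<in> carrier K"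
      and "f \<in> ?S"
    then have f: "ar f" "dm f = Y" "cd f = Z" "c \<star> f = zr Y (cd c)" by auto
    have m: "f \<in> mor C Y Z" "c \<in> mor C Z (cd c)" using f c ar_mor[of f] ar_mor[of c] by auto
    have "c \<star> (a \<odot>\<^bsub>Hom C Y Z\<^esub> f) = a \<odot>\<^bsub>Hom C Y (cd c)\<^esub> (c \<star> f)"
      by (rule cmp_smult_right[OF Y Z _ a m]) (use c in simp)
    also have "\<dots> = zr Y (cd c)"
      unfolding f using module.smult_r_null[OF hom_module a] Y c by simp
    finally show "a \<odot>\<^bsub>Hom C Y Z\<^esub> f \<in> ?S"
      using smult_ar[OF Y Z a m(1)] by simp
  qed (use c Y Z in auto)
qed

lemma subfunctor_kernel:
  assumes c: "ar c" "dm c = Z"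
  shows "subfunctor Z (\<lambda>Y. {f. ar f \<and> dm f = Y \<and> cd f = Z \<and> c \<star> f = zr Y (cd c)})"
  unfolding subfunctor_def
proof (intro conjI ballI allI impI submodule_kernel[OF c])
  fix f g assume fg: "ar f" "ar g" "cd g = dm f"
    "f \<in> {fa. ar fa \<and> dm fa = dm f \<and> cd fa = Z \<and> c \<star> fa = zr (dm f) (cd c)}"
  have "c \<star> (f \<star> g) = zr (dm f) (cd c) \<star> g" by (rule reassoc) (use fg c in auto)
  also have "\<dots> = zr (dm g) (cd c)" using fg c by simp
  finally show "f \<star> g \<in> {f. ar f \<and> dm f = dm g \<and> cd f = Z \<and> c \<star> f = zr (dm g) (cd c)}"
    using fg by simp
qed

lemma subfunctor_image:
  assumes c: "ar c" "dm c = E" "cd c = A"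
  shows "subfunctor A (\<lambda>Y. {c \<star> f | f. ar f \<and> dm f = Y \<and> cd f = E})"
  unfolding subfunctor_def
proof (intro conjI ballI allI impI)
  have E: "E \<in> Ob C" and A: "A \<in> Ob C" using arD c by auto
  fix Y assume Y: "Y \<in> Ob C"
  let ?S = "{c \<star> f | f. ar f \<and> dm f = Y \<and> cd f = E}"
  show "submodule ?S K (Hom C Y A)"
  proof (rule hom_submoduleI[OF Y A])
    show "zr Y A \<in> ?S"
      using c E Y by (auto intro!: exI[of _ "zr Y E"])
  next
    fix a f assume a: "a \<in> carrier K" and "f \<in> ?S"
    then obtain g where g: "f = c \<star> g" "ar g" "dm g = Y" "cd g = E" by auto
    have m: "g \<in> mor C Y E" "c \<in> mor C E A" using g c ar_mor[of g] ar_mor[of c] by auto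
    have "a \<odot>\<^bsub>Hom C Y A\<^esub> f = c \<star> (a \<odot>\<^bsub>Hom C Y E\<^esub> g)"
      unfolding g using cmp_smult_right[OF Y E A a m] by simp
    then show "a \<odot>\<^bsub>Hom C Y A\<^esub> f \<in> ?S"
      using smult_ar[OF Y E a m(1)] by auto
  next
    fix f g assume "f \<in> ?S"
      "g \<in> ?S"
    then obtain f' g' where "f = c \<star> f'" "ar f'" "dm f' = Y" "cd f' = E"
      "g = c \<star> g'" "ar g'" "dm g' = Y" "cd g' = E" by auto
    then show "f \<boxplus> g \<in> ?S"
      using c by (auto intro!: exI[of _ "f' \<boxplus> g'"])
  next
    fix f assume "f \<in> ?S"
    then obtain f' where "f = c \<star> f'" "ar f'" "dm f' = Y" "cd f' = E" by auto
    then show "ng f \<in> ?S"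
      using c by (auto intro!: exI[of _ "ng f'"])
  qed (use c in auto)
next
  fix f g assume fg: "ar f" "ar g" "cd g = dm f" "f \<in> {c \<star> fa |fa. ar fa \<and> dm fa = dm f \<and> cd fa = E}"
  then obtain h where h: "f = c \<star> h" "ar h" "dm h = dm f" "cd h = E" by auto
  have "f \<star> g = c \<star> (h \<star> g)" unfolding h(1) by (rule assoc) (use h fg c in auto)
  then show "f \<star> g \<in> {c \<star> f |f. ar f \<and> dm f = dm g \<and> cd f = E}"
    using h fg by (auto intro!: exI[of _ "h \<star> g"])
qed

end

section \<open>Subfunctors of finite length\<close>

context linear_category
begin

lemma nonzero_by_biproduct':
  assumes fb: "finite_biproduct C n Q A i p"
    and f: "ar f" "dm f = B" "cd f = A" "f \<noteq> zr B A"
  shows "\<exists>j<n. p j \<star> f \<noteq> zr B (Q j)"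
proof (rule ccontr)
  assume n: "\<not> (\<exists>j<n. p j \<star> f \<noteq> zr B (Q j))"
  have A: "A \<in> Ob C" and B: "B \<in> Ob C" using arD[OF f(1)] f by auto
  have "one A \<in> {x. ar x \<and> dm x = A \<and> cd x = A \<and> x \<star> f = zr B A}"
  proof (rule one_in_by_biproduct[OF fb])
    fix j assume j: "j < n"
    note d = finite_biproductD[OF fb j]
    have "(i j \<star> p j) \<star> f = i j \<star> (p j \<star> f)" by (rule assoc) (use d f in auto)
    also have "\<dots> = zr B A" using n j d B by simp
    finally show "i j \<star> p j \<in> {x. ar x \<and> dm x = A \<and> cd x = A \<and> x \<star> f = zr B A}"
      using d by simp
  qed (use A B f in auto)
  then show False using f A by simp
qed

lemma not_retraction_comp:
  assumes "ar h" "ar u" "cd u = dm h" "\<not> is_retraction C (dm h) (cd h) h"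
  shows "\<not> is_retraction C (dm u) (cd h) (h \<star> u)"
proof
  assume "is_retraction C (dm u) (cd h) (h \<star> u)"
  then obtain r where r: "ar r" "dm r = cd h" "cd r = dm u" "(h \<star> u) \<star> r = one (cd h)"
    using is_retraction_iff[of "dm u" "cd h" "h \<star> u"] assms by auto
  have "h \<star> (u \<star> r) = one (cd h)" using r assms by simp
  then show False
    using assms r is_retraction_iff[of "dm h" "cd h" h] by (auto intro!: exI[of _ "u \<star> r"])
qed

end

context krull_schmidt_category
begin

lemma ex_decomposition:
  assumes "A \<in> Ob C"
  obtains n Q i p where "finite_biproduct C n Q A i p"
    "\<And>j. j < n \<Longrightarrow> local_endomorphism_ring C (Q j)"
  using ks assms unfolding krull_schmidt_def by blast

lemma ex_local_source:
  assumes f: "ar f" "dm f = A" "cd f = B" "f \<noteq> zr A B"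
  obtains Q u where "Q \<in> Ob C" "local_endomorphism_ring C Q" "ar u" "dm u = Q" "cd u = A"
    "f \<star> u \<noteq> zr Q B"
proof -
  have A: "A \<in> Ob C" using arD[OF f(1)] f by auto
  obtain n Q i p where fb: "finite_biproduct C n Q A i p"
    and l: "\<And>j. j < n \<Longrightarrow> local_endomorphism_ring C (Q j)"
    using ex_decomposition[OF A] by metis
  obtain j where "j < n" "f \<star> i j \<noteq> zr (Q j) B" using nonzero_by_biproduct[OF fb f] by blast
  then show ?thesis using that[of "Q j" "i j"] finite_biproductD[OF fb] l by blast
qed

lemma finite_indecomposables_over:
  assumes A: "A \<in> Ob C"
  shows "finite {iso_class C Y | Y. indecomposable C Y \<and> mor C Y A \<noteq> {zr Y A}}"
proof -
  obtain n Q i p where fb: "finite_biproduct C n Q A i p"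
    and l: "\<And>j. j < n \<Longrightarrow> local_endomorphism_ring C (Q j)"
    using ex_decomposition[OF A] by metis
  let ?T = "\<lambda>A. {iso_class C Y | Y. indecomposable C Y \<and> mor C Y A \<noteq> {zr Y A}}"
  have "?T A \<subseteq> (\<Union>j<n. ?T (Q j))"
  proof
    fix c assume "c \<in> ?T A"
    then obtain Y where Y: "c = iso_class C Y" "indecomposable C Y" "mor C Y A \<noteq> {zr Y A}" by blast
    have YO: "Y \<in> Ob C" using Y(2) by (simp add: indecomposable_def)
    then obtain f where f: "f \<in> mor C Y A" "f \<noteq> zr Y A" using Y(3) zr_closed A by blast
    then have f': "ar f" "dm f = Y" "cd f = A" using mor_iff A YO by blast+
    obtain j where j: "j < n" "p j \<star> f \<noteq> zr Y (Q j)"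
      using nonzero_by_biproduct'[OF fb f' f(2)] by blast
    have "p j \<star> f \<in> mor C Y (Q j)"
      using finite_biproductD[OF fb j(1)] f' YO by (simp add: mor_iff)
    then have "mor C Y (Q j) \<noteq> {zr Y (Q j)}" using j(2) by auto
    then show "c \<in> (\<Union>j<n. ?T (Q j))" using j(1) Y by blast
  qed
  moreover have "finite (?T (Q j))" if "j < n" for j
    using lf[unfolded locally_finite_def, rule_format,
        OF local_indecomposable[OF finite_biproductD(1)[OF fb that] l[OF that]]] by (rule conjunct2)
  then have "finite (\<Union>j<n. ?T (Q j))" by simp
  ultimately show ?thesis by (rule finite_subset)
qed

text \<open>
  A function on subfunctors of \<open>Hom(-, A)\<close> that increases strictly as soon as the inclusion is
  strict at some indecomposable object.
\<close>

definition subfunctor_length :: "'o \<Rightarrow> (('o \<Rightarrow> 'm set) \<Rightarrow> nat) \<Rightarrow> bool" where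
  "subfunctor_length A M \<longleftrightarrow> (\<forall>N N'. subfunctor A N \<longrightarrow> subfunctor A N' \<longrightarrow>
    (\<forall>Y \<in> Ob C. N Y \<subseteq> N' Y) \<longrightarrow> (\<exists>Y. indecomposable C Y \<and> N Y \<noteq> N' Y) \<longrightarrow> M N < M N')"

lemma subfunctor_lengthD:
  assumes "subfunctor_length A M" "subfunctor A N" "subfunctor A N'"
    "\<And>Y. Y \<in> Ob C \<Longrightarrow> N Y \<subseteq> N' Y" "indecomposable C Y" "N Y \<noteq> N' Y"
  shows "M N < M N'"
  using assms unfolding subfunctor_length_def by blast

text \<open>
  Local finiteness makes every representable functor of finite length: subfunctors are
  determined by their values at finitely many indecomposable objects.
\<close>

lemma ex_subfunctor_length:
  assumes A: "A \<in> Ob C"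
  shows "\<exists>M. subfunctor_length A M"
proof -
  let ?T = "{iso_class C Y | Y. indecomposable C Y \<and> mor C Y A \<noteq> {zr Y A}}"
  define rp where "rp c = (SOME Y. Y \<in> c)" for c :: "'o set"
  have rp: "rp c \<in> Ob C \<and> (\<exists>f. is_isomorphism C Y (rp c) f)" if "Y \<in> Ob C" "c = iso_class C Y" for Y c
    using someI_ex[of "\<lambda>Y. Y \<in> c"] iso_class_self[OF that(1)] that(2)
    unfolding rp_def iso_class_def by blast
  have "\<forall>Y \<in> Ob C. \<exists>len. submodule_length K (Hom C Y A) len"
    using ex_submodule_length[OF field_axioms hom_module] hf A unfolding hom_finite_def by blast
  then obtain len where len: "\<And>Y. Y \<in> Ob C \<Longrightarrow> submodule_length K (Hom C Y A) (len Y)" by metis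
  define M where "M N = (\<Sum>c\<in>?T. len (rp c) (N (rp c)))" for N :: "'o \<Rightarrow> 'm set"
  have "M N < M N'" if N: "subfunctor A N" and N': "subfunctor A N'" 
    and le: "\<And>Y. Y \<in> Ob C \<Longrightarrow> N Y \<subseteq> N' Y"
    and Y: "indecomposable C Y" and ne: "N Y \<noteq> N' Y" for N N' Y
  proof -
    have sm: "submodule (N D) K (Hom C D A)" "submodule (N' D) K (Hom C D A)" if "D \<in> Ob C" for D
      using N N' that unfolding subfunctor_def by blast+
    have YO: "Y \<in> Ob C" using Y by (simp add: indecomposable_def)
    interpret YA: module K "Hom C Y A" using hom_module YO A by blast
    obtain f where f: "f \<in> N' Y" "f \<notin> N Y" using ne le YO by blast
    have fm: "f \<in> mor C Y A" using f(1) YA.submoduleE(1)[OF sm(2)[OF YO]] by blast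
    have "f \<noteq> zr Y A" using f(2) YA.submodule_zero[OF sm(1)[OF YO]] by blast
    then have cT: "iso_class C Y \<in> ?T" using fm Y by blast
    let ?c = "iso_class C Y" let ?X = "rp ?c"
    obtain u where X: "?X \<in> Ob C" and u: "is_isomorphism C Y ?X u" using rp[OF YO refl] by blast
    have u': "ar u" "dm u = Y" "cd u = ?X"
      using u YO X mor_iff unfolding is_isomorphism_def by blast+
    obtain v where v: "ar v" "dm v = ?X" "cd v = Y" "v \<star> u = one Y"
      using u is_isomorphism_iff[OF YO X u'] by blast
    have fa: "ar f" "dm f = Y" "cd f = A" using fm YO A mor_iff by blast+
    have "f \<star> v \<in> N' ?X" using N' fa v f(1) unfolding subfunctor_def by metis
    moreover have "f \<star> v \<notin> N ?X"
    proof
      assume "f \<star> v \<in> N ?X"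
      then have "(f \<star> v) \<star> u \<in> N Y" using N fa v u' unfolding subfunctor_def by (metis cmp_ar(1,2))
      then show False using f(2) fa v u' by simp
    qed
    ultimately have "N ?X \<subset> N' ?X" using le X by blast
    then have "len ?X (N ?X) < len ?X (N' ?X)"
      using len[OF X] sm X unfolding submodule_length_def by blast
    moreover have "len (rp c) (N (rp c)) \<le> len (rp c) (N' (rp c))" if "c \<in> ?T" for c
    proof -
      have "rp c \<in> Ob C" using that rp unfolding indecomposable_def by blast
      then show ?thesis using submodule_length_mono[OF len] sm le by blast
    qed
    ultimately show ?thesis
      unfolding M_def using cT by (intro sum_strict_mono_ex1 finite_indecomposables_over A) blast+
  qed
  then have "subfunctor_length A M" unfolding subfunctor_length_def by blast
  then show ?thesis by blast
qed

text \<open>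
  The image of \<open>Hom(-, c)\<close> contains a simple subfunctor, generated by some \<open>c g\<close>. To find it,
  replace \<open>g\<close> by \<open>g h u\<close> as long as a non-retraction \<open>h\<close> with \<open>c g h \<noteq> 0\<close> exists; the subfunctor
  generated by \<open>c g\<close> shrinks strictly each time.
\<close>

lemma ex_socle_element:
  assumes Z: "Z \<in> Ob C" and A: "A \<in> Ob C" and c: "c \<in> mor C Z A" "c \<noteq> zr Z A"
  shows "\<exists>E g. E \<in> Ob C \<and> local_endomorphism_ring C E \<and> g \<in> mor C E Z \<and> c \<star> g \<noteq> zr E A \<and>
    (\<forall>Y \<in> Ob C. \<forall>h \<in> mor C Y E. \<not> is_retraction C Y E h \<longrightarrow> c \<star> (g \<star> h) = zr Y A)"
proof -
  have c': "ar c" "dm c = Z" "cd c = A" using c mor_iff Z A by blast+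
  obtain M where M: "subfunctor_length A M"
    using ex_subfunctor_length[OF A] by blast
  define im where "im x E = (\<lambda>Y. {x \<star> f | f. ar f \<and> dm f = Y \<and> cd f = E})" for x E
  let ?good = "\<lambda>E g. E \<in> Ob C \<and> local_endomorphism_ring C E \<and> ar g \<and> dm g = E \<and> cd g = Z \<and>
    c \<star> g \<noteq> zr E A"
  let ?goal = "\<lambda>E g. ?good E g \<and>
    (\<forall>Y \<in> Ob C. \<forall>h \<in> mor C Y E. \<not> is_retraction C Y E h \<longrightarrow> c \<star> (g \<star> h) = zr Y A)"
  have step: "\<exists>E g. ?goal E g" if "?good E g" for E g
    using that
  proof (induction "M (im (c \<star> g) E)" arbitrary: E g rule: less_induct)
    case less
    then have E: "E \<in> Ob C" "local_endomorphism_ring C E"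
      and g: "ar g" "dm g = E" "cd g = Z" and nz: "c \<star> g \<noteq> zr E A" by auto
    show ?case
    proof (cases "?goal E g")
      case False
      then obtain Y h where Y: "Y \<in> Ob C" and hm: "h \<in> mor C Y E"
        and nr: "\<not> is_retraction C Y E h" and nz': "c \<star> (g \<star> h) \<noteq> zr Y A"
        using less.prems by blast
      have h: "ar h" "dm h = Y" "cd h = E" using hm mor_iff Y E by blast+
      obtain Q u where Q: "Q \<in> Ob C" "local_endomorphism_ring C Q"
        and u: "ar u" "dm u = Q" "cd u = Y" and nz'': "(c \<star> (g \<star> h)) \<star> u \<noteq> zr Q A"
        by (rule ex_local_source[of "c \<star> (g \<star> h)" Y A]) (use c' g h nz' in auto)
      let ?g = "g \<star> (h \<star> u)"
      have good: "?good Q ?g" using Q u g h c' nz'' by simp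
      have nr': "\<not> is_retraction C Q E (h \<star> u)" using not_retraction_comp[of h u] nr h u by simp
      have "M (im (c \<star> ?g) Q) < M (im (c \<star> g) E)"
      proof (rule subfunctor_lengthD[OF M])
        show "subfunctor A (im (c \<star> ?g) Q)" "subfunctor A (im (c \<star> g) E)"
          unfolding im_def by (rule subfunctor_image; use good c' g in simp)+
        show "im (c \<star> ?g) Q Y \<subseteq> im (c \<star> g) E Y" for Y
        proof
          fix x assume "x \<in> im (c \<star> ?g) Q Y"
          then obtain s where s: "x = (c \<star> ?g) \<star> s" "ar s" "dm s = Y" "cd s = Q"
            unfolding im_def by blast
          then have "x = (c \<star> g) \<star> (h \<star> (u \<star> s))" using c' g h u by simp
          then show "x \<in> im (c \<star> g) E Y"
            unfolding im_def using s h u by (auto intro!: exI[of _ "h \<star> (u \<star> s)"])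
        qed
        show "indecomposable C E" by (rule local_indecomposable[OF E])
        have "c \<star> g \<in> im (c \<star> g) E E"
          unfolding im_def using c' g E by (auto intro!: exI[of _ "one E"])
        moreover have "c \<star> g \<notin> im (c \<star> ?g) Q E"
        proof
          assume "c \<star> g \<in> im (c \<star> ?g) Q E"
          then obtain s where s: "c \<star> g = (c \<star> ?g) \<star> s" "ar s" "dm s = E" "cd s = Q"
            unfolding im_def by blast
          have "(c \<star> g) \<star> ((h \<star> u) \<star> s) = (c \<star> ?g) \<star> s" using c' g h u s(2-) by simp
          then have e: "(c \<star> g) \<star> ((h \<star> u) \<star> s) = c \<star> g" using s(1) by metis
          obtain r where r: "ar r" "dm r = E" "cd r = E" "((h \<star> u) \<star> s) \<star> r = one E"
            by (rule local_absorb[OF E, of "c \<star> g" A "(h \<star> u) \<star> s"])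
              (use c' g h u s(2-) nz e in \<open>auto simp del: assoc\<close>)
          have "(h \<star> u) \<star> (s \<star> r) = one E" using r h u s(2-) by simp
          then show False
            using nr' is_retraction_iff[of Q E "h \<star> u"] Q E h u s(2-) r(1-3)
            by (auto intro!: exI[of _ "s \<star> r"])
        qed
        ultimately show "im (c \<star> ?g) Q E \<noteq> im (c \<star> g) E E" by metis
      qed
      from less.hyps[OF this good] show ?thesis .
    qed blast
  qed
  obtain Q u where "Q \<in> Ob C" "local_endomorphism_ring C Q" "ar u" "dm u = Q" "cd u = Z"
    "c \<star> u \<noteq> zr Q A"
    using ex_local_source[OF c' c(2)] by blast
  then obtain E g where "?goal E g" using step[of Q u] by blast
  then show ?thesis using mor_iff Z by metis
qed

text \<open>The opposite category turns statements about sources into statements about targets.\<close>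

definition opc :: "('k, 'o, 'm, 'z) linear_cat_scheme" where
  "opc = C\<lparr>Hom := (\<lambda>A B. Hom C B A), cmp := (\<lambda>g f. f \<star> g)\<rparr>"

lemma opc_simps [simp]: "Ob opc = Ob C" "Hom opc A B = Hom C B A" "g \<bullet>\<^bsub>opc\<^esub> f = f \<star> g"
  "idt opc = idt C"
  by (simp_all add: opc_def)

lemma opc_iso: "is_isomorphism opc A B f \<longleftrightarrow> is_isomorphism C B A f"
  unfolding is_isomorphism_def opc_simps by blast

lemma opc_iso_class: "A \<in> Ob C \<Longrightarrow> iso_class opc A = iso_class C A"
  unfolding iso_class_def opc_iso opc_simps using iso_sym by blast

lemma opc_zero: "zero_object opc A \<longleftrightarrow> zero_object C A"
  unfolding zero_object_def opc_simps by blast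

lemma opc_biproduct: "biproduct opc A B P i1 i2 p1 p2 \<longleftrightarrow> biproduct C A B P p1 p2 i1 i2"
  unfolding biproduct_def opc_simps by (rule iffI; elim conjE; intro conjI; assumption)

lemma opc_indecomposable: "indecomposable opc A \<longleftrightarrow> indecomposable C A"
  unfolding indecomposable_def opc_biproduct opc_zero opc_simps by blast

lemma opc_finite_biproduct: "finite_biproduct opc n Q A i p \<longleftrightarrow> finite_biproduct C n Q A p i"
proof -
  have "(\<forall>j<n. \<forall>l<n. i j \<star> p l = (if j = l then one (Q j) else zr (Q l) (Q j))) \<longleftrightarrow>
    (\<forall>j<n. \<forall>l<n. i l \<star> p j = (if j = l then one (Q j) else zr (Q j) (Q l)))" by metis
  then show ?thesis unfolding finite_biproduct_def opc_simps by blast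
qed

lemma opc_local: "local_endomorphism_ring opc A \<longleftrightarrow> local_endomorphism_ring C A"
  by (simp add: local_endomorphism_ring_def opc_iso)

lemma opc_krull_schmidt: "krull_schmidt_category K opc"
proof -
  have "linear_category_axioms K opc"
  proof (rule linear_category_axioms.intro; unfold opc_simps)
    fix A B A' B' f
    assume "A \<in> Ob C" "B \<in> Ob C" "A' \<in> Ob C" "B' \<in> Ob C" "f \<in> mor C B A" "f \<in> mor C B' A'"
    then show "A = A' \<and> B = B'" using hom_disjoint[of B A B' A' f] by simp
  next
    fix A B D E f g h
    assume "A \<in> Ob C" "B \<in> Ob C" "D \<in> Ob C" "E \<in> Ob C"
      "f \<in> mor C B A" "g \<in> mor C D B" "h \<in> mor C E D"
    then show "f \<star> g \<star> h = (f \<star> g) \<star> h" using cmp_assoc[of E D B A h g f] by simp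
  qed (rule hom_module idt_closed cmp_closed
      cmp_idt_right cmp_idt_left cmp_add_right cmp_add_left cmp_smult_right cmp_smult_left;
      assumption)+
  then have "linear_category K opc" using field_axioms by (simp add: linear_category_def)
  moreover have "hom_finite K opc" using hf by (simp add: hom_finite_def)
  moreover have "krull_schmidt opc"
    using ks unfolding krull_schmidt_def opc_finite_biproduct opc_local opc_simps by blast
  moreover have "{iso_class opc Y | Y. indecomposable opc Y \<and> P Y} =
      {iso_class C Y | Y. indecomposable C Y \<and> P Y}" for P
    unfolding opc_indecomposable using opc_iso_class by (auto simp: indecomposable_def; metis)
  then have "locally_finite opc"
    using lf unfolding locally_finite_def opc_indecomposable opc_simps by simp
  ultimately show ?thesis
    by (simp add: krull_schmidt_category_def krull_schmidt_category_axioms_def)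
qed

lemma ex_cosocle_element:
  assumes Z: "Z \<in> Ob C" and A: "A \<in> Ob C" and c: "c \<in> mor C Z A" "c \<noteq> zr Z A"
  shows "\<exists>B h. B \<in> Ob C \<and> local_endomorphism_ring C B \<and> h \<in> mor C A B \<and> h \<star> c \<noteq> zr Z B \<and>
    (\<forall>Y \<in> Ob C. \<forall>k \<in> mor C B Y. \<not> is_section C B Y k \<longrightarrow> (k \<star> h) \<star> c = zr Z Y)"
proof -
  have "is_retraction opc Y E h \<longleftrightarrow> is_section C E Y h" for Y E h
    by (simp add: is_retraction_def is_section_def)
  then show ?thesis
    using krull_schmidt_category.ex_socle_element[OF opc_krull_schmidt, of A Z c] assms
    by (simp add: opc_local)
qed

end

section \<open>Radical and idempotents\<close>

context linear_category
begin

lemma radical_iff: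
  assumes "A \<in> Ob C" "B \<in> Ob C" "ar f" "dm f = A" "cd f = B"
  shows "f \<in> radical C A B \<longleftrightarrow> (\<forall>g. ar g \<and> dm g = B \<and> cd g = A \<longrightarrow>
    (\<exists>r. ar r \<and> dm r = A \<and> cd r = A \<and> (one A \<boxplus> ng (g \<star> f)) \<star> r = one A \<and>
      r \<star> (one A \<boxplus> ng (g \<star> f)) = one A))"
proof -
  have key: "is_isomorphism C A A (one A \<ominus>\<^bsub>Hom C A A\<^esub> g \<star> f) \<longleftrightarrow>
      (\<exists>r. ar r \<and> dm r = A \<and> cd r = A \<and> (one A \<boxplus> ng (g \<star> f)) \<star> r = one A \<and>
      r \<star> (one A \<boxplus> ng (g \<star> f)) = one A)"
    if g: "ar g \<and> dm g = B \<and> cd g = A" for g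
  proof -
    have m: "g \<star> f \<in> mor C A A" "one A \<in> mor C A A" using g assms mor_iff by simp_all
    have e: "one A \<ominus>\<^bsub>Hom C A A\<^esub> g \<star> f = one A \<boxplus> ng (g \<star> f)"
      using pl_eq[OF assms(1) assms(1) m(2)] ng_eq[OF assms(1) assms(1) m(1)]
      by (simp add: a_minus_def)
    show ?thesis unfolding e by (rule is_isomorphism_iff) (use g assms in simp_all)
  qed
  have "f \<in> mor C A B" using assms mor_iff by simp
  then have "f \<in> radical C A B \<longleftrightarrow> (\<forall>g. g \<in> mor C B A \<longrightarrow>
      is_isomorphism C A A (one A \<ominus>\<^bsub>Hom C A A\<^esub> g \<star> f))"
    unfolding radical_def by blast
  also have "\<dots> \<longleftrightarrow> (\<forall>g. ar g \<and> dm g = B \<and> cd g = A \<longrightarrow>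
    (\<exists>r. ar r \<and> dm r = A \<and> cd r = A \<and> (one A \<boxplus> ng (g \<star> f)) \<star> r = one A \<and>
      r \<star> (one A \<boxplus> ng (g \<star> f)) = one A))"
    by (rule iff_allI, rule imp_cong[OF mor_iff[OF assms(2,1)]], rule key)
  finally show ?thesis .
qed

lemma radical_add:
  assumes A: "A \<in> Ob C" and B: "B \<in> Ob C"
    and f: "ar f" "dm f = A" "cd f = B" "f \<in> radical C A B"
    and f': "ar f'" "dm f' = A" "cd f' = B" "f' \<in> radical C A B"
  shows "f \<boxplus> f' \<in> radical C A B"
proof -
  have pf: "ar (f \<boxplus> f')" "dm (f \<boxplus> f') = A" "cd (f \<boxplus> f') = B" using f f' by simp_all
  show ?thesis
    unfolding radical_iff[OF A B pf]
  proof (intro allI impI, elim conjE)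
    fix g assume g: "ar g" "dm g = B" "cd g = A"
    let ?x = "one A \<boxplus> ng (g \<star> f)"
    obtain a where a: "ar a" "dm a = A" "cd a = A" "?x \<star> a = one A" "a \<star> ?x = one A"
      using f(4) g unfolding radical_iff[OF A B f(1-3)] by blast
    let ?y = "one A \<boxplus> ng ((a \<star> g) \<star> f')"
    have "ar (a \<star> g)" "dm (a \<star> g) = B" "cd (a \<star> g) = A" using a g by simp_all
    then obtain b where b: "ar b" "dm b = A" "cd b = A" "?y \<star> b = one A" "b \<star> ?y = one A"
      using f'(4) unfolding radical_iff[OF A B f'(1-3)] by blast
    have xy: "ar ?x" "dm ?x = A" "cd ?x = A" "ar ?y" "dm ?y = A" "cd ?y = A"
      using A f f' g a(1-3) by simp_all
    have gf': "ar (g \<star> f')" "dm (g \<star> f') = A" "cd (g \<star> f') = A" using f' g by simp_all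
    \<comment> \<open>The factorisation \<open>1 - g (f + f') = (1 - g f) (1 - a g f')\<close> with \<open>a\<close> inverse to \<open>1 - g f\<close>.\<close>
    have "?x \<star> ?y = ?x \<star> one A \<boxplus> ?x \<star> ng ((a \<star> g) \<star> f')"
      by (rule cmp_pl) (use xy A a(1-3) g f' in simp_all)
    also have "?x \<star> ng ((a \<star> g) \<star> f') = ng (?x \<star> (a \<star> (g \<star> f')))"
      using cmp_ng(1)[of "a \<star> (g \<star> f')" ?x] xy a(1-3) g f' by (simp del: pl_cmp)
    also have "?x \<star> (a \<star> (g \<star> f')) = one A \<star> (g \<star> f')"
      by (rule reassoc[OF a(4)]) (use xy a(1-3) gf' in simp_all)
    also have "one A \<star> (g \<star> f') = g \<star> f'" using gf' by simp
    also have "?x \<star> one A = ?x" by (rule cmp_one(1)) (use xy in simp_all)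
    also have "?x \<boxplus> ng (g \<star> f') = one A \<boxplus> ng (g \<star> (f \<boxplus> f'))"
      using A f(1-3) f'(1-3) g by (simp add: pl_assoc)
    finally have e: "?x \<star> ?y = one A \<boxplus> ng (g \<star> (f \<boxplus> f'))" .
    have "(?x \<star> ?y) \<star> (b \<star> a) = one A"
    proof -
      have "(?x \<star> ?y) \<star> (b \<star> a) = ?x \<star> (?y \<star> (b \<star> a))"
        by (rule assoc) (use xy a(1-3) b(1-3) in simp_all)
      also have "?y \<star> (b \<star> a) = one A \<star> a"
        by (rule reassoc[OF b(4)]) (use xy a(1-3) b(1-3) in simp_all)
      also have "one A \<star> a = a" using a by simp
      finally show ?thesis using a(4) by simp
    qed
    moreover have "(b \<star> a) \<star> (?x \<star> ?y) = one A"
    proof -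
      have "(b \<star> a) \<star> (?x \<star> ?y) = b \<star> (a \<star> (?x \<star> ?y))"
        by (rule assoc) (use xy a(1-3) b(1-3) in simp_all)
      also have "a \<star> (?x \<star> ?y) = one A \<star> ?y"
        by (rule reassoc[OF a(5)]) (use xy a(1-3) b(1-3) in simp_all)
      also have "one A \<star> ?y = ?y" by (rule cmp_one(2)) (use xy in simp_all)
      finally show ?thesis using b(5) by simp
    qed
    ultimately show "\<exists>r. ar r \<and> dm r = A \<and> cd r = A \<and>
        (one A \<boxplus> ng (g \<star> (f \<boxplus> f'))) \<star> r = one A \<and> r \<star> (one A \<boxplus> ng (g \<star> (f \<boxplus> f'))) = one A"
      unfolding e using a(1-3) b(1-3) by (intro exI[of _ "b \<star> a"]) simp
  qed
qed

lemma radical_comp: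
  assumes f: "ar f" "dm f = Q" "cd f = B" "f \<in> radical C Q B"
    and p: "ar p" "dm p = A" "cd p = Q"
  shows "f \<star> p \<in> radical C A B"
proof -
  have A: "A \<in> Ob C" and B: "B \<in> Ob C" and Q: "Q \<in> Ob C" using arD f p by auto
  have fp: "ar (f \<star> p)" "dm (f \<star> p) = A" "cd (f \<star> p) = B" using f p by simp_all
  show ?thesis
    unfolding radical_iff[OF A B fp]
  proof (intro allI impI, elim conjE)
    fix g assume g: "ar g" "dm g = B" "cd g = A"
    define u where "u = g \<star> f"
    have u: "ar u" "dm u = Q" "cd u = A" using f g by (simp_all add: u_def)
    have "ar (p \<star> g)" "dm (p \<star> g) = B" "cd (p \<star> g) = Q" using p g by simp_all
    then obtain s where s: "ar s" "dm s = Q" "cd s = Q"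
      "(one Q \<boxplus> ng ((p \<star> g) \<star> f)) \<star> s = one Q" "s \<star> (one Q \<boxplus> ng ((p \<star> g) \<star> f)) = one Q"
      using f(4) unfolding radical_iff[OF Q B f(1-3)] by blast
    have pu: "(p \<star> g) \<star> f = p \<star> u" using p f g by (simp add: u_def)
    have s1: "s \<boxplus> ng (p \<star> (u \<star> s)) = one Q" and s2: "s \<boxplus> ng (s \<star> (p \<star> u)) = one Q"
      using s(4,5) unfolding pu using s(1-3) u p Q by simp_all
    have gfp: "g \<star> (f \<star> p) = u \<star> p" using p f g by (simp add: u_def)
    let ?r = "one A \<boxplus> u \<star> (s \<star> p)"
    \<comment> \<open>If \<open>s\<close> is inverse to \<open>1 - p u\<close>, then \<open>1 + u s p\<close> is inverse to \<open>1 - u p\<close>.\<close>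
    have k1: "u \<star> (s \<star> p) \<boxplus> ng (u \<star> (p \<star> (u \<star> (s \<star> p)))) = u \<star> p"
    proof -
      have "u \<star> ((s \<boxplus> ng (p \<star> (u \<star> s))) \<star> p) = u \<star> p" unfolding s1 using u p by simp
      then show ?thesis using u p s(1-3) by simp
    qed
    have k2: "u \<star> (s \<star> p) \<boxplus> ng (u \<star> (s \<star> (p \<star> (u \<star> p)))) = u \<star> p"
    proof -
      have "u \<star> ((s \<boxplus> ng (s \<star> (p \<star> u))) \<star> p) = u \<star> p" unfolding s2 using u p by simp
      then show ?thesis using u p s(1-3) by simp
    qed
    have "(one A \<boxplus> ng (u \<star> p)) \<star> ?r = one A \<boxplus> (ng (u \<star> p) \<boxplus>
        (u \<star> (s \<star> p) \<boxplus> ng (u \<star> (p \<star> (u \<star> (s \<star> p))))))"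
      using u p s(1-3) A by (simp add: pl_ac)
    also have "\<dots> = one A" unfolding k1 using u p A by simp
    finally have l: "(one A \<boxplus> ng (u \<star> p)) \<star> ?r = one A" .
    have "?r \<star> (one A \<boxplus> ng (u \<star> p)) = one A \<boxplus> (ng (u \<star> p) \<boxplus>
        (u \<star> (s \<star> p) \<boxplus> ng (u \<star> (s \<star> (p \<star> (u \<star> p))))))"
      using u p s(1-3) A by (simp add: pl_ac)
    also have "\<dots> = one A" unfolding k2 using u p A by simp
    finally have r: "?r \<star> (one A \<boxplus> ng (u \<star> p)) = one A" .
    have "ar ?r" "dm ?r = A" "cd ?r = A" using u p s A by simp_all
    with l r show "\<exists>r. ar r \<and> dm r = A \<and> cd r = A \<and>
        (one A \<boxplus> ng (g \<star> (f \<star> p))) \<star> r = one A \<and> r \<star> (one A \<boxplus> ng (g \<star> (f \<star> p))) = one A"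
      unfolding gfp by blast
  qed
qed

lemma radical_zr:
  assumes "A \<in> Ob C" "B \<in> Ob C"
  shows "zr A B \<in> radical C A B"
  by (subst radical_iff[OF assms]) (use assms in \<open>auto intro!: exI[of _ "one A"]\<close>)

end

context krull_schmidt_category
begin

text \<open>A morphism outside the radical restricts to an isomorphism between local summands.\<close>

lemma not_radical:
  assumes f: "ar f" "dm f = A" "cd f = B" and nr: "f \<notin> radical C A B"
  obtains Q u r where "Q \<in> Ob C" "local_endomorphism_ring C Q" "ar u" "dm u = Q" "cd u = A"
    "ar r" "dm r = B" "cd r = Q" "r \<star> (f \<star> u) = one Q"
proof -
  have A: "A \<in> Ob C" and B: "B \<in> Ob C" using arD f by auto
  obtain n Q i p where fb: "finite_biproduct C n Q A i p"
    and l: "\<And>j. j < n \<Longrightarrow> local_endomorphism_ring C (Q j)"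
    using ex_decomposition[OF A] by metis
  have "\<exists>j<n. f \<star> i j \<notin> radical C (Q j) B"
  proof (rule ccontr)
    assume n: "\<not> ?thesis"
    let ?T = "{x. ar x \<and> dm x = A \<and> cd x = A \<and> f \<star> x \<in> radical C A B}"
    have "one A \<in> ?T"
    proof (rule one_in_by_biproduct[OF fb])
      show "zr A A \<in> ?T" using radical_zr A B f by simp
    next
      fix x y assume "x \<in> ?T" "y \<in> ?T"
      then show "x \<boxplus> y \<in> ?T" using radical_add[OF A B, of "f \<star> x" "f \<star> y"] f by simp
    next
      fix j assume j: "j < n"
      note d = finite_biproductD[OF fb j]
      have "(f \<star> i j) \<star> p j \<in> radical C A B"
        by (rule radical_comp[of _ "Q j"]) (use d f n j in auto)
      then show "i j \<star> p j \<in> ?T" using d f by simp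
    qed
    then show False using nr f by simp
  qed
  then obtain j where j: "j < n" "f \<star> i j \<notin> radical C (Q j) B" by blast
  note d = finite_biproductD[OF fb j(1)]
  have fi: "ar (f \<star> i j)" "dm (f \<star> i j) = Q j" "cd (f \<star> i j) = B" using d f by simp_all
  obtain g where g: "ar g" "dm g = B" "cd g = Q j"
    and ni: "\<And>r. \<lbrakk>ar r; dm r = Q j; cd r = Q j; (one (Q j) \<boxplus> ng (g \<star> (f \<star> i j))) \<star> r = one (Q j);
        r \<star> (one (Q j) \<boxplus> ng (g \<star> (f \<star> i j))) = one (Q j)\<rbrakk> \<Longrightarrow> False"
    using j(2) unfolding radical_iff[OF d(1) B fi] by blast
  have gfi: "ar (g \<star> (f \<star> i j))" "dm (g \<star> (f \<star> i j)) = Q j" "cd (g \<star> (f \<star> i j)) = Q j"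
    using g fi by simp_all
  show ?thesis
  proof (rule local_cases[OF d(1) l[OF j(1)] gfi])
    fix r assume r: "ar r" "dm r = Q j" "cd r = Q j" "r \<star> (g \<star> (f \<star> i j)) = one (Q j)"
    have "(r \<star> g) \<star> (f \<star> i j) = one (Q j)" using r g fi by simp
    then show ?thesis using that[of "Q j" "i j" "r \<star> g"] d l[OF j(1)] r g by simp
  qed (use ni in blast)
qed

end

locale additive_krull_schmidt_category = additive_category K C + krull_schmidt_category K C
  for K :: "('k, 'r) ring_scheme" and C :: "('k, 'o, 'm, 'z) linear_cat_scheme"
begin

text \<open>
  A nonzero idempotent is not in the radical, so a local object splits off from it; what remains
  is an idempotent with a smaller right ideal.
\<close>

lemma split_idempotent:
  assumes "ar e" "dm e = A" "cd e = A" "e \<star> e = e"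
  shows "\<exists>P i p. P \<in> Ob C \<and> ar i \<and> dm i = P \<and> cd i = A \<and> ar p \<and> dm p = A \<and> cd p = P \<and>
    p \<star> i = one P \<and> i \<star> p = e"
proof -
  have A: "A \<in> Ob C" using assms arD by auto
  obtain len where len: "submodule_length K (Hom C A A) len"
    using ex_submodule_length[OF field_axioms hom_module] hf A unfolding hom_finite_def by blast
  let ?N = "\<lambda>e. {f. ar f \<and> dm f = A \<and> cd f = A \<and> (one A \<boxplus> ng e) \<star> f = zr A A}"
  from assms show ?thesis
  proof (induction "len (?N e)" arbitrary: e rule: less_induct)
    case less
    note e = less.prems
    show ?case
    proof (cases "e = zr A A")
      case True
      obtain Z where Z: "zero_object C Z" using ex_zero_object by blast
      then have ZO: "Z \<in> Ob C" by (simp add: zero_object_def)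
      have "zr Z Z = one Z" by (rule zero_object_eq[OF Z]) (use ZO in auto)
      then show ?thesis
        using True ZO A by (intro exI[of _ Z] exI[of _ "zr Z A"] exI[of _ "zr A Z"]) simp
    next
      case False
      have "e \<notin> radical C A A"
      proof
        assume "e \<in> radical C A A"
        then obtain r where r: "ar r" "dm r = A" "cd r = A" "(one A \<boxplus> ng (one A \<star> e)) \<star> r = one A"
          unfolding radical_iff[OF A A e(1-3)] using A one_ar by blast
        have "e = e \<star> ((one A \<boxplus> ng e) \<star> r)" using r e A by (simp del: pl_cmp cmp_ng)
        also have "\<dots> = (e \<star> (one A \<boxplus> ng e)) \<star> r"
          by (rule assoc[symmetric]) (use r e A in simp_all)
        also have "e \<star> (one A \<boxplus> ng e) = zr A A" using e A by simp
        also have "zr A A \<star> r = zr A A" using r(1-3) A by simp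
        finally show False using False by blast
      qed
      then obtain Q u r where Q: "Q \<in> Ob C" "local_endomorphism_ring C Q"
        and u: "ar u" "dm u = Q" "cd u = A" and r: "ar r" "dm r = A" "cd r = Q"
        and reu: "r \<star> (e \<star> u) = one Q"
        using not_radical[OF e(1-3)] by metis
      define a where "a = e \<star> u"
      define b where "b = r \<star> e"
      have a: "ar a" "dm a = Q" "cd a = A" and b: "ar b" "dm b = A" "cd b = Q"
        using u r e by (simp_all add: a_def b_def)
      have ea: "e \<star> a = a" unfolding a_def using reassoc[OF e(4)] u e by simp
      have be: "b \<star> e = b" unfolding b_def using r e by simp
      have "b \<star> a = r \<star> (e \<star> a)" using r e a by (simp add: b_def)
      also have "\<dots> = one Q" unfolding ea using reu by (simp add: a_def)
      finally have ba: "b \<star> a = one Q" .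
      have bax: "b \<star> (a \<star> x) = x" if "ar x" "cd x = Q" for x
        using reassoc[OF ba] a b that by simp
      have eax: "e \<star> (a \<star> x) = a \<star> x" if "ar x" "cd x = Q" for x
        using reassoc[OF ea] a e that by simp
      define e' where "e' = e \<boxplus> ng (a \<star> b)"
      have e': "ar e'" "dm e' = A" "cd e' = A" using e a b by (simp_all add: e'_def)
      have e'a: "e' \<star> a = zr Q A" using e a b Q ea ba by (simp add: e'_def)
      have be': "b \<star> e' = zr A Q" using e a b A be bax by (simp add: e'_def)
      have ee': "e \<star> e' = e'" unfolding e'_def using e a b eax by simp
      have "e' \<star> e' = e' \<star> e \<boxplus> ng ((e' \<star> a) \<star> b)"
      proof -
        have "e' \<star> e' = e' \<star> (e \<boxplus> ng (a \<star> b))" by (simp only: e'_def)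
        also have "\<dots> = e' \<star> e \<boxplus> ng (e' \<star> (a \<star> b))" using e' e a b by simp
        also have "e' \<star> (a \<star> b) = (e' \<star> a) \<star> b" by (rule assoc[symmetric]) (use e' a b in simp_all)
        finally show ?thesis .
      qed
      also have "\<dots> = e' \<star> e" unfolding e'a using e' e b A by simp
      also have "\<dots> = e'" unfolding e'_def using e a b be by simp
      finally have idem: "e' \<star> e' = e'" .
      have iff: "(one A \<boxplus> ng x) \<star> f = zr A A \<longleftrightarrow> x \<star> f = f"
        if "ar x" "dm x = A" "cd x = A" "ar f" "dm f = A" "cd f = A" for x f
        using minus_zr_iff[of f "x \<star> f"] that A by auto
      have "?N e' \<subset> ?N e"
      proof
        show "?N e' \<subseteq> ?N e"
        proof
          fix f assume "f \<in> ?N e'"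
          then have f: "ar f" "dm f = A" "cd f = A" "e' \<star> f = f" using iff e' by auto
          have "e \<star> f = e \<star> (e' \<star> f)" unfolding f(4) ..
          also have "\<dots> = e' \<star> f" by (rule reassoc[OF ee']) (use e e' f in simp_all)
          finally show "f \<in> ?N e" using f iff[OF e(1-3)] by simp
        qed
        have abN: "a \<star> b \<in> ?N e" using iff[OF e(1-3), of "a \<star> b"] a b eax by simp
        have abN': "a \<star> b \<notin> ?N e'"
        proof
          assume "a \<star> b \<in> ?N e'"
          then have "e' \<star> (a \<star> b) = a \<star> b" using iff[OF e', of "a \<star> b"] a b by simp
          moreover have "e' \<star> (a \<star> b) = zr Q A \<star> b" by (rule reassoc[OF e'a]) (use e' a b in simp_all)
          ultimately have ab: "a \<star> b = zr A A" using b A by simp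
          have "one Q = b \<star> ((a \<star> b) \<star> a)" using a b ba bax Q by simp
          also have "\<dots> = zr Q Q" unfolding ab using a b A Q by simp
          finally show False using Q(2) by (simp add: local_endomorphism_ring_def)
        qed
        show "?N e' \<noteq> ?N e"
        proof
          assume e: "?N e' = ?N e"
          show False using abN' unfolding e by (rule notE[OF _ abN])
        qed
      qed
      moreover have "submodule (?N x) K (Hom C A A)" if "ar x" "dm x = A" "cd x = A" for x
        using submodule_kernel[of "one A \<boxplus> ng x" A A] that A by simp
      ultimately have "len (?N e') < len (?N e)"
        using len e(1-3) e' unfolding submodule_length_def by blast
      from less.hyps[OF this e' idem] obtain P' i' p' where P': "P' \<in> Ob C"
        and i': "ar i'" "dm i' = P'" "cd i' = A" and p': "ar p'" "dm p' = A" "cd p' = P'"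
        and p'i': "p' \<star> i' = one P'" and i'p': "i' \<star> p' = e'" by blast
      obtain P j1 j2 q1 q2 where bp: "biproduct C P' Q P j1 j2 q1 q2"
        using ex_biproduct[OF P' Q(1)] by blast
      note [simp] = biproductD[OF bp]
      have p'a: "p' \<star> a = zr Q P'"
      proof -
        have "p' \<star> (e' \<star> a) = one P' \<star> (p' \<star> a)"
          unfolding i'p'[symmetric] using reassoc[OF p'i', of "p' \<star> a"] p' i' a by simp
        then show ?thesis unfolding e'a using p' a Q P' by simp
      qed
      have bi': "b \<star> i' = zr P' Q"
      proof -
        have "(b \<star> e') \<star> i' = b \<star> i'"
          unfolding i'p'[symmetric] using p'i' p' i' b by simp
        then show ?thesis unfolding be' using i' b Q A by simp
      qed
      have p'i'x: "p' \<star> (i' \<star> x) = x" if "ar x" "cd x = P'" for x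
        using reassoc[OF p'i'] p' i' that by simp
      have p'ax: "p' \<star> (a \<star> x) = zr (dm x) P'" if "ar x" "cd x = Q" for x
        using reassoc[OF p'a] p' a that P' by simp
      have bi'x: "b \<star> (i' \<star> x) = zr (dm x) Q" if "ar x" "cd x = P'" for x
        using reassoc[OF bi'] b i' that Q by simp
      define i where "i = i' \<star> q1 \<boxplus> a \<star> q2"
      define p where "p = j1 \<star> p' \<boxplus> j2 \<star> b"
      have i: "ar i" "dm i = P" "cd i = A" and p: "ar p" "dm p = A" "cd p = P"
        using i' a p' b by (simp_all add: i_def p_def)
      have "p \<star> i = j1 \<star> q1 \<boxplus> j2 \<star> q2"
        unfolding i_def p_def using i' a p' b p'i'x p'ax bi'x bax by simp
      then have "p \<star> i = one P" using bp by (simp add: biproduct_iff)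
      moreover have "i \<star> p = i' \<star> p' \<boxplus> a \<star> b"
        unfolding i_def p_def using i' a p' b A by simp
      then have "i \<star> p = e" unfolding i'p' e'_def using e a b by (simp add: pl_ac)
      ultimately show ?thesis using i p by (intro exI[of _ P] exI[of _ i] exI[of _ p]) simp
    qed
  qed
qed

lemma ex_complement:
  assumes u: "ar u" "dm u = D" "cd u = A" and r: "ar r" "dm r = A" "cd r = D"
    and ru: "r \<star> u = one D"
  shows "\<exists>Y j q. biproduct C D Y A u j r q"
proof -
  have A: "A \<in> Ob C" and D: "D \<in> Ob C" using u arD by auto
  let ?e = "one A \<boxplus> ng (u \<star> r)"
  have e: "ar ?e" "dm ?e = A" "cd ?e = A" using A u r by simp_all
  have rux: "r \<star> (u \<star> x) = x" if "ar x" "cd x = D" for x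
    using reassoc[OF ru] u r that by simp
  have "?e \<star> ?e = ?e" using A u r rux by (simp add: pl_ac)
  then obtain Y j q where Y: "Y \<in> Ob C" and j: "ar j" "dm j = Y" "cd j = A"
    and q: "ar q" "dm q = A" "cd q = Y" and qj: "q \<star> j = one Y" and jq: "j \<star> q = ?e"
    using split_idempotent[OF e] by metis
  have "r \<star> j = r \<star> (j \<star> (q \<star> j))" using qj j r by simp
  also have "\<dots> = (r \<star> (j \<star> q)) \<star> j" using j q r by simp
  also have "r \<star> (j \<star> q) = zr A D" unfolding jq using A D u r rux by simp
  finally have rj: "r \<star> j = zr Y D" using j D by simp
  have "q \<star> u = q \<star> (j \<star> (q \<star> u))" using reassoc[OF qj, of "q \<star> u"] j q u by simp
  also have "\<dots> = q \<star> ((j \<star> q) \<star> u)" using j q u by simp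
  also have "(j \<star> q) \<star> u = zr D A" unfolding jq using A D u r ru by simp
  finally have qu: "q \<star> u = zr D Y" using q D by simp
  have "u \<star> r \<boxplus> j \<star> q = one A" unfolding jq using A u r by (simp add: pl_ac)
  then have "biproduct C D Y A u j r q"
    using A D Y u r j q qj rj qu ru by (simp add: biproduct_iff)
  then show ?thesis by blast
qed

text \<open>
  The size of an object replaces the dimension of its endomorphism algebra; it is the smallest
  value at the whole algebra of a length function on submodules.
\<close>

definition size_ob :: "'o \<Rightarrow> nat" where
  "size_ob A = (LEAST n. \<exists>len. submodule_length K (Hom C A A) len \<and> len (mor C A A) = n)"

lemma size_summand:
  assumes bp: "biproduct C D Y A u j r q" and D: "one D \<noteq> zr D D"
  shows "size_ob Y < size_ob A"
proof -
  note [simp] = biproductD[OF bp]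
  have fd: "finite_dimensional K (Hom C A A)"
    using hf biproductD(3)[OF bp] unfolding hom_finite_def by blast
  obtain len0 where "submodule_length K (Hom C A A) len0"
    using ex_submodule_length[OF field_axioms hom_module fd] by auto
  then have "\<exists>n len. submodule_length K (Hom C A A) len \<and> len (mor C A A) = n"
    by (intro exI[of _ "len0 (mor C A A)"] exI[of _ len0] conjI refl)
  then have "\<exists>len. submodule_length K (Hom C A A) len \<and> len (mor C A A) = size_ob A"
    unfolding size_ob_def by (rule LeastI_ex)
  then obtain len where len: "submodule_length K (Hom C A A) len" "len (mor C A A) = size_ob A"
    by blast
  interpret AA: module K "Hom C A A" by (rule hom_module) simp_all
  interpret YY: module K "Hom C Y Y" by (rule hom_module) simp_all
  define im where "im N = (\<lambda>f. j \<star> (f \<star> q)) ` N" for N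
  have N_ar: "ar f \<and> dm f = Y \<and> cd f = Y" if "submodule N K (Hom C Y Y)" "f \<in> N" for N f
    using YY.submoduleE(1)[OF that(1)] that(2) mor_iff[of Y Y] by auto
  have inj: "f = g" if "j \<star> (f \<star> q) = j \<star> (g \<star> q)" "ar f \<and> dm f = Y \<and> cd f = Y"
    "ar g \<and> dm g = Y \<and> cd g = Y" for f g
  proof -
    have "q \<star> ((j \<star> (f \<star> q)) \<star> j) = q \<star> ((j \<star> (g \<star> q)) \<star> j)" by (simp only: that(1))
    then show ?thesis using that(2,3) by simp
  qed
  have sm: "submodule (im N) K (Hom C A A)" if N: "submodule N K (Hom C Y Y)" for N
  proof (rule hom_submoduleI)
    show "zr A A \<in> im N"
      unfolding im_def using YY.submodule_zero[OF N] by (auto intro!: image_eqI[of _ _ "zr Y Y"])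
  next
    fix f g assume "f \<in> im N" "g \<in> im N"
    then obtain f' g' where f': "f' \<in> N" "f = j \<star> (f' \<star> q)" and g': "g' \<in> N" "g = j \<star> (g' \<star> q)"
      unfolding im_def by blast
    have m: "f' \<in> mor C Y Y" using YY.submoduleE(1)[OF N] f' by blast
    have "f' \<boxplus> g' \<in> N" using YY.submoduleE(5)[OF N f'(1) g'(1)] pl_eq[OF _ _ m] by simp
    moreover have "f \<boxplus> g = j \<star> ((f' \<boxplus> g') \<star> q)"
      using f' g' N_ar[OF N f'(1)] N_ar[OF N g'(1)] by simp
    ultimately show "f \<boxplus> g \<in> im N" unfolding im_def by blast
  next
    fix f assume "f \<in> im N"
    then obtain f' where f': "f' \<in> N" "f = j \<star> (f' \<star> q)" unfolding im_def by blast
    have m: "f' \<in> mor C Y Y" using YY.submoduleE(1)[OF N] f' by blast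
    have "ng f' \<in> N" using YY.submoduleE(3)[OF N f'(1)] ng_eq[OF _ _ m] by simp
    moreover have "ng f = j \<star> (ng f' \<star> q)" using f' N_ar[OF N f'(1)] by simp
    ultimately show "ng f \<in> im N" unfolding im_def by blast
  next
    fix a f assume a: "a \<in> carrier K" and "f \<in> im N"
    then obtain f' where f': "f' \<in> N" "f = j \<star> (f' \<star> q)" unfolding im_def by blast
    have m: "f' \<in> mor C Y Y" "q \<in> mor C A Y" "j \<in> mor C Y A" "f' \<star> q \<in> mor C A Y"
      using N_ar[OF N f'(1)] mor_iff by simp_all
    have "a \<odot>\<^bsub>Hom C A A\<^esub> f = j \<star> ((a \<odot>\<^bsub>Hom C Y Y\<^esub> f') \<star> q)"
      unfolding f' using cmp_smult_left[OF _ _ _ a m(2) m(1)] cmp_smult_right[OF _ _ _ a m(4) m(3)]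
      by simp
    then show "a \<odot>\<^bsub>Hom C A A\<^esub> f \<in> im N"
      unfolding im_def using YY.submoduleE(4)[OF N a f'(1)] by blast
  qed (use N_ar[OF N] in \<open>auto simp: im_def\<close>)
  have lt: "im N \<subset> im N'" if NN: "submodule N K (Hom C Y Y)" "submodule N' K (Hom C Y Y)" "N \<subset> N'"
    for N N'
  proof -
    obtain x where x: "x \<in> N'" "x \<notin> N" using NN(3) by blast
    have "j \<star> (x \<star> q) \<notin> im N"
    proof
      assume "j \<star> (x \<star> q) \<in> im N"
      then obtain y where y: "y \<in> N" "j \<star> (x \<star> q) = j \<star> (y \<star> q)" unfolding im_def by blast
      have "x = y" by (rule inj[OF y(2)]) (use x y N_ar NN in blast)+
      then show False using x y by blast
    qed
    then show ?thesis using x NN(3) unfolding im_def by blast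
  qed
  have len': "submodule_length K (Hom C Y Y) (\<lambda>N. len (im N))"
    unfolding submodule_length_def
  proof (intro allI impI)
    fix N N' assume N: "submodule N K (Hom C Y Y)" "submodule N' K (Hom C Y Y)" "N \<subset> N'"
    show "len (im N) < len (im N')"
      using len(1) lt[OF N] sm[OF N(1)] sm[OF N(2)] unfolding submodule_length_def by blast
  qed
  have "size_ob Y \<le> len (im (mor C Y Y))"
    unfolding size_ob_def by (rule Least_le) (rule exI[of _ "\<lambda>N. len (im N)"], rule conjI[OF len' refl])
  also have "\<dots> < len (mor C A A)"
  proof -
    have s: "submodule (im (mor C Y Y)) K (Hom C A A)" by (rule sm[OF YY.carrier_is_submodule])
    have "one A \<notin> im (mor C Y Y)"
    proof
      assume "one A \<in> im (mor C Y Y)"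
      then obtain f where f: "f \<in> mor C Y Y" "one A = j \<star> (f \<star> q)" unfolding im_def by blast
      have f': "ar f" "dm f = Y" "cd f = Y" using f(1) mor_iff[of Y Y] by auto
      have "one D = r \<star> (one A \<star> u)" by simp
      also have "\<dots> = zr D D" unfolding f(2) using f' by simp
      finally show False using D by blast
    qed
    moreover have "one A \<in> mor C A A" by (rule idt_closed) simp
    moreover have "im (mor C Y Y) \<subseteq> mor C A A" by (rule AA.submoduleE(1)[OF s])
    ultimately have "im (mor C Y Y) \<subset> mor C A A" by (metis psubsetI)
    then show ?thesis
      by (rule len(1)[unfolded submodule_length_def, rule_format, OF s AA.carrier_is_submodule])
  qed
  finally show ?thesis using len(2) by simp
qed

end

section \<open>Angles\<close>

lemma wrap_simps [simp]:
  "i \<le> Suc d \<Longrightarrow> wrap d S x i = x i"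
  "wrap d S x (Suc (Suc d)) = S (x 0)"
  "wrap d S x (Suc (Suc (Suc d))) = S (x (Suc 0))"
  by (simp_all add: wrap_def)

context angulated_category
begin

abbreviation SO where "SO \<equiv> susp_ob C"
abbreviation SM where "SM \<equiv> susp_mor C"

lemma SO_Ob [simp]: "A \<in> Ob C \<Longrightarrow> SO A \<in> Ob C"
  using susp_ob_bij by (auto simp: bij_betw_def)

lemma SO_surj: "A \<in> Ob C \<Longrightarrow> \<exists>B \<in> Ob C. SO B = A"
  using susp_ob_bij unfolding bij_betw_def by (metis imageE)

lemma SM_ar [simp]:
  assumes "ar f"
  shows "ar (SM f)" "dm (SM f) = SO (dm f)" "cd (SM f) = SO (cd f)"
proof -
  have o: "dm f \<in> Ob C" "cd f \<in> Ob C" using assms by simp_all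
  have "SM f \<in> mor C (SO (dm f)) (SO (cd f))"
    using susp_mor_bij[OF o] ar_mor[OF assms] by (meson bij_betw_apply)
  then show "ar (SM f)" "dm (SM f) = SO (dm f)" "cd (SM f) = SO (cd f)"
    using mor_iff o by simp_all
qed

lemma SM_cmp [simp]: "\<lbrakk>ar f; ar g; cd f = dm g\<rbrakk> \<Longrightarrow> SM (g \<star> f) = SM g \<star> SM f"
  using susp_cmp[of "dm f" "dm g" "cd g" f g] ar_mor[of f] ar_mor[of g] by simp

lemma SM_pl [simp]:
  assumes "ar f" "ar g" "dm f = dm g" "cd f = cd g"
  shows "SM (f \<boxplus> g) = SM f \<boxplus> SM g"
  using susp_add[of "dm g" "cd g" f g] ar_mor[of f] ar_mor[of g] assms
  by (simp add: pl_def)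

lemma SM_one [simp]: "A \<in> Ob C \<Longrightarrow> SM (one A) = one (SO A)"
  by (rule susp_idt)

lemma SM_zr [simp]:
  assumes "A \<in> Ob C" "B \<in> Ob C"
  shows "SM (zr A B) = zr (SO A) (SO B)"
proof -
  have "SM (zr A B) \<boxplus> SM (zr A B) = SM (zr A B \<boxplus> zr A B)"
    by (rule SM_pl[symmetric]) (use assms in simp_all)
  also have "zr A B \<boxplus> zr A B = zr A B" using assms by simp
  finally show ?thesis by (rule pl_idem) (use assms in simp_all)
qed

lemma SM_ng [simp]:
  assumes "ar f"
  shows "SM (ng f) = ng (SM f)"
proof (rule ng_unique)
  have "SM f \<boxplus> SM (ng f) = SM (f \<boxplus> ng f)" by (rule SM_pl[symmetric]) (use assms in simp_all)
  then show "SM f \<boxplus> SM (ng f) = zr (dm (SM f)) (cd (SM f))" using assms by simp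
qed (use assms in simp_all)

lemma SM_inj:
  assumes "SM f = SM g" "ar f" "ar g" "dm f = dm g" "cd f = cd g"
  shows "f = g"
proof -
  have "inj_on SM (mor C (dm g) (cd g))"
    using susp_mor_bij[of "dm g" "cd g"] assms by (simp add: bij_betw_def)
  moreover have "f \<in> mor C (dm g) (cd g)" "g \<in> mor C (dm g) (cd g)"
    using ar_mor[of f] ar_mor[of g] assms by simp_all
  ultimately show ?thesis using assms(1) by (simp add: inj_on_def)
qed

lemma SM_surj:
  assumes "ar h" "dm h = SO A" "cd h = SO B" "A \<in> Ob C" "B \<in> Ob C"
  obtains f where "ar f" "dm f = A" "cd f = B" "SM f = h"
proof -
  have "h \<in> mor C (SO A) (SO B)" using assms mor_iff by simp
  then have "h \<in> SM ` mor C A B" using susp_mor_bij[OF assms(4,5)] by (simp add: bij_betw_def)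
  then obtain f where "f \<in> mor C A B" "SM f = h" by blast
  then show ?thesis using that mor_iff assms(4,5) by blast
qed

lemma SO_zero:
  assumes "zero_object C Z"
  shows "zero_object C (SO Z)"
proof -
  have Z: "Z \<in> Ob C" using assms by (simp add: zero_object_def)
  have "one Z = zr Z Z" by (rule zero_object_eq[OF assms]) (use Z in auto)
  then have "SM (one Z) = SM (zr Z Z)" by (rule arg_cong)
  then show ?thesis using Z by (intro zero_objectI) simp_all
qed

lemma SM_biproduct:
  assumes "biproduct C A B P i1 i2 p1 p2"
  shows "biproduct C (SO A) (SO B) (SO P) (SM i1) (SM i2) (SM p1) (SM p2)"
proof -
  note [simp] = biproductD[OF assms]
  have e: "i1 \<star> p1 \<boxplus> i2 \<star> p2 = one P" using assms by (simp add: biproduct_iff)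
  have "SM (p1 \<star> i1) = SM (one A)" "SM (p2 \<star> i2) = SM (one B)" "SM (p1 \<star> i2) = SM (zr B A)"
    "SM (p2 \<star> i1) = SM (zr A B)" "SM (i1 \<star> p1 \<boxplus> i2 \<star> p2) = SM (one P)"
    using e by simp_all
  then have "SM p1 \<star> SM i1 = one (SO A)" "SM p2 \<star> SM i2 = one (SO B)"
    "SM p1 \<star> SM i2 = zr (SO B) (SO A)" "SM p2 \<star> SM i1 = zr (SO A) (SO B)"
    "SM i1 \<star> SM p1 \<boxplus> SM i2 \<star> SM p2 = one (SO P)"
    by (simp_all del: biproductD(16-19)[OF assms])
  then show ?thesis by (simp add: biproduct_iff)
qed

lemma seqD:
  assumes "is_seq C d U"
  shows "i \<le> Suc d \<Longrightarrow> vtx U i \<in> Ob C" "i \<le> Suc d \<Longrightarrow> ar (arr U i)"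
    "i \<le> Suc d \<Longrightarrow> dm (arr U i) = vtx U i" "i \<le> d \<Longrightarrow> cd (arr U i) = vtx U (Suc i)"
    "cd (arr U (Suc d)) = SO (vtx U 0)"
proof -
  have O: "vtx U i \<in> Ob C" if "i \<le> Suc d" for i using assms that by (simp add: is_seq_def)
  have w: "wob C d U (Suc i) \<in> Ob C" if "i \<le> Suc d" for i
  proof (cases "i = Suc d")
    case True then show ?thesis using O[of 0] by simp
  next
    case False then show ?thesis using O[of "Suc i"] that by simp
  qed
  have m: "arr U i \<in> mor C (vtx U i) (wob C d U (Suc i))" if "i \<le> Suc d" for i
    using assms that by (simp add: is_seq_def)
  have a: "ar (arr U i) \<and> dm (arr U i) = vtx U i \<and> cd (arr U i) = wob C d U (Suc i)" if "i \<le> Suc d" for i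
    using m[OF that] mor_iff[OF O[OF that] w[OF that]] by blast
  show "i \<le> Suc d \<Longrightarrow> vtx U i \<in> Ob C" "i \<le> Suc d \<Longrightarrow> ar (arr U i)"
    "i \<le> Suc d \<Longrightarrow> dm (arr U i) = vtx U i" "i \<le> d \<Longrightarrow> cd (arr U i) = vtx U (Suc i)"
    "cd (arr U (Suc d)) = SO (vtx U 0)"
    using O a[of i] a[of "Suc d"] by auto
qed

lemma seqI:
  assumes "\<And>i. i \<le> Suc d \<Longrightarrow> vtx U i \<in> Ob C" "\<And>i. i \<le> Suc d \<Longrightarrow> ar (arr U i)"
    "\<And>i. i \<le> Suc d \<Longrightarrow> dm (arr U i) = vtx U i" "\<And>i. i \<le> d \<Longrightarrow> cd (arr U i) = vtx U (Suc i)"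
    "cd (arr U (Suc d)) = SO (vtx U 0)"
  shows "is_seq C d U"
  unfolding is_seq_def
proof (intro allI impI conjI)
  fix i assume "i \<le> d + 1"
  then have i: "i \<le> d \<or> i = Suc d" by auto
  then show "vtx U i \<in> Ob C" using assms(1) by auto
  show "arr U i \<in> mor C (vtx U i) (wob C d U (i + 1))"
    using i
  proof
    assume "i \<le> d"
    then show ?thesis using assms(1)[of i] assms(1)[of "Suc i"] assms(2-4)[of i] by (simp add: mor_iff)
  next
    assume "i = Suc d"
    then show ?thesis using assms(1)[of i] assms(1)[of 0] assms(2,3)[of i] assms(5) by (simp add: mor_iff)
  qed
qed

lemmas angleD = seqD[OF angles_seq]

lemma seq_morphismD:
  assumes "seq_morphism C d U V \<phi>" "is_seq C d U" "is_seq C d V"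
  shows "i \<le> Suc d \<Longrightarrow> ar (\<phi> i)" "i \<le> Suc d \<Longrightarrow> dm (\<phi> i) = vtx U i"
    "i \<le> Suc d \<Longrightarrow> cd (\<phi> i) = vtx V i"
    "i \<le> d \<Longrightarrow> \<phi> (Suc i) \<star> arr U i = arr V i \<star> \<phi> i"
    "SM (\<phi> 0) \<star> arr U (Suc d) = arr V (Suc d) \<star> \<phi> (Suc d)"
proof -
  have m: "\<phi> i \<in> mor C (vtx U i) (vtx V i)" if "i \<le> Suc d" for i
    using assms(1) that by (simp add: seq_morphism_def)
  then have "ar (\<phi> i) \<and> dm (\<phi> i) = vtx U i \<and> cd (\<phi> i) = vtx V i" if "i \<le> Suc d" for i
    using that mor_iff seqD(1)[OF assms(2)] seqD(1)[OF assms(3)] by blast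
  then show "i \<le> Suc d \<Longrightarrow> ar (\<phi> i)" "i \<le> Suc d \<Longrightarrow> dm (\<phi> i) = vtx U i"
    "i \<le> Suc d \<Longrightarrow> cd (\<phi> i) = vtx V i" by blast+
  have e: "wmor C d \<phi> (Suc i) \<star> arr U i = arr V i \<star> \<phi> i" if "i \<le> Suc d" for i
    using assms(1) that by (simp add: seq_morphism_def)
  show "i \<le> d \<Longrightarrow> \<phi> (Suc i) \<star> arr U i = arr V i \<star> \<phi> i" using e[of i] by simp
  show "SM (\<phi> 0) \<star> arr U (Suc d) = arr V (Suc d) \<star> \<phi> (Suc d)" using e[of "Suc d"] by simp
qed

lemma seq_morphismI:
  assumes "is_seq C d U" "is_seq C d V"
    "\<And>i. i \<le> Suc d \<Longrightarrow> ar (\<phi> i) \<and> dm (\<phi> i) = vtx U i \<and> cd (\<phi> i) = vtx V i"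
    "\<And>i. i \<le> d \<Longrightarrow> \<phi> (Suc i) \<star> arr U i = arr V i \<star> \<phi> i"
    "SM (\<phi> 0) \<star> arr U (Suc d) = arr V (Suc d) \<star> \<phi> (Suc d)"
  shows "seq_morphism C d U V \<phi>"
  unfolding seq_morphism_def
proof (intro allI impI conjI)
  fix i assume "i \<le> d + 1"
  then have i: "i \<le> d \<or> i = Suc d" and i': "i \<le> Suc d" by auto
  show "\<phi> i \<in> mor C (vtx U i) (vtx V i)"
    using assms(3)[OF i'] mor_iff seqD(1)[OF assms(1) i'] seqD(1)[OF assms(2) i'] by blast
  show "wmor C d \<phi> (i + 1) \<star> arr U i = arr V i \<star> \<phi> i"
    using i assms(4,5) by auto
qed

lemma angles_cong:
  assumes U: "U \<in> angles C" and eq: "\<And>i. i \<le> Suc d \<Longrightarrow> vtx V i = vtx U i \<and> arr V i = arr U i"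
  shows "V \<in> angles C"
proof -
  note s = angleD[OF U]
  have V: "is_seq C d V" by (rule seqI) (use s eq in auto)
  have "seq_morphism C d U V (\<lambda>i. one (vtx U i))"
    by (rule seq_morphismI[OF angles_seq[OF U] V]) (use s eq in auto)
  moreover have "is_isomorphism C (vtx U i) (vtx V i) (one (vtx U i))" if "i \<le> Suc d" for i
    using s(1)[OF that] eq[OF that] by (auto simp: is_isomorphism_iff intro!: exI[of _ "one (vtx U i)"])
  ultimately have "seq_isomorphic C d U V" unfolding seq_isomorphic_def by auto
  then show ?thesis using N1a_iso U V by blast
qed

lemma rotate_simps [simp]:
  "i \<le> d \<Longrightarrow> vtx (rotate_seq C d U) i = vtx U (Suc i)"
  "vtx (rotate_seq C d U) (Suc d) = SO (vtx U 0)"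
  "i \<le> d \<Longrightarrow> arr (rotate_seq C d U) i = arr U (Suc i)"
  by (simp_all add: rotate_seq_def)

lemma rotate_last:
  assumes "is_seq C d U"
  shows "arr (rotate_seq C d U) (Suc d) = (if even d then SM (arr U 0) else ng (SM (arr U 0)))"
proof -
  have "SM (arr U 0) \<in> mor C (SO (vtx U 0)) (SO (vtx U (Suc 0)))"
    using seqD(2-4)[OF assms, of 0] seqD(1)[OF assms, of 0] seqD(1)[OF assms, of "Suc 0"] by (simp add: mor_iff)
  then show ?thesis
    using ng_eq seqD(1)[OF assms, of 0] seqD(1)[OF assms, of "Suc 0"] by (simp add: rotate_seq_def)
qed

lemma rotate_angle: "U \<in> angles C \<Longrightarrow> rotate_seq C d U \<in> angles C"
  using N2 angles_seq by blast

text \<open>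
  Every angle agrees with the rotation of an angle, because the suspension is an automorphism.
\<close>

lemma unrotate:
  assumes U: "U \<in> angles C"
  obtains V where "V \<in> angles C" "\<And>i. i \<le> d \<Longrightarrow> vtx V (Suc i) = vtx U i"
    "\<And>i. i \<le> d \<Longrightarrow> arr V (Suc i) = arr U i" "SO (vtx V 0) = vtx U (Suc d)"
    "arr U (Suc d) = (if even d then SM (arr V 0) else ng (SM (arr V 0)))"
proof -
  note s = angleD[OF U]
  obtain Z where Z: "Z \<in> Ob C" "SO Z = vtx U (Suc d)" using SO_surj s(1)[of "Suc d"] by blast
  let ?w = "arr U (Suc d)"
  obtain c where c: "ar c" "dm c = Z" "cd c = vtx U 0" "SM c = (if even d then ?w else ng ?w)"
    by (rule SM_surj[of "if even d then ?w else ng ?w" Z "vtx U 0"]) (use s Z in auto)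
  define V where "V = \<lparr>vtx = (\<lambda>i. case i of 0 \<Rightarrow> Z | Suc j \<Rightarrow> vtx U j),
    arr = (\<lambda>i. case i of 0 \<Rightarrow> c | Suc j \<Rightarrow> arr U j)\<rparr>"
  have V: "vtx V 0 = Z" "arr V 0 = c" "\<And>i. vtx V (Suc i) = vtx U i" "\<And>i. arr V (Suc i) = arr U i"
    by (simp_all add: V_def)
  have Vs: "is_seq C d V"
  proof (rule seqI)
    fix i assume "i \<le> Suc d"
    then show "vtx V i \<in> Ob C" "ar (arr V i)" "dm (arr V i) = vtx V i"
      using s c Z by (cases i; simp add: V)+
  next
    fix i assume "i \<le> d"
    then show "cd (arr V i) = vtx V (Suc i)" using s c by (cases i) (simp_all add: V)
  next
    show "cd (arr V (Suc d)) = SO (vtx V 0)" using s(4)[of d] Z by (simp add: V)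
  qed
  have w: "?w = (if even d then SM (arr V 0) else ng (SM (arr V 0)))"
    using c(4) s(2)[of "Suc d"] by (simp add: V)
  have "rotate_seq C d V \<in> angles C"
  proof (rule angles_cong[OF U])
    fix i assume "i \<le> Suc d"
    then consider "i \<le> d" | "i = Suc d" by linarith
    then show "vtx (rotate_seq C d V) i = vtx U i \<and> arr (rotate_seq C d V) i = arr U i"
    proof cases
      case 1 then show ?thesis by (simp add: V)
    next
      case 2
      have "vtx (rotate_seq C d V) (Suc d) = vtx U (Suc d)" using Z by (simp add: V)
      moreover have "arr (rotate_seq C d V) (Suc d) = ?w" using w rotate_last[OF Vs] by simp
      ultimately show ?thesis using 2 by simp
    qed
  qed
  then have "V \<in> angles C" using N2[OF Vs] by blast
  then show ?thesis using that[of V] V Z w by simp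
qed

text \<open>A fixed zero object.\<close>

definition zob :: 'o where
  "zob = (SOME Z. zero_object C Z)"

lemma zob: "zero_object C zob" "zob \<in> Ob C"
  using someI_ex[OF ex_zero_object] by (simp_all add: zob_def zero_object_def)

text \<open>The sequence with \<open>1 : A \<rightarrow> A\<close> at the indices \<open>j\<close>, \<open>j + 1\<close> and zero objects elsewhere.\<close>

definition tseq :: "nat \<Rightarrow> 'o \<Rightarrow> ('o, 'm) susp_seq" where
  "tseq j A = (let v = (\<lambda>i. if i = j \<or> i = Suc j then A else zob)
    in \<lparr>vtx = v, arr = (\<lambda>i. if i = j then one A else zr (v i) (wrap d SO v (Suc i)))\<rparr>)"

lemma tseq_vtx: "vtx (tseq j A) i = (if i = j \<or> i = Suc j then A else zob)"
  by (simp add: tseq_def Let_def)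

lemma tseq_props:
  fixes A :: 'o and j :: nat
  assumes A: "A \<in> Ob C" and j: "j \<le> d"
  shows "is_seq C d (tseq j A)" "vtx (tseq j A) j = A" "vtx (tseq j A) (Suc j) = A"
    "arr (tseq j A) j = one A"
    "\<lbrakk>i \<noteq> j; i \<noteq> Suc j\<rbrakk> \<Longrightarrow> zero_object C (vtx (tseq j A) i)"
    "\<lbrakk>i \<noteq> j; i \<le> d\<rbrakk> \<Longrightarrow> arr (tseq j A) i = zr (vtx (tseq j A) i) (vtx (tseq j A) (Suc i))"
    "arr (tseq j A) (Suc d) = zr (vtx (tseq j A) (Suc d)) (SO (vtx (tseq j A) 0))"
proof -
  note v = tseq_vtx
  have a: "arr (tseq j A) i = (if i = j then one A else
      zr (vtx (tseq j A) i) (wrap d SO (vtx (tseq j A)) (Suc i)))" for i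
    by (simp add: tseq_def Let_def)
  have vO: "vtx (tseq j A) i \<in> Ob C" for i using A zob by (simp add: v)
  show v1: "vtx (tseq j A) j = A" "vtx (tseq j A) (Suc j) = A" by (simp_all add: v)
  show a1: "arr (tseq j A) j = one A" by (simp add: a)
  show "\<lbrakk>i \<noteq> j; i \<noteq> Suc j\<rbrakk> \<Longrightarrow> zero_object C (vtx (tseq j A) i)" using zob by (simp add: v)
  show a2: "\<lbrakk>i \<noteq> j; i \<le> d\<rbrakk> \<Longrightarrow>
      arr (tseq j A) i = zr (vtx (tseq j A) i) (vtx (tseq j A) (Suc i))" for i
    by (simp add: a)
  show a3: "arr (tseq j A) (Suc d) = zr (vtx (tseq j A) (Suc d)) (SO (vtx (tseq j A) 0))"
    using j by (simp add: a)
  show "is_seq C d (tseq j A)"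
  proof (rule seqI)
    fix i assume "i \<le> Suc d"
    then consider "i = j" | "i \<noteq> j" "i \<le> d" | "i \<noteq> j" "i = Suc d" by linarith
    then show "ar (arr (tseq j A) i)" "dm (arr (tseq j A) i) = vtx (tseq j A) i"
      using A vO by (cases; simp add: a1 a2 a3 v1)+
  next
    fix i assume "i \<le> d"
    then show "cd (arr (tseq j A) i) = vtx (tseq j A) (Suc i)"
      using A vO by (cases "i = j") (simp_all add: a1 a2 v1)
  qed (use vO a3 in simp_all)
qed

lemma tseq0_angle:
  assumes "A \<in> Ob C"
  shows "tseq 0 A \<in> angles C"
proof (rule N1b[OF assms])
  show "is_seq C d (tseq 0 A)" "vtx (tseq 0 A) 0 = A" "vtx (tseq 0 A) 1 = A" "arr (tseq 0 A) 0 = one A"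
    using tseq_props(1-4)[OF assms, of 0] by simp_all
  show "zero_object C (vtx (tseq 0 A) i)" if "2 \<le> i" for i
    using tseq_props(5)[OF assms, of 0 i] that by simp
qed

lemma rotate_is_seq:
  assumes U: "is_seq C d U"
  shows "is_seq C d (rotate_seq C d U)"
proof (rule seqI)
  fix i assume "i \<le> Suc d"
  then consider "i \<le> d" | "i = Suc d" by linarith
  then show "vtx (rotate_seq C d U) i \<in> Ob C" "ar (arr (rotate_seq C d U) i)"
    "dm (arr (rotate_seq C d U) i) = vtx (rotate_seq C d U) i"
    using seqD(1-3)[OF U, of 0] seqD(1-3)[OF U, of "Suc i"]
    by (cases; simp add: rotate_last[OF U])+
next
  fix i assume "i \<le> d"
  then consider "i < d" | "i = d" by linarith
  then show "cd (arr (rotate_seq C d U) i) = vtx (rotate_seq C d U) (Suc i)"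
    using seqD(4)[OF U, of "Suc i"] seqD(5)[OF U] by cases simp_all
next
  show "cd (arr (rotate_seq C d U) (Suc d)) = SO (vtx (rotate_seq C d U) 0)"
    using seqD(2,4)[OF U, of 0] by (simp add: rotate_last[OF U])
qed

lemma tseq1_angle:
  assumes A: "A \<in> Ob C"
  shows "tseq 1 A \<in> angles C"
proof -
  note t = tseq_props[OF A d_pos]
  have "rotate_seq C d (tseq 1 A) \<in> angles C"
  proof (rule N1b[OF A rotate_is_seq[OF t(1)]])
    show "vtx (rotate_seq C d (tseq 1 A)) 0 = A" "vtx (rotate_seq C d (tseq 1 A)) 1 = A"
      "arr (rotate_seq C d (tseq 1 A)) 0 = one A"
      using t(2,3,4) d_pos by simp_all
  next
    fix i :: nat assume "2 \<le> i" "i \<le> d + 1"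
    then consider "2 \<le> i" "i \<le> d" | "i = Suc d" by linarith
    then show "zero_object C (vtx (rotate_seq C d (tseq 1 A)) i)"
      using t(5)[of "Suc i"] SO_zero[OF t(5)[of 0]] by cases simp_all
  qed
  then show ?thesis using N2[OF t(1)] by blast
qed

text \<open>The second morphism of an angle is a weak cokernel of the first.\<close>

lemma cofactor:
  assumes U: "U \<in> angles C" and f: "ar f" "dm f = vtx U 1" "cd f = Y"
    and z: "f \<star> arr U 0 = zr (vtx U 0) Y"
  obtains k where "ar k" "dm k = vtx U 2" "cd k = Y" "k \<star> arr U 1 = f"
proof -
  have Y: "Y \<in> Ob C" using f arD by auto
  note t = tseq_props[OF Y d_pos]
  note s = angleD[OF U] and T = tseq1_angle[OF Y]
  have T0: "vtx (tseq 1 Y) 0 \<in> Ob C" "arr (tseq 1 Y) 0 = zr (vtx (tseq 1 Y) 0) Y"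
    using t(6)[of 0] t(3) t(2) seqD(1)[OF t(1), of 0] by simp_all
  have "f \<in> mor C (vtx U 1) (vtx (tseq 1 Y) 1)" using f Y t(2) arD(1)[OF f(1)] by (simp add: mor_iff)
  moreover have "zr (vtx U 0) (vtx (tseq 1 Y) 0) \<in> mor C (vtx U 0) (vtx (tseq 1 Y) 0)"
    using zr_closed s(1)[of 0] T0 by simp
  moreover have "f \<star> arr U 0 = arr (tseq 1 Y) 0 \<star> zr (vtx U 0) (vtx (tseq 1 Y) 0)"
    unfolding T0 z using s(1)[of 0] T0 Y by simp
  ultimately obtain \<phi> where \<phi>: "\<phi> 1 = f" "seq_morphism C d U (tseq 1 Y) \<phi>"
    using N3[OF U T] by blast
  note m = seq_morphismD[OF \<phi>(2) angles_seq[OF U] t(1)]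
  have "\<phi> 2 \<star> arr U 1 = f" using m(4)[of 1] d_pos \<phi>(1) t(4) f by (simp add: numeral_2_eq_2)
  then show ?thesis using that[of "\<phi> 2"] m(1-3)[of 2] d_pos t(3) by (simp add: numeral_2_eq_2)
qed

lemma complex_first:
  assumes U: "U \<in> angles C"
  shows "arr U (Suc 0) \<star> arr U 0 = zr (vtx U 0) (cd (arr U (Suc 0)))"
proof -
  note s = angleD[OF U]
  have A: "vtx U 0 \<in> Ob C" using s(1) by simp
  note t = tseq_props[OF A, of 0, simplified]
  note T = tseq0_angle[OF A]
  have "one (vtx U 0) \<in> mor C (vtx (tseq 0 (vtx U 0)) 0) (vtx U 0)"
    using A t(2) idt_closed by simp
  moreover have "arr U 0 \<in> mor C (vtx (tseq 0 (vtx U 0)) 1) (vtx U 1)"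
    using s(1-4)[of 0] s(1)[of 1] t(3) by (simp add: mor_iff)
  moreover have "arr U 0 \<star> arr (tseq 0 (vtx U 0)) 0 = arr U 0 \<star> one (vtx U 0)"
    using t(4) by simp
  ultimately obtain \<phi> where \<phi>: "\<phi> 1 = arr U 0" "seq_morphism C d (tseq 0 (vtx U 0)) U \<phi>"
    using N3[OF T U] by blast
  note m = seq_morphismD[OF \<phi>(2) t(1) angles_seq[OF U]]
  have v2: "vtx (tseq 0 (vtx U 0)) (Suc (Suc 0)) \<in> Ob C" using seqD(1)[OF t(1)] d_pos by simp
  have "arr U 1 \<star> arr U 0 = \<phi> (Suc (Suc 0)) \<star> zr (vtx U 0) (vtx (tseq 0 (vtx U 0)) (Suc (Suc 0)))"
    using m(4)[of 1] d_pos \<phi>(1) t(6)[of 1] t(3) by simp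
  also have "\<dots> = zr (vtx U 0) (cd (\<phi> (Suc (Suc 0))))"
    by (rule cmp_zr(1)) (use m(1,2)[of "Suc (Suc 0)"] d_pos A in simp_all)
  also have "cd (\<phi> (Suc (Suc 0))) = cd (arr U (Suc 0))"
    using m(3)[of "Suc (Suc 0)"] s(4)[of "Suc 0"] d_pos by simp
  finally show ?thesis by simp
qed

lemma complex:
  assumes "U \<in> angles C" "i \<le> d"
  shows "arr U (Suc i) \<star> arr U i = zr (vtx U i) (cd (arr U (Suc i)))"
  using assms
proof (induction i arbitrary: U)
  case 0
  then show ?case using complex_first by blast
next
  case (Suc i)
  have "arr (rotate_seq C d U) (Suc i) \<star> arr (rotate_seq C d U) i =
      zr (vtx (rotate_seq C d U) i) (cd (arr (rotate_seq C d U) (Suc i)))"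
    using Suc.IH[OF rotate_angle[OF Suc.prems(1)]] Suc.prems(2) by simp
  then show ?case using Suc.prems(2) by simp
qed

lemma complex_last:
  assumes U: "U \<in> angles C"
  shows "SM (arr U 0) \<star> arr U (Suc d) = zr (vtx U (Suc d)) (SO (vtx U (Suc 0)))"
proof -
  note s = angleD[OF U]
  have U0: "ar (arr U 0)" "dm (arr U 0) = vtx U 0" "cd (arr U 0) = vtx U (Suc 0)" using s by simp_all
  have U1: "ar (arr U (Suc d))" "dm (arr U (Suc d)) = vtx U (Suc d)"
    "cd (arr U (Suc d)) = SO (vtx U 0)" using s by simp_all
  have Ob: "vtx U (Suc d) \<in> Ob C" "vtx U (Suc 0) \<in> Ob C" "vtx U 0 \<in> Ob C" using s(1) by simp_all
  have "arr (rotate_seq C d U) (Suc d) \<star> arr (rotate_seq C d U) d =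
      zr (vtx (rotate_seq C d U) d) (cd (arr (rotate_seq C d U) (Suc d)))"
    by (rule complex[OF rotate_angle[OF U] order_refl])
  then have e: "(if even d then SM (arr U 0) else ng (SM (arr U 0))) \<star> arr U (Suc d) =
      zr (vtx U (Suc d)) (cd (if even d then SM (arr U 0) else ng (SM (arr U 0))))"
    by (simp add: rotate_last[OF angles_seq[OF U]])
  show ?thesis
  proof (cases "even d")
    case True
    then show ?thesis using e U0 U1 by simp
  next
    case False
    then have "ng (SM (arr U 0) \<star> arr U (Suc d)) = zr (vtx U (Suc d)) (SO (vtx U (Suc 0)))"
      using e U0 U1 by simp
    then have "ng (ng (SM (arr U 0) \<star> arr U (Suc d))) = ng (zr (vtx U (Suc d)) (SO (vtx U (Suc 0))))"
      by (rule arg_cong)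
    then show ?thesis using U0 U1 Ob by simp
  qed
qed

text \<open>Up to suspension, the last morphism of an angle is a weak kernel of the first.\<close>

lemma factor:
  assumes U: "U \<in> angles C" and g: "ar g" "dm g = Y" "cd g = vtx U 0"
    and z: "arr U 0 \<star> g = zr Y (vtx U (Suc 0))"
  obtains k where "ar k" "dm k = SO Y" "cd k = vtx U (Suc d)" "arr U (Suc d) \<star> k = SM g"
proof -
  have Y: "Y \<in> Ob C" using g arD by auto
  note t = tseq_props[OF Y, of 0, simplified]
  let ?T = "rotate_seq C d (tseq 0 Y)"
  have T: "?T \<in> angles C" by (rule rotate_angle[OF tseq0_angle[OF Y]])
  note s = angleD[OF U] and ts = angleD[OF T]
  have T0: "vtx ?T 0 = Y" "vtx ?T 1 = vtx (tseq 0 Y) 2" using t(3) d_pos by (simp_all add: numeral_2_eq_2)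
  have O: "vtx ?T 1 \<in> Ob C" "vtx U 1 \<in> Ob C" "vtx U 0 \<in> Ob C" using ts(1) s(1) by simp_all
  have "g \<in> mor C (vtx ?T 0) (vtx U 0)" using g Y O T0 by (simp add: mor_iff)
  moreover have "zr (vtx ?T 1) (vtx U 1) \<in> mor C (vtx ?T 1) (vtx U 1)" using zr_closed O by simp
  moreover have "zr (vtx ?T 1) (vtx U 1) \<star> arr ?T 0 = arr U 0 \<star> g"
    unfolding z using ts(1-4)[of 0] O T0 by simp
  ultimately obtain \<phi> where \<phi>: "\<phi> 0 = g" "seq_morphism C d ?T U \<phi>" using N3[OF T U] by blast
  note m = seq_morphismD[OF \<phi>(2) angles_seq[OF T] angles_seq[OF U]]
  have last: "arr ?T (Suc d) = (if even d then one (SO Y) else ng (one (SO Y)))"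
    using rotate_last[OF t(1)] t(4) Y by simp
  have p: "ar (\<phi> (Suc d))" "dm (\<phi> (Suc d)) = SO Y" "cd (\<phi> (Suc d)) = vtx U (Suc d)"
    using m(1-3)[of "Suc d"] t(2) by simp_all
  have U1: "ar (arr U (Suc d))" "dm (arr U (Suc d)) = vtx U (Suc d)" using s by simp_all
  have e: "SM g \<star> arr ?T (Suc d) = arr U (Suc d) \<star> \<phi> (Suc d)" using m(5) \<phi>(1) by simp
  show ?thesis
  proof (cases "even d")
    case True
    have "arr U (Suc d) \<star> \<phi> (Suc d) = SM g" using e True last g by simp
    then show ?thesis using that[of "\<phi> (Suc d)"] p by simp
  next
    case False
    have "arr U (Suc d) \<star> \<phi> (Suc d) = ng (SM g)" using e False last g Y by simp
    then have "arr U (Suc d) \<star> ng (\<phi> (Suc d)) = SM g" using p U1 g by simp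
    then show ?thesis using that[of "ng (\<phi> (Suc d))"] p by simp
  qed
qed

end

section \<open>Direct sums and summands of angles\<close>

context linear_category
begin

lemma biproduct_sym:
  assumes "biproduct C A B P i1 i2 p1 p2"
  shows "biproduct C B A P i2 i1 p2 p1"
proof -
  note [simp] = biproductD[OF assms]
  have "i2 \<star> p2 \<boxplus> i1 \<star> p1 = i1 \<star> p1 \<boxplus> i2 \<star> p2" by (rule pl_comm) simp_all
  also have "\<dots> = one P" using assms by (simp add: biproduct_iff)
  finally show ?thesis by (simp add: biproduct_iff)
qed

text \<open>
  A morphism of biproducts without off-diagonal components restricts to the second summands and
  commutes with the injections and projections there.
\<close>

lemma block_diagonal:
  assumes b: "biproduct C A B P i1 i2 p1 p2" and b': "biproduct C A' B' P' i1' i2' p1' p2'"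
    and a: "ar a" "dm a = P" "cd a = P'"
    and z: "p1' \<star> (a \<star> i2) = zr B A'" "p2' \<star> (a \<star> i1) = zr A B'"
  shows "i2' \<star> (p2' \<star> (a \<star> i2)) = a \<star> i2" "p2' \<star> a = (p2' \<star> (a \<star> i2)) \<star> p2"
proof -
  note [simp] = biproductD[OF b] biproductD[OF b'] a
  show "i2' \<star> (p2' \<star> (a \<star> i2)) = a \<star> i2"
    by (rule biproduct_eqI[OF b']) (simp_all add: z)
  have "p2' \<star> (a \<star> (i1 \<star> x)) = zr (dm x) B'" if "ar x" "cd x = A" for x
    using reassoc[OF z(2), of x] that by simp
  note [simp] = this
  show "p2' \<star> a = (p2' \<star> (a \<star> i2)) \<star> p2"
    by (rule biproduct_coeqI[OF b]) (simp_all add: z)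
qed

end

context angulated_category
begin

text \<open>
  The sequence with objects \<open>Y k\<close> that \<open>U\<close> induces along injections \<open>i2 k\<close> into and projections
  \<open>p2 k\<close> from its objects.
\<close>

definition summand_seq ::
  "(nat \<Rightarrow> 'o) \<Rightarrow> (nat \<Rightarrow> 'm) \<Rightarrow> (nat \<Rightarrow> 'm) \<Rightarrow> ('o, 'm) susp_seq \<Rightarrow> ('o, 'm) susp_seq" where
  "summand_seq Y i2 p2 U = \<lparr>vtx = Y, arr = (\<lambda>k. wmor C d p2 (Suc k) \<star> (arr U k \<star> i2 k))\<rparr>"

lemma summand_seq_simps [simp]:
  "vtx (summand_seq Y i2 p2 U) = Y"
  "k \<le> d \<Longrightarrow> arr (summand_seq Y i2 p2 U) k = p2 (Suc k) \<star> (arr U k \<star> i2 k)"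
  "arr (summand_seq Y i2 p2 U) (Suc d) = SM (p2 0) \<star> (arr U (Suc d) \<star> i2 (Suc d))"
  by (simp_all add: summand_seq_def)

lemma summand_seq_morphisms:
  assumes U: "is_seq C d U"
    and b: "\<And>k. k \<le> Suc d \<Longrightarrow> biproduct C (D k) (Y k) (vtx U k) (i1 k) (i2 k) (p1 k) (p2 k)"
    and z1: "\<And>k. k \<le> d \<Longrightarrow> p1 (Suc k) \<star> (arr U k \<star> i2 k) = zr (Y k) (D (Suc k))"
    and z2: "\<And>k. k \<le> d \<Longrightarrow> p2 (Suc k) \<star> (arr U k \<star> i1 k) = zr (D k) (Y (Suc k))"
    and z3: "SM (p1 0) \<star> (arr U (Suc d) \<star> i2 (Suc d)) = zr (Y (Suc d)) (SO (D 0))"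
    and z4: "SM (p2 0) \<star> (arr U (Suc d) \<star> i1 (Suc d)) = zr (D (Suc d)) (SO (Y 0))"
  shows "is_seq C d (summand_seq Y i2 p2 U)"
    "seq_morphism C d (summand_seq Y i2 p2 U) U i2"
    "seq_morphism C d U (summand_seq Y i2 p2 U) p2"
proof -
  let ?V = "summand_seq Y i2 p2 U"
  note s = seqD[OF U]
  note bD = biproductD[OF b]
  have step: "ar (p2 (Suc k) \<star> (arr U k \<star> i2 k))" "dm (p2 (Suc k) \<star> (arr U k \<star> i2 k)) = Y k"
    "cd (p2 (Suc k) \<star> (arr U k \<star> i2 k)) = Y (Suc k)" if k: "k \<le> d" for k
    using bD(7-9)[of k] bD(13-15)[of "Suc k"] s(2-4)[of k] k by simp_all
  have last: "ar (SM (p2 0) \<star> (arr U (Suc d) \<star> i2 (Suc d)))"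
    "dm (SM (p2 0) \<star> (arr U (Suc d) \<star> i2 (Suc d))) = Y (Suc d)"
    "cd (SM (p2 0) \<star> (arr U (Suc d) \<star> i2 (Suc d))) = SO (Y 0)"
    using bD(7-9)[of "Suc d"] bD(13-15)[of 0] s(2,3)[of "Suc d"] s(5) by simp_all
  show V: "is_seq C d ?V"
  proof (rule seqI)
    fix i assume "i \<le> Suc d"
    then consider "i \<le> d" | "i = Suc d" by linarith
    then show "ar (arr ?V i)" "dm (arr ?V i) = vtx ?V i"
      using step[of i] last by (cases; simp)+
  qed (use bD(2) step last in simp_all)
  have d1: "i2 (Suc k) \<star> (p2 (Suc k) \<star> (arr U k \<star> i2 k)) = arr U k \<star> i2 k"
    "p2 (Suc k) \<star> arr U k = (p2 (Suc k) \<star> (arr U k \<star> i2 k)) \<star> p2 k" if k: "k \<le> d" for k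
    by (rule block_diagonal[OF b[of k] b[of "Suc k"]]; use k s(2-4)[of k] z1 z2 in simp)+
  have d2: "SM (i2 0) \<star> (SM (p2 0) \<star> (arr U (Suc d) \<star> i2 (Suc d))) = arr U (Suc d) \<star> i2 (Suc d)"
    "SM (p2 0) \<star> arr U (Suc d) = (SM (p2 0) \<star> (arr U (Suc d) \<star> i2 (Suc d))) \<star> p2 (Suc d)"
    by (rule block_diagonal[OF b[of "Suc d"] SM_biproduct[OF b[of 0]]];
        use s(2,3)[of "Suc d"] s(5) z3 z4 in simp)+
  show "seq_morphism C d ?V U i2"
    by (rule seq_morphismI[OF V U]) (use bD(7-9) d1(1) d2(1) in simp_all)
  show "seq_morphism C d U ?V p2"
  proof (rule seq_morphismI[OF U V])
    fix i assume "i \<le> d"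
    then show "p2 (Suc i) \<star> arr U i = arr ?V i \<star> p2 i" using d1(2)[of i] by (simp del: assoc)
  next
    show "SM (p2 0) \<star> arr U (Suc d) = arr ?V (Suc d) \<star> p2 (Suc d)" using d2(2) by (simp del: assoc)
  qed (use bD(13-15) in simp)
qed

lemma summand_angle:
  assumes U: "U \<in> angles C"
    and b: "\<And>k. k \<le> Suc d \<Longrightarrow> biproduct C (D k) (Y k) (vtx U k) (i1 k) (i2 k) (p1 k) (p2 k)"
    and z1: "\<And>k. k \<le> d \<Longrightarrow> p1 (Suc k) \<star> (arr U k \<star> i2 k) = zr (Y k) (D (Suc k))"
    and z2: "\<And>k. k \<le> d \<Longrightarrow> p2 (Suc k) \<star> (arr U k \<star> i1 k) = zr (D k) (Y (Suc k))"
    and z3: "SM (p1 0) \<star> (arr U (Suc d) \<star> i2 (Suc d)) = zr (Y (Suc d)) (SO (D 0))"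
    and z4: "SM (p2 0) \<star> (arr U (Suc d) \<star> i1 (Suc d)) = zr (D (Suc d)) (SO (Y 0))"
  shows "summand_seq Y i2 p2 U \<in> angles C"
proof -
  note m2 = summand_seq_morphisms[OF angles_seq[OF U] b z1 z2 z3 z4]
  note m1 = summand_seq_morphisms[OF angles_seq[OF U] biproduct_sym[OF b] z2 z1 z4 z3]
  have "seq_direct_sum C d (summand_seq D i1 p1 U) (summand_seq Y i2 p2 U) U"
    unfolding seq_direct_sum_def
    by (intro exI[of _ i1] exI[of _ i2] exI[of _ p1] exI[of _ p2] conjI m1 m2) (use b in simp_all)
  then show ?thesis using N1a_direct_summand[OF U m1(1) m2(1)] by blast
qed

text \<open>
  A direct summand \<open>1 : D \<rightarrow> D\<close> at the indices \<open>j\<close>, \<open>j + 1\<close> can be removed from an angle;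
  the neighbouring morphisms respect the decomposition because consecutive composites vanish.
\<close>

lemma split_off:
  assumes U: "U \<in> angles C" and j: "j \<le> d"
    and b0: "biproduct C D Z (vtx U j) i1 i2 p1 p2"
    and b1: "biproduct C D Y (vtx U (Suc j)) i1' i2' p1' p2'"
    and i1': "i1' = arr U j \<star> i1" and p1: "p1 = p1' \<star> arr U j"
  obtains V where "V \<in> angles C" "vtx V j = Z" "vtx V (Suc j) = Y"
    "\<And>k. \<lbrakk>k \<le> Suc d; k \<noteq> j; k \<noteq> Suc j\<rbrakk> \<Longrightarrow> vtx V k = vtx U k"
    "arr V j = p2' \<star> (arr U j \<star> i2)"
    "\<And>k. \<lbrakk>k \<le> d; k \<noteq> j; k \<noteq> Suc j; Suc k \<noteq> j\<rbrakk> \<Longrightarrow> arr V k = arr U k"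
proof -
  note s = angleD[OF U]
  define DD where "DD k = (if k = j \<or> k = Suc j then D else zob)" for k
  define YY where "YY k = (if k = j then Z else if k = Suc j then Y else vtx U k)" for k
  define I1 where "I1 k = (if k = j then i1 else if k = Suc j then i1' else zr zob (vtx U k))" for k
  define I2 where "I2 k = (if k = j then i2 else if k = Suc j then i2' else one (vtx U k))" for k
  define P1 where "P1 k = (if k = j then p1 else if k = Suc j then p1' else zr (vtx U k) zob)" for k
  define P2 where "P2 k = (if k = j then p2 else if k = Suc j then p2' else one (vtx U k))" for k
  note F = DD_def YY_def I1_def I2_def P1_def P2_def
  have b: "biproduct C (DD k) (YY k) (vtx U k) (I1 k) (I2 k) (P1 k) (P2 k)" if "k \<le> Suc d" for k
    using b0 b1 zero_biproduct[OF zob(1) s(1)[OF that]] by (simp add: F)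
  note bD = biproductD[OF b]
  note B0 = biproductD[OF b0] and B1 = biproductD[OF b1]
  have aj: "ar (arr U j)" "dm (arr U j) = vtx U j" "cd (arr U j) = vtx U (Suc j)" using s(2-4) j by simp_all
  have e1: "arr U (Suc j) \<star> i1' = zr D (cd (arr U (Suc j)))"
  proof -
    have "arr U (Suc j) \<star> i1' = zr (vtx U j) (cd (arr U (Suc j))) \<star> i1"
      unfolding i1' by (rule reassoc[OF complex[OF U j]]) (use B0 aj s(2,3)[of "Suc j"] j in simp_all)
    then show ?thesis using B0 arD(2)[OF s(2)[of "Suc j"]] j by simp
  qed
  have e2: "p1 \<star> arr U k = zr (vtx U k) D" if "Suc k = j" for k
  proof -
    have k: "k \<le> d" "Suc k \<le> d" using that j by simp_all
    have "p1 \<star> arr U k = p1' \<star> (arr U j \<star> arr U k)"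
      unfolding p1 by (rule assoc) (use B1 aj s(2,4)[of k] that k in simp_all)
    also have "arr U j \<star> arr U k = zr (vtx U k) (vtx U (Suc j))"
      using complex[OF U k(1)] that s(4)[of j] j by simp
    also have "p1' \<star> \<dots> = zr (vtx U k) D" using B1 s(1)[of k] k by simp
    finally show ?thesis .
  qed
  have e3: "SM p1 \<star> arr U (Suc d) = zr (vtx U (Suc d)) (SO D)" if j0: "j = 0"
  proof -
    have "SM p1 = SM p1' \<star> SM (arr U 0)" unfolding p1 using aj B1 j0 by simp
    then have "SM p1 \<star> arr U (Suc d) = SM p1' \<star> (SM (arr U 0) \<star> arr U (Suc d))"
      using aj B1 j0 s(2)[of "Suc d"] s(5) by simp
    also have "\<dots> = zr (vtx U (Suc d)) (SO D)"
      unfolding complex_last[OF U] using B1 j0 s(1)[of "Suc d"] by simp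
    finally show ?thesis .
  qed
  let ?V = "summand_seq YY I2 P2 U"
  have V: "?V \<in> angles C"
  proof (rule summand_angle[OF U b])
    fix k assume k: "k \<le> d"
    have uk: "ar (arr U k)" "dm (arr U k) = vtx U k" "cd (arr U k) = vtx U (Suc k)"
      "vtx U k \<in> Ob C" "vtx U (Suc k) \<in> Ob C" using s(1-4) k by simp_all
    note D1 = bD(4-15)[of k] and D2 = bD(4-15)[of "Suc k"]
    have Ok: "DD k \<in> Ob C" "YY k \<in> Ob C" "DD (Suc k) \<in> Ob C" "YY (Suc k) \<in> Ob C"
      using bD(1,2)[of k] bD(1,2)[of "Suc k"] k by simp_all
    consider (a) "k = j" | (b) "Suc k = j" | (c) "k = Suc j" | (e) "k \<noteq> j" "Suc k \<noteq> j" "k \<noteq> Suc j"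
      by blast
    then show "P1 (Suc k) \<star> (arr U k \<star> I2 k) = zr (YY k) (DD (Suc k))"
    proof cases
      case a
      have "p1' \<star> (arr U j \<star> i2) = p1 \<star> i2" unfolding p1 using B1 B0 aj by simp
      then show ?thesis using a B0 by (simp add: F)
    next
      case b
      then show ?thesis using e2[OF b] uk by (simp add: F)
    next
      case c
      then show ?thesis using D1 D2 uk Ok k zob by (simp add: F)
    next
      case e
      then show ?thesis using D1 D2 uk Ok k zob by (simp add: F)
    qed
    consider (a) "k = j" | (c) "k = Suc j" | (e) "k \<noteq> j" "k \<noteq> Suc j"
      by blast
    then show "P2 (Suc k) \<star> (arr U k \<star> I1 k) = zr (DD k) (YY (Suc k))"
    proof cases
      case a
      have "p2' \<star> (arr U j \<star> i1) = p2' \<star> i1'" unfolding i1' ..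
      then show ?thesis using a B1 by (simp add: F)
    next
      case c
      then have "arr U k \<star> I1 k = zr (DD k) (vtx U (Suc k))" using e1 uk by (simp add: F)
      then show ?thesis using D2 Ok k by simp
    next
      case e
      then have "arr U k \<star> I1 k = zr (DD k) (vtx U (Suc k))" using uk zob by (simp add: F)
      then show ?thesis using D2 Ok k by simp
    qed
  next
    have ud: "ar (arr U (Suc d))" "dm (arr U (Suc d)) = vtx U (Suc d)"
      "cd (arr U (Suc d)) = SO (vtx U 0)" "vtx U (Suc d) \<in> Ob C" "vtx U 0 \<in> Ob C"
      using s by simp_all
    note D1 = bD(1-15)[of "Suc d"] and D2 = bD(1-15)[of 0]
    show "SM (P1 0) \<star> (arr U (Suc d) \<star> I2 (Suc d)) = zr (YY (Suc d)) (SO (DD 0))"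
    proof (cases "j = 0")
      case True
      then show ?thesis using e3[OF True] ud d_pos by (simp add: F)
    next
      case False
      then have "P1 0 = zr (vtx U 0) (DD 0)" by (simp add: F)
      then show ?thesis using D1 D2 ud by simp
    qed
    show "SM (P2 0) \<star> (arr U (Suc d) \<star> I1 (Suc d)) = zr (DD (Suc d)) (SO (YY 0))"
    proof -
      have "arr U (Suc d) \<star> I1 (Suc d) = zr (DD (Suc d)) (SO (vtx U 0))"
      proof (cases "j = d")
        case True
        then show ?thesis using e1 ud by (simp add: F)
      next
        case False
        then have "I1 (Suc d) = zr (DD (Suc d)) (vtx U (Suc d))" using j by (simp add: F)
        then show ?thesis using D1 ud by simp
      qed
      then show ?thesis using D1 D2 by simp
    qed
  qed
  show ?thesis
  proof (rule that[OF V])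
    fix k assume k: "k \<le> d" "k \<noteq> j" "k \<noteq> Suc j" "Suc k \<noteq> j"
    then show "arr ?V k = arr U k" using s(1-4)[of k] s(1)[of "Suc k"] by (simp add: F)
  qed (use j in \<open>simp_all add: F\<close>)
qed

lemma direct_sum_angle:
  assumes U: "U \<in> angles C" and V: "V \<in> angles C"
    and b: "\<And>k. k \<le> Suc d \<Longrightarrow> biproduct C (vtx U k) (vtx V k) (Q k) (i1 k) (i2 k) (p1 k) (p2 k)"
  obtains W where "W \<in> angles C" "vtx W = Q"
    "arr W 0 = i1 1 \<star> (arr U 0 \<star> p1 0) \<boxplus> i2 1 \<star> (arr V 0 \<star> p2 0)"
proof -
  note u = angleD[OF U] and v = angleD[OF V]
  note bD = biproductD[OF b]
  define W where "W = \<lparr>vtx = Q, arr = (\<lambda>k. wmor C d i1 (Suc k) \<star> (arr U k \<star> p1 k) \<boxplus>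
    wmor C d i2 (Suc k) \<star> (arr V k \<star> p2 k))\<rparr>"
  have Wv: "vtx W = Q" by (simp add: W_def)
  have Wa: "arr W k = i1 (Suc k) \<star> (arr U k \<star> p1 k) \<boxplus> i2 (Suc k) \<star> (arr V k \<star> p2 k)" if "k \<le> d" for k
    using that by (simp add: W_def)
  have Wl: "arr W (Suc d) = SM (i1 0) \<star> (arr U (Suc d) \<star> p1 (Suc d)) \<boxplus>
      SM (i2 0) \<star> (arr V (Suc d) \<star> p2 (Suc d))"
    by (simp add: W_def)
  have W: "is_seq C d W"
  proof (rule seqI)
    fix k assume "k \<le> Suc d"
    then consider "k \<le> d" | "k = Suc d" by linarith
    then show "ar (arr W k)" "dm (arr W k) = vtx W k"
      using bD(4-15)[of k] bD(4-15)[of "Suc k"] bD(4-15)[of 0] u(2-4)[of k] v(2-4)[of k] u(5) v(5)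
      by (cases; simp add: Wa Wl Wv)+
  next
    fix k assume "k \<le> d"
    then show "cd (arr W k) = vtx W (Suc k)"
      using bD(4-15)[of k] bD(4-15)[of "Suc k"] u(2-4)[of k] v(2-4)[of k] by (simp add: Wa Wv)
  next
    show "cd (arr W (Suc d)) = SO (vtx W 0)"
      using bD(4-15)[of 0] bD(4-15)[of "Suc d"] u(2,3)[of "Suc d"] v(2,3)[of "Suc d"] u(5) v(5)
      by (simp add: Wl Wv)
  qed (use bD(3) in \<open>simp add: Wv\<close>)
  have m: "i1 (Suc k) \<star> arr U k = arr W k \<star> i1 k" "i2 (Suc k) \<star> arr V k = arr W k \<star> i2 k"
    "p1 (Suc k) \<star> arr W k = arr U k \<star> p1 k" "p2 (Suc k) \<star> arr W k = arr V k \<star> p2 k"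
    if k: "k \<le> d" for k
  proof -
    note [simp] = bD[of k] bD[of "Suc k"] u(1-4)[of k] v(1-4)[of k]
    have [simp]: "k \<le> Suc d" using k by simp
    show "i1 (Suc k) \<star> arr U k = arr W k \<star> i1 k" "i2 (Suc k) \<star> arr V k = arr W k \<star> i2 k"
      "p1 (Suc k) \<star> arr W k = arr U k \<star> p1 k" "p2 (Suc k) \<star> arr W k = arr V k \<star> p2 k"
      unfolding Wa[OF k] using k by simp_all
  qed
  have ml: "SM (i1 0) \<star> arr U (Suc d) = arr W (Suc d) \<star> i1 (Suc d)"
    "SM (i2 0) \<star> arr V (Suc d) = arr W (Suc d) \<star> i2 (Suc d)"
    "SM (p1 0) \<star> arr W (Suc d) = arr U (Suc d) \<star> p1 (Suc d)"
    "SM (p2 0) \<star> arr W (Suc d) = arr V (Suc d) \<star> p2 (Suc d)"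
  proof -
    note [simp] = bD[of "Suc d"] biproductD[OF SM_biproduct[OF b[of 0]]]
      u(1-3)[of "Suc d"] v(1-3)[of "Suc d"] u(5) v(5)
    show "SM (i1 0) \<star> arr U (Suc d) = arr W (Suc d) \<star> i1 (Suc d)"
      "SM (i2 0) \<star> arr V (Suc d) = arr W (Suc d) \<star> i2 (Suc d)"
      "SM (p1 0) \<star> arr W (Suc d) = arr U (Suc d) \<star> p1 (Suc d)"
      "SM (p2 0) \<star> arr W (Suc d) = arr V (Suc d) \<star> p2 (Suc d)"
      unfolding Wl by simp_all
  qed
  have "seq_morphism C d U W i1" "seq_morphism C d V W i2" "seq_morphism C d W U p1"
    "seq_morphism C d W V p2"
    by (rule seq_morphismI; use W angles_seq[OF U] angles_seq[OF V] bD(4-15) m ml in \<open>simp add: Wv\<close>)+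
  then have "seq_direct_sum C d U V W"
    unfolding seq_direct_sum_def using b
    by (intro exI[of _ i1] exI[of _ i2] exI[of _ p1] exI[of _ p2]) (simp add: Wv)
  then have "W \<in> angles C" using N1a_direct_sum[OF U V W] by blast
  then show ?thesis using that[of W] Wv Wa[of 0] by simp
qed

end

section \<open>Auslander-Reiten angles\<close>

locale krull_schmidt_angulated_category =
  angulated_category K C d + additive_krull_schmidt_category K C
  for K :: "('k, 'r) ring_scheme" and C :: "('k, 'o, 'm, 'z) angulated_cat_scheme" and d :: nat
begin

text \<open>
  Removing trivial summands away from the first morphism makes the middle morphisms radical.
\<close>

lemma minimal_angle:
  assumes "U \<in> angles C"
  shows "\<exists>V \<in> angles C. vtx V 0 = vtx U 0 \<and> vtx V 1 = vtx U 1 \<and> arr V 0 = arr U 0 \<and>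
    (\<forall>i. 2 \<le> i \<and> i \<le> d \<longrightarrow> arr V i \<in> radical C (vtx V i) (vtx V (Suc i)))"
  using assms
proof (induction "\<Sum>k\<le>Suc d. size_ob (vtx U k)" arbitrary: U rule: less_induct)
  case less
  note U = less.prems
  note s = angleD[OF U]
  show ?case
  proof (cases "\<forall>i. 2 \<le> i \<and> i \<le> d \<longrightarrow> arr U i \<in> radical C (vtx U i) (vtx U (Suc i))")
    case False
    then obtain i where i: "2 \<le> i" "i \<le> d" "arr U i \<notin> radical C (vtx U i) (vtx U (Suc i))" by blast
    have a: "ar (arr U i)" "dm (arr U i) = vtx U i" "cd (arr U i) = vtx U (Suc i)"
      using s(2-4)[of i] i by simp_all
    obtain D u r where D: "D \<in> Ob C" "local_endomorphism_ring C D"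
      and u: "ar u" "dm u = D" "cd u = vtx U i" and r: "ar r" "dm r = vtx U (Suc i)" "cd r = D"
      and rau: "r \<star> (arr U i \<star> u) = one D"
      using not_radical[OF a i(3)] by metis
    have D0: "one D \<noteq> zr D D" using D(2) by (simp add: local_endomorphism_ring_def)
    have "\<exists>Z j q. biproduct C D Z (vtx U i) u j (r \<star> arr U i) q"
      by (rule ex_complement) (use u r a rau in simp_all)
    then obtain Z j q where b0: "biproduct C D Z (vtx U i) u j (r \<star> arr U i) q" by blast
    have "\<exists>Y j q. biproduct C D Y (vtx U (Suc i)) (arr U i \<star> u) j r q"
      by (rule ex_complement) (use u r a rau in simp_all)
    then obtain Y j' q' where b1: "biproduct C D Y (vtx U (Suc i)) (arr U i \<star> u) j' r q'" by blast
    obtain V where V: "V \<in> angles C" "vtx V i = Z" "vtx V (Suc i) = Y"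
      "\<And>k. \<lbrakk>k \<le> Suc d; k \<noteq> i; k \<noteq> Suc i\<rbrakk> \<Longrightarrow> vtx V k = vtx U k"
      "\<And>k. \<lbrakk>k \<le> d; k \<noteq> i; k \<noteq> Suc i; Suc k \<noteq> i\<rbrakk> \<Longrightarrow> arr V k = arr U k"
      using split_off[OF U i(2) b0 b1 refl refl] by metis
    have sz: "size_ob (vtx V i) < size_ob (vtx U i)" "size_ob (vtx V (Suc i)) < size_ob (vtx U (Suc i))"
      using size_summand[OF b0 D0] size_summand[OF b1 D0] V(2,3) by simp_all
    have "(\<Sum>k\<le>Suc d. size_ob (vtx V k)) < (\<Sum>k\<le>Suc d. size_ob (vtx U k))"
    proof (rule sum_strict_mono_ex1)
      show "\<forall>k\<in>{..Suc d}. size_ob (vtx V k) \<le> size_ob (vtx U k)"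
      proof
        fix k assume "k \<in> {..Suc d}"
        then show "size_ob (vtx V k) \<le> size_ob (vtx U k)"
          using sz V(4)[of k] by (cases "k = i"; cases "k = Suc i") simp_all
      qed
      show "\<exists>k\<in>{..Suc d}. size_ob (vtx V k) < size_ob (vtx U k)"
        using sz(1) i(2) by (intro bexI[of _ i]) simp_all
    qed simp
    from less.hyps[OF this V(1)] obtain W where W: "W \<in> angles C" "vtx W 0 = vtx V 0"
      "vtx W 1 = vtx V 1" "arr W 0 = arr V 0"
      "\<forall>i. 2 \<le> i \<and> i \<le> d \<longrightarrow> arr W i \<in> radical C (vtx W i) (vtx W (Suc i))" by blast
    have "vtx V 0 = vtx U 0" "vtx V 1 = vtx U 1" "arr V 0 = arr U 0" using V(4,5) i by simp_all
    then show ?thesis using W by (intro bexI[of _ W]) simp_all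
  qed (use U in blast)
qed

text \<open>
  Below a nonzero \<open>c\<close> that starts an angle there is an angle \<open>V\<close> whose rotation is an
  Auslander-Reiten angle; its first morphism is \<open>h \<star> c \<star> g\<close>.
\<close>

lemma ex_AR_angle:
  assumes U: "U \<in> angles C" and nz: "arr U 0 \<noteq> zr (vtx U 0) (vtx U 1)"
  obtains V g t h where "V \<in> angles C" "AR_angle C d (rotate_seq C d V)"
    "local_endomorphism_ring C (vtx V 0)"
    "ar g" "dm g = vtx V 0" "cd g = vtx U 0" "ar t" "dm t = vtx V 1" "cd t = vtx U 1"
    "ar h" "dm h = vtx U 1" "cd h = vtx V 1"
    "t \<star> arr V 0 = arr U 0 \<star> g" "h \<star> t = one (vtx V 1)"
    "arr U 0 \<star> g \<noteq> zr (vtx V 0) (vtx U 1)"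
proof -
  note s = angleD[OF U]
  define Z where "Z = vtx U 0"
  define A where "A = vtx U 1"
  define c where "c = arr U 0"
  have Z: "Z \<in> Ob C" and A: "A \<in> Ob C" using s(1) by (simp_all add: Z_def A_def)
  have c: "ar c" "dm c = Z" "cd c = A" using s(2-4)[of 0] by (simp_all add: Z_def A_def c_def)
  have cm: "c \<in> mor C Z A" "c \<noteq> zr Z A" using c Z A mor_iff nz by (simp_all add: Z_def A_def c_def)
  obtain E g where E: "E \<in> Ob C" "local_endomorphism_ring C E" and gm: "g \<in> mor C E Z"
    and cg: "c \<star> g \<noteq> zr E A"
    and soc: "\<forall>Y \<in> Ob C. \<forall>h \<in> mor C Y E. \<not> is_retraction C Y E h \<longrightarrow> c \<star> (g \<star> h) = zr Y A"
    using ex_socle_element[OF Z A cm] by blast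
  have g: "ar g" "dm g = E" "cd g = Z" using gm E Z mor_iff by simp_all
  have cgm: "c \<star> g \<in> mor C E A" using c g E A mor_iff by simp
  obtain B h0 where B: "B \<in> Ob C" "local_endomorphism_ring C B" and h0m: "h0 \<in> mor C A B"
    and v: "h0 \<star> (c \<star> g) \<noteq> zr E B"
    and cosoc: "\<forall>Y \<in> Ob C. \<forall>k \<in> mor C B Y. \<not> is_section C B Y k \<longrightarrow>
      (k \<star> h0) \<star> (c \<star> g) = zr E Y"
    using ex_cosocle_element[OF E(1) A cgm cg] by blast
  have h0: "ar h0" "dm h0 = A" "cd h0 = B" using h0m A B mor_iff by simp_all
  \<comment> \<open>The morphism \<open>v\<close> is annihilated by non-retractions on the right and by non-sections on the
    left, which makes both ends of an angle starting with \<open>v\<close> almost split.\<close>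
  define v where "v = h0 \<star> (c \<star> g)"
  have v': "ar v" "dm v = E" "cd v = B" "v \<noteq> zr E B" using h0 c g v by (simp_all add: v_def)
  have "v \<in> mor C E B" using v' E B mor_iff by simp
  then obtain V0 where V0: "V0 \<in> angles C" "vtx V0 0 = E" "vtx V0 1 = B" "arr V0 0 = v"
    using N1c[OF E(1) B(1)] by blast
  obtain V where V: "V \<in> angles C" "vtx V 0 = E" "vtx V 1 = B" "arr V 0 = v"
    and rad: "\<forall>i. 2 \<le> i \<and> i \<le> d \<longrightarrow> arr V i \<in> radical C (vtx V i) (vtx V (Suc i))"
    using minimal_angle[OF V0(1)] V0(2-4) by auto
  note sv = angleD[OF V(1)]
  have kill: "c \<star> (g \<star> f) = zr Y A"
    if "ar f" "dm f = Y" "cd f = E" "\<And>s. \<lbrakk>ar s; dm s = E; cd s = Y; f \<star> s = one E\<rbrakk> \<Longrightarrow> False" for f Y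
  proof -
    have Y: "Y \<in> Ob C" using that arD by auto
    have "f \<in> mor C Y E" using that Y E mor_iff by simp
    moreover have "\<not> is_retraction C Y E f" using is_retraction_iff[OF Y E(1) that(1-3)] that(4) by blast
    ultimately show ?thesis using soc Y by blast
  qed
  have v1: "ar (arr V (Suc 0))" "dm (arr V (Suc 0)) = B" "cd (arr V (Suc 0)) = vtx V (Suc (Suc 0))"
    using sv(2-4)[of "Suc 0"] d_pos V(3) by simp_all
  have v2O: "vtx V (Suc (Suc 0)) \<in> Ob C" using sv(1) d_pos by simp
  have v1v: "arr V (Suc 0) \<star> v = zr E (vtx V (Suc (Suc 0)))"
    using complex_first[OF V(1)] V v1 by simp
  have vl: "ar (arr V (Suc d))" "dm (arr V (Suc d)) = vtx V (Suc d)" "cd (arr V (Suc d)) = SO E"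
    using sv(2,3)[of "Suc d"] sv(5) V by simp_all
  have vlO: "vtx V (Suc d) \<in> Ob C" using sv(1) by simp
  have vvl: "SM v \<star> arr V (Suc d) = zr (vtx V (Suc d)) (SO B)"
    using complex_last[OF V(1)] V by simp
  have las: "left_almost_split C B (vtx V (Suc (Suc 0))) (arr V (Suc 0))"
    unfolding left_almost_split_def
  proof (intro conjI ballI impI notI)
    show "arr V (Suc 0) \<in> mor C B (vtx V (Suc (Suc 0)))" using v1 B v2O mor_iff by simp
  next
    assume "is_section C B (vtx V (Suc (Suc 0))) (arr V (Suc 0))"
    then obtain r where r: "ar r" "dm r = vtx V (Suc (Suc 0))" "cd r = B" "r \<star> arr V (Suc 0) = one B"
      using is_section_iff[OF B(1) v2O v1] by blast
    have "v = r \<star> (arr V (Suc 0) \<star> v)" using reassoc[OF r(4), of v] v' v1 r(1-3) by simp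
    also have "\<dots> = zr E B" unfolding v1v using r(1-3) E by simp
    finally show False using v' by blast
  next
    fix Y f assume Y: "Y \<in> Ob C" and fm: "f \<in> mor C B Y" and ns: "\<not> is_section C B Y f"
    have f: "ar f" "dm f = B" "cd f = Y" using fm Y B mor_iff by simp_all
    have "(f \<star> h0) \<star> (c \<star> g) = zr E Y" using cosoc Y fm ns by blast
    then have "f \<star> arr V 0 = zr (vtx V 0) Y" unfolding V v_def using f h0 c g by simp
    then obtain k where k: "ar k" "dm k = vtx V 2" "cd k = Y" "k \<star> arr V 1 = f"
      using cofactor[OF V(1) f(1) _ f(3)] f(2) V(3) by metis
    then have "k \<in> mor C (vtx V (Suc (Suc 0))) Y" using Y v2O mor_iff by (simp add: numeral_2_eq_2)
    then show "\<exists>h\<in>mor C (vtx V (Suc (Suc 0))) Y. f = h \<star> arr V (Suc 0)"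
      using k(4) by (intro bexI[of _ k]) simp_all
  qed
  have ras: "right_almost_split C (vtx V (Suc d)) (SO E) (arr V (Suc d))"
    unfolding right_almost_split_def
  proof (intro conjI ballI impI notI)
    show "arr V (Suc d) \<in> mor C (vtx V (Suc d)) (SO E)" using vl vlO E mor_iff by simp
  next
    assume "is_retraction C (vtx V (Suc d)) (SO E) (arr V (Suc d))"
    then obtain r where r: "ar r" "dm r = SO E" "cd r = vtx V (Suc d)" "arr V (Suc d) \<star> r = one (SO E)"
      using is_retraction_iff[OF vlO SO_Ob[OF E(1)] vl] by blast
    have "SM v = SM v \<star> (arr V (Suc d) \<star> r)" unfolding r(4) using v' by simp
    also have "\<dots> = (SM v \<star> arr V (Suc d)) \<star> r"
      by (rule assoc[symmetric]) (use v' r(1-3) vl in simp_all)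
    also have "\<dots> = zr (SO E) (SO B)" unfolding vvl using r(1-3) B by simp
    also have "\<dots> = SM (zr E B)" using E B by simp
    finally have "v = zr E B" by (rule SM_inj) (use v' E B in simp_all)
    then show False using v' by blast
  next
    fix Y f assume Y: "Y \<in> Ob C" and fm: "f \<in> mor C Y (SO E)"
      and nr: "\<not> is_retraction C Y (SO E) f"
    have f: "ar f" "dm f = Y" "cd f = SO E" using fm Y E mor_iff by simp_all
    obtain Y0 where Y0: "Y0 \<in> Ob C" "SO Y0 = Y" using SO_surj[OF Y] by blast
    obtain f0 where f0: "ar f0" "dm f0 = Y0" "cd f0 = E" "SM f0 = f"
      using SM_surj[OF f(1) _ f(3) Y0(1) E(1)] f(2) Y0(2) by metis
    have "c \<star> (g \<star> f0) = zr Y0 A"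
    proof (rule kill[OF f0(1-3)])
      fix s assume sr: "ar s" "dm s = E" "cd s = Y0" "f0 \<star> s = one E"
      have "SM (f0 \<star> s) = SM (one E)" using sr(4) by simp
      then have "f \<star> SM s = one (SO E)" using f0 sr(1-3) E by simp
      then show False
        using nr is_retraction_iff[OF Y SO_Ob[OF E(1)] f] sr(1-3) Y0(2)
        by (auto intro!: exI[of _ "SM s"])
    qed
    then have "v \<star> f0 = zr Y0 B" unfolding v_def using h0 c g f0 Y0 by simp
    then have "arr V 0 \<star> f0 = zr Y0 (vtx V (Suc 0))" using V by simp
    then obtain k where k: "ar k" "dm k = SO Y0" "cd k = vtx V (Suc d)" "arr V (Suc d) \<star> k = SM f0"
      using factor[OF V(1) f0(1,2)] f0(3) V(2) by metis
    then have "k \<in> mor C Y (vtx V (Suc d))" using Y Y0(2) vlO mor_iff by simp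
    then show "\<exists>h\<in>mor C Y (vtx V (Suc d)). f = arr V (Suc d) \<star> h"
      using k(4) f0(4) by (intro bexI[of _ k]) simp_all
  qed
  have AR: "AR_angle C d (rotate_seq C d V)"
    unfolding AR_angle_def
  proof (intro conjI allI impI)
    show "rotate_seq C d V \<in> angles C" by (rule rotate_angle[OF V(1)])
    show "left_almost_split C (vtx (rotate_seq C d V) 0) (vtx (rotate_seq C d V) 1)
        (arr (rotate_seq C d V) 0)"
      using las V(3) d_pos by simp
    show "right_almost_split C (vtx (rotate_seq C d V) d) (vtx (rotate_seq C d V) (d + 1))
        (arr (rotate_seq C d V) d)"
      using ras V(2) by simp
    fix i assume "1 \<le> i \<and> i < d"
    then show "arr (rotate_seq C d V) i \<in>
        radical C (vtx (rotate_seq C d V) i) (vtx (rotate_seq C d V) (i + 1))"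
      using rad by simp
  qed
  obtain V' where V': "V' \<in> angles C" "\<And>i. i \<le> d \<Longrightarrow> vtx V' (Suc i) = vtx V i"
    "\<And>i. i \<le> d \<Longrightarrow> arr V' (Suc i) = arr V i"
    using unrotate[OF V(1)] by metis
  have V'1: "vtx V' 1 = E" "vtx V' 2 = B" "arr V' 1 = v"
    using V'(2)[of 0] V'(2)[of 1] V'(3)[of 0] d_pos V by (simp_all add: numeral_2_eq_2)
  note sv' = angleD[OF V'(1)]
  have a0: "ar (arr V' 0)" "dm (arr V' 0) = vtx V' 0" "cd (arr V' 0) = E" "vtx V' 0 \<in> Ob C"
    using sv'(1-4)[of 0] V'1 by simp_all
  have va0: "v \<star> arr V' 0 = zr (vtx V' 0) B"
    using complex_first[OF V'(1)] V'1 v' by simp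
  have "c \<star> (g \<star> arr V' 0) = zr (vtx V' 0) A"
  proof (rule kill[OF a0(1-3)])
    fix s assume sr: "ar s" "dm s = E" "cd s = vtx V' 0" "arr V' 0 \<star> s = one E"
    have "v = v \<star> (arr V' 0 \<star> s)" unfolding sr(4) using v' by simp
    also have "\<dots> = (v \<star> arr V' 0) \<star> s"
      by (rule assoc[symmetric]) (use v' sr(1-3) a0 in simp_all)
    also have "\<dots> = zr E B" unfolding va0 using sr(1-3) B by simp
    finally show False using v' by blast
  qed
  then have z: "(c \<star> g) \<star> arr V' 0 = zr (vtx V' 0) A" using c g a0 by simp
  have cg': "ar (c \<star> g)" "dm (c \<star> g) = vtx V' 1" "cd (c \<star> g) = A" using c g V'1 by simp_all
  obtain t where t: "ar t" "dm t = B" "cd t = A" "t \<star> v = c \<star> g"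
    using cofactor[OF V'(1) cg' z] V'1 by metis
  have ht: "ar (h0 \<star> t)" "dm (h0 \<star> t) = B" "cd (h0 \<star> t) = B" using h0 t by simp_all
  \<comment> \<open>As \<open>B\<close> is local, \<open>h0 t\<close> is invertible, so \<open>t\<close> is a section.\<close>
  have "(h0 \<star> t) \<star> v = v" using h0 t v' by (simp add: v_def)
  then obtain r where r: "ar r" "dm r = B" "cd r = B" "r \<star> (h0 \<star> t) = one B"
    using local_absorb_left[OF B v'(1,3,2,4) ht] by metis
  have rt: "(r \<star> h0) \<star> t = one B" using r h0 t by simp
  show ?thesis
    by (rule that[OF V(1) AR, of g t "r \<star> h0"])
      (use V E g t h0 r rt cg in \<open>simp_all add: Z_def A_def c_def del: assoc\<close>)
qed

text \<open>
  The mapping cone of \<open>(g, t) : V \<rightarrow> U\<close> contains the trivial summand \<open>1 : V\<^sub>1 \<rightarrow> V\<^sub>1\<close>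
  because \<open>t\<close> is a section. Removing it leaves an angle that still starts at \<open>U\<^sub>0\<close>, and more
  morphisms into \<open>U\<^sub>0\<close> are annihilated by its first morphism, namely also \<open>g\<close>.
\<close>

lemma cone_step:
  assumes U: "U \<in> angles C" and V: "V \<in> angles C"
    and g: "ar g" "dm g = vtx V 0" "cd g = vtx U 0"
    and t: "ar t" "dm t = vtx V 1" "cd t = vtx U 1"
    and h: "ar h" "dm h = vtx U 1" "cd h = vtx V 1"
    and tv: "t \<star> arr V 0 = arr U 0 \<star> g" and ht: "h \<star> t = one (vtx V 1)"
  obtains W W' :: "('o, 'm) susp_seq" and i1 i2 p1 p2 :: "nat \<Rightarrow> 'm" and i1' i2' p1' p2' :: 'm
  where "W' \<in> angles C" "vtx W' 0 = vtx U 0"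
    "\<forall>k\<le>d. biproduct C (wob C d V (Suc (Suc k))) (vtx U (Suc k)) (vtx W (Suc k))
        (i1 k) (i2 k) (p1 k) (p2 k)"
    "biproduct C (vtx V 1) (vtx W' 1) (vtx W 1) i1' i2' p1' p2'"
    "\<forall>k. 1 \<le> k \<and> k \<le> d \<longrightarrow> vtx W' (Suc k) = vtx W (Suc k)"
    "\<forall>f. ar f \<and> cd f = vtx U 0 \<and> arr U 0 \<star> f = zr (dm f) (vtx U 1) \<longrightarrow>
      arr W' 0 \<star> f = zr (dm f) (vtx W' 1)"
    "arr W' 0 \<star> g = zr (vtx V 0) (vtx W' 1)"
proof -
  note u = angleD[OF U] and v = angleD[OF V]
  have "g \<in> mor C (vtx V 0) (vtx U 0)" "t \<in> mor C (vtx V 1) (vtx U 1)"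
    using g t u(1)[of 0] v(1)[of 0] u(1)[of 1] v(1)[of 1] mor_iff by simp_all
  then obtain \<phi> W where \<phi>: "\<phi> 1 = t" and cone: "mapping_cone C d V U \<phi> W" and W: "W \<in> angles C"
    using N4[OF V U _ _ tv] by blast
  obtain i1 i2 p1 p2 where b: "\<And>i. i \<le> d + 1 \<Longrightarrow>
      biproduct C (wob C d V (i + 1)) (vtx U i) (vtx W i) (i1 i) (i2 i) (p1 i) (p2 i)"
    and a: "\<And>i. i \<le> d + 1 \<Longrightarrow> arr W i =
      wmor C d i1 (i + 1) \<star>
        (\<ominus>\<^bsub>Hom C (wob C d V (i + 1)) (wob C d V (i + 2))\<^esub> wmor C d (arr V) (i + 1)) \<star> p1 i
      \<oplus>\<^bsub>Hom C (vtx W i) (wob C d W (i + 1))\<^esub>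
      wmor C d i2 (i + 1) \<star>
        (wmor C d \<phi> (i + 1) \<star> p1 i
          \<oplus>\<^bsub>Hom C (vtx W i) (wob C d U (i + 1))\<^esub> arr U i \<star> p2 i)"
    using cone unfolding mapping_cone_def by blast
  note w = angleD[OF W]
  define v0 where "v0 = arr V 0"
  define v1 where "v1 = arr V (Suc 0)"
  define c where "c = arr U 0"
  define B where "B = vtx V (Suc 0)"
  define B' where "B' = vtx V (Suc (Suc 0))"
  define Z where "Z = vtx U 0"
  define A where "A = vtx U (Suc 0)"
  define E where "E = vtx V 0"
  note defs = v0_def v1_def c_def B_def B'_def Z_def A_def E_def
  have v01: "ar v0" "dm v0 = E" "cd v0 = B" "ar v1" "dm v1 = B" "cd v1 = B'" "ar c" "dm c = Z" "cd c = A"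
    using u(2-4)[of 0] v(2-4)[of 0] v(2-4)[of "Suc 0"] d_pos by (simp_all add: defs)
  have Ob: "B \<in> Ob C" "B' \<in> Ob C" "Z \<in> Ob C" "A \<in> Ob C" "E \<in> Ob C" "vtx W 0 \<in> Ob C" "vtx W (Suc 0) \<in> Ob C"
    using u(1) v(1) w(1) d_pos by (simp_all add: defs)
  have v1v0: "v1 \<star> v0 = zr E B'" using complex_first[OF V] v01 by (simp add: defs)
  have g': "ar g" "dm g = E" "cd g = Z" and t': "ar t" "dm t = B" "cd t = A"
    and h': "ar h" "dm h = A" "cd h = B" and tv': "t \<star> v0 = c \<star> g" and ht': "h \<star> t = one B"
    using g t h tv ht by (simp_all add: defs)
  have b0: "biproduct C B Z (vtx W 0) (i1 0) (i2 0) (p1 0) (p2 0)"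
    using b[of 0] by (simp add: defs)
  have b1: "biproduct C B' A (vtx W (Suc 0)) (i1 (Suc 0)) (i2 (Suc 0)) (p1 (Suc 0)) (p2 (Suc 0))"
    using b[of "Suc 0"] d_pos by (simp add: defs)
  define \<iota> where "\<iota> = i1 0"
  define \<kappa> where "\<kappa> = i2 0"
  define \<pi> where "\<pi> = p1 0"
  define \<rho> where "\<rho> = p2 0"
  define \<iota>' where "\<iota>' = i1 (Suc 0)"
  define \<kappa>' where "\<kappa>' = i2 (Suc 0)"
  define \<pi>' where "\<pi>' = p1 (Suc 0)"
  define \<rho>' where "\<rho>' = p2 (Suc 0)"
  define P where "P = vtx W 0"
  define P' where "P' = vtx W (Suc 0)"
  note bp0 = b0[folded \<iota>_def \<kappa>_def \<pi>_def \<rho>_def P_def]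
  note bp1 = b1[folded \<iota>'_def \<kappa>'_def \<pi>'_def \<rho>'_def P'_def]
  note [simp] = biproductD[OF bp0] biproductD[OF bp1] v01 g' t' h'
  define x where "x = arr W 0"
  have x: "ar x" "dm x = P" "cd x = P'" using w(2-4)[of 0] by (simp_all add: x_def P_def P'_def)
  have xe: "x = ng (\<iota>' \<star> (v1 \<star> \<pi>)) \<boxplus> (\<kappa>' \<star> (t \<star> \<pi>) \<boxplus> \<kappa>' \<star> (c \<star> \<rho>))"
  proof -
    have v1m: "v1 \<in> mor C B B'" using mor_iff by simp
    have "x = \<iota>' \<star> (\<ominus>\<^bsub>Hom C B B'\<^esub> v1) \<star> \<pi> \<oplus>\<^bsub>Hom C P P'\<^esub>
        \<kappa>' \<star> (t \<star> \<pi> \<oplus>\<^bsub>Hom C P A\<^esub> c \<star> \<rho>)"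
      unfolding x_def using a[of 0] d_pos \<phi>
      by (simp add: \<iota>_def \<kappa>_def \<pi>_def \<rho>_def \<iota>'_def \<kappa>'_def \<pi>'_def \<rho>'_def P_def P'_def defs
          numeral_2_eq_2)
    also have "\<ominus>\<^bsub>Hom C B B'\<^esub> v1 = ng v1" by (rule ng_eq) (use v1m in simp_all)
    also have "t \<star> \<pi> \<oplus>\<^bsub>Hom C P A\<^esub> c \<star> \<rho> = t \<star> \<pi> \<boxplus> c \<star> \<rho>"
      by (rule pl_eq) (simp_all add: mor_iff)
    also have "\<iota>' \<star> ng v1 \<star> \<pi> \<oplus>\<^bsub>Hom C P P'\<^esub> \<kappa>' \<star> (t \<star> \<pi> \<boxplus> c \<star> \<rho>) =
        \<iota>' \<star> ng v1 \<star> \<pi> \<boxplus> \<kappa>' \<star> (t \<star> \<pi> \<boxplus> c \<star> \<rho>)"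
      by (rule pl_eq) (simp_all add: mor_iff)
    finally show ?thesis by simp
  qed
  have htx: "h \<star> (t \<star> y) = y" if "ar y" "cd y = B" for y
    using reassoc[OF ht', of y] that by simp
  have ret: "(h \<star> \<rho>') \<star> x = \<pi> \<boxplus> h \<star> (c \<star> \<rho>)" unfolding xe by (simp add: htx)
  let ?k = "\<kappa> \<boxplus> ng (\<iota> \<star> (h \<star> c))" and ?p = "\<pi> \<boxplus> h \<star> (c \<star> \<rho>)"
  \<comment> \<open>Both decompositions are chosen so that \<open>x\<close> becomes diagonal with entry \<open>1\<close> at \<open>B\<close>.\<close>
  have bq0: "biproduct C B Z P \<iota> ?k ?p \<rho>"
  proof -
    have s: "\<iota> \<star> \<pi> \<boxplus> \<kappa> \<star> \<rho> = one P" using bp0 by (simp add: biproduct_iff)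
    have "\<iota> \<star> ?p \<boxplus> ?k \<star> \<rho> = \<iota> \<star> \<pi> \<boxplus> \<kappa> \<star> \<rho>" by (simp add: pl_ac)
    then show ?thesis using s by (simp add: biproduct_iff)
  qed
  have "\<exists>Y j q. biproduct C B Y P' (x \<star> \<iota>) j (h \<star> \<rho>') q"
  proof (rule ex_complement)
    have "(h \<star> \<rho>') \<star> (x \<star> \<iota>) = ((h \<star> \<rho>') \<star> x) \<star> \<iota>"
      by (rule assoc[symmetric]) (use x in simp_all)
    also have "\<dots> = one B" unfolding ret by simp
    finally show "(h \<star> \<rho>') \<star> (x \<star> \<iota>) = one B" .
  qed (use x in simp_all)
  then obtain Y j q where bq1: "biproduct C B Y P' (x \<star> \<iota>) j (h \<star> \<rho>') q" by blast
  have bq0': "biproduct C B Z (vtx W 0) \<iota> ?k ?p \<rho>" using bq0 by (simp add: P_def)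
  have bq1': "biproduct C B Y (vtx W (Suc 0)) (x \<star> \<iota>) j (h \<star> \<rho>') q" using bq1 by (simp add: P'_def)
  obtain W' where W': "W' \<in> angles C" "vtx W' 0 = Z" "vtx W' (Suc 0) = Y"
    "\<And>k. \<lbrakk>k \<le> Suc d; k \<noteq> 0; k \<noteq> Suc 0\<rbrakk> \<Longrightarrow> vtx W' k = vtx W k"
    "arr W' 0 = q \<star> (x \<star> ?k)"
    using split_off[OF W _ bq0' bq1'] ret by (metis x_def le0)
  have q: "ar q" "dm q = P'" "cd q = Y" and Y: "Y \<in> Ob C" using biproductD[OF bq1] by simp_all
  have xk: "x \<star> (\<kappa> \<star> f) = \<kappa>' \<star> (c \<star> f)" if "ar f" "cd f = Z" for f
    unfolding xe using that by simp
  have xi: "x \<star> (\<iota> \<star> v0) = \<kappa>' \<star> (t \<star> v0)"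
    unfolding xe using v1v0 Ob by simp
  show ?thesis
  proof (rule that[of W' W "\<lambda>k. i1 (Suc k)" "\<lambda>k. i2 (Suc k)" "\<lambda>k. p1 (Suc k)"
        "\<lambda>k. p2 (Suc k)" "x \<star> \<iota>" j "h \<star> \<rho>'" q, OF W'(1)])
    show "vtx W' 0 = vtx U 0" using W'(2) by (simp add: Z_def)
    show "\<forall>k\<le>d. biproduct C (wob C d V (Suc (Suc k))) (vtx U (Suc k)) (vtx W (Suc k))
        (i1 (Suc k)) (i2 (Suc k)) (p1 (Suc k)) (p2 (Suc k))"
    proof (intro allI impI)
      fix k assume "k \<le> d"
      then show "biproduct C (wob C d V (Suc (Suc k))) (vtx U (Suc k)) (vtx W (Suc k))
        (i1 (Suc k)) (i2 (Suc k)) (p1 (Suc k)) (p2 (Suc k))"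
        using b[of "Suc k"] by simp
    qed
  next
    show "biproduct C (vtx V 1) (vtx W' 1) (vtx W 1) (x \<star> \<iota>) j (h \<star> \<rho>') q"
      using bq1' W'(3) by (simp add: B_def)
  next
    show "\<forall>k. 1 \<le> k \<and> k \<le> d \<longrightarrow> vtx W' (Suc k) = vtx W (Suc k)" using W'(4) by simp
  next
    show "\<forall>f. ar f \<and> cd f = vtx U 0 \<and> arr U 0 \<star> f = zr (dm f) (vtx U 1) \<longrightarrow>
      arr W' 0 \<star> f = zr (dm f) (vtx W' 1)"
    proof (intro allI impI, elim conjE)
      fix f assume f: "ar f" "cd f = vtx U 0" "arr U 0 \<star> f = zr (dm f) (vtx U 1)"
      have f': "cd f = Z" "c \<star> f = zr (dm f) A" using f by (simp_all add: defs)
      have "arr W' 0 \<star> f = q \<star> (x \<star> (\<kappa> \<star> f \<boxplus> ng (\<iota> \<star> (h \<star> (c \<star> f)))))"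
        unfolding W'(5) using f(1) f'(1) x q by simp
      also have "\<dots> = q \<star> (x \<star> (\<kappa> \<star> f))" unfolding f'(2) using f(1) f'(1) by simp
      also have "\<dots> = zr (dm f) Y" unfolding xk[OF f(1) f'(1)] f'(2) using f(1) q by simp
      finally show "arr W' 0 \<star> f = zr (dm f) (vtx W' 1)" using W'(3) by simp
    qed
  next
    have "h \<star> (c \<star> g) = v0" using htx[of v0] tv' by simp
    then have "arr W' 0 \<star> g = q \<star> (x \<star> (\<kappa> \<star> g) \<boxplus> ng (x \<star> (\<iota> \<star> v0)))"
      unfolding W'(5) using x q by simp
    also have "\<dots> = q \<star> (\<kappa>' \<star> (c \<star> g) \<boxplus> ng (\<kappa>' \<star> (c \<star> g)))"
      unfolding xi tv' using xk[of g] by simp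
    also have "\<dots> = zr E Y" using q Ob by simp
    finally show "arr W' 0 \<star> g = zr (vtx V 0) (vtx W' 1)" using W'(3) by (simp add: E_def)
  qed
qed

end

section \<open>Relations in the Grothendieck groups\<close>

text \<open>The multiple of \<open>x\<close> by \<open>(-1)\<^sup>k\<close>.\<close>

definition sg :: "nat \<Rightarrow> ('a \<Rightarrow>\<^sub>0 int) \<Rightarrow> ('a \<Rightarrow>\<^sub>0 int)" where
  "sg k x = frag_cmul ((-1) ^ k) x"

lemma sg_0 [simp]: "sg 0 x = x"
  by (simp add: sg_def)

lemma sg_Suc [simp]: "sg (Suc k) x = - sg k x"
  by (simp add: sg_def)

lemma sg_zero [simp]: "sg k 0 = 0"
  by (simp add: sg_def)

lemma sg_add: "sg k (x + y) = sg k x + sg k y"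
  by (simp add: sg_def frag_cmul_distrib2)

lemma sg_diff: "sg k (x - y) = sg k x - sg k y"
  by (induction k) simp_all

lemma sum_sg_telescope:
  "(\<Sum>k\<le>n. sg k (if k = 0 then y 1 else y k + y (Suc k) - z)) =
    sg n (y (Suc n)) + (z - (\<Sum>k\<le>n. sg k z))"
proof (induction n)
  case (Suc n)
  then show ?case by (simp add: sg_diff sg_add)
qed simp

lemma sum_sg_const: "z - (\<Sum>k\<le>n. sg k z) = (\<Sum>k\<le>Suc n. sg k z)"
proof (induction n)
  case (Suc n)
  then show ?case by (simp add: algebra_simps)
qed simp

context angulated_category
begin

abbreviation cl :: "'o \<Rightarrow> 'o set \<Rightarrow>\<^sub>0 int" where
  "cl A \<equiv> frag_of (iso_class C A)"

lemma free_subgroup: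
  assumes H: "subgroup H (free_ab C)"
  shows "0 \<in> H" "\<lbrakk>x \<in> H; y \<in> H\<rbrakk> \<Longrightarrow> x + y \<in> H" "x \<in> H \<Longrightarrow> - x \<in> H" "\<lbrakk>x \<in> H; y \<in> H\<rbrakk> \<Longrightarrow> x - y \<in> H"
    "x \<in> H \<Longrightarrow> sg k x \<in> H"
proof -
  show "0 \<in> H" using subgroup.one_closed[OF H] by (simp add: free_ab_def)
  show p: "x + y \<in> H" if "x \<in> H" "y \<in> H" for x y
    using subgroup.m_closed[OF H that] by (simp add: free_ab_def)
  show m: "- x \<in> H" if "x \<in> H" for x
  proof -
    have "x \<in> carrier (free_ab C)" using subgroup.subset[OF H] that by blast
    then show ?thesis using subgroup.m_inv_closed[OF H that] by (simp add: free_ab_def)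
  qed
  show "x - y \<in> H" if "x \<in> H" "y \<in> H" using p[OF that(1) m[OF that(2)]] by simp
  show "x \<in> H \<Longrightarrow> sg k x \<in> H" by (induction k) (simp_all add: m)
qed

lemma free_subgroup_sum:
  assumes H: "subgroup H (free_ab C)" and "finite I" "\<And>i. i \<in> I \<Longrightarrow> f i \<in> H"
  shows "sum f I \<in> H"
  using assms(2,3) by (induction I rule: finite_induct) (simp_all add: free_subgroup[OF H])

lemma split_relations_subgroup: "subgroup (split_relations C d) (free_ab C)"
  by (rule normal_imp_subgroup[OF split_relations_normal])

lemma split_relationsI: "split_angle C U \<Longrightarrow> euler_char C d U \<in> split_relations C d"
  unfolding split_relations_def by (rule generate.incl) blast

lemma euler_char_sg: "euler_char C d U = (\<Sum>k\<le>Suc d. sg k (cl (vtx U k)))"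
  by (simp only: euler_char_def sg_def Suc_eq_plus1)

lemma euler_zob: "euler_char C d (tseq 0 zob) = (\<Sum>k\<le>Suc d. sg k (cl zob))"
  by (simp add: euler_char_sg tseq_vtx)

lemma euler_zob_relation: "(\<Sum>k\<le>Suc d. sg k (cl zob)) \<in> split_relations C d"
proof -
  note t = tseq_props[OF zob(2), of 0]
  have "is_section C zob zob (one zob)"
    using zob(2) by (subst is_section_iff) (auto intro!: exI[of _ "one zob"])
  then have "split_angle C (tseq 0 zob)"
    using tseq0_angle[OF zob(2)] t(2-4) by (simp add: split_angle_def)
  then show ?thesis using split_relationsI euler_zob by metis
qed

text \<open>
  Classes are additive only up to the class of a zero object: when \<open>d\<close> is even, that class is
  not killed by the split angles.
\<close>

lemma biproduct_relation:
  assumes b: "biproduct C A B P i1 i2 p1 p2"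
  shows "cl A + cl B - cl P - cl zob \<in> split_relations C d"
proof -
  note B = biproductD[OF b]
  define Q where "Q k = (if k = 0 then A else if k = 1 then P else if k = 2 then B else zob)" for k :: nat
  define I1 where "I1 k = (if k = 0 then one A else if k = 1 then i1 else zr zob (Q k))" for k :: nat
  define I2 where "I2 k = (if k = 0 then zr zob A else if k = 1 then i2 else one (Q k))" for k :: nat
  define P1 where "P1 k = (if k = 0 then one A else if k = 1 then p1 else zr (Q k) zob)" for k :: nat
  define P2 where "P2 k = (if k = 0 then zr A zob else if k = 1 then p2 else one (Q k))" for k :: nat
  note F = Q_def I1_def I2_def P1_def P2_def
  have "biproduct C (vtx (tseq 0 A) k) (vtx (tseq 1 B) k) (Q k) (I1 k) (I2 k) (P1 k) (P2 k)" for k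
  proof -
    consider "k = 0" | "k = 1" | "k = 2" | "k \<noteq> 0" "k \<noteq> 1" "k \<noteq> 2" by blast
    then show ?thesis
    proof cases
      case 1
      then show ?thesis using biproduct_sym[OF zero_biproduct[OF zob(1) B(1)]]
        by (simp add: F tseq_vtx)
    next
      case 2
      then show ?thesis using b by (simp add: F tseq_vtx)
    next
      case 3
      then show ?thesis using zero_biproduct[OF zob(1) B(2)] by (simp add: F tseq_vtx)
    next
      case 4
      then show ?thesis using zero_biproduct[OF zob(1) zob(2)] by (simp add: F tseq_vtx)
    qed
  qed
  then obtain W where W: "W \<in> angles C" "vtx W = Q"
    "arr W 0 = I1 1 \<star> (arr (tseq 0 A) 0 \<star> P1 0) \<boxplus> I2 1 \<star> (arr (tseq 1 B) 0 \<star> P2 0)"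
    using direct_sum_angle[OF tseq0_angle[OF B(1)] tseq1_angle[OF B(2)]] by metis
  have "arr (tseq 1 B) 0 = zr zob B"
    using tseq_props(6)[OF B(2) d_pos, of 0] by (simp add: tseq_vtx)
  then have "arr W 0 = i1"
    unfolding W(3) using tseq_props(4)[OF B(1), of 0] B zob by (simp add: F)
  moreover have "is_section C A P i1"
    using B by (subst is_section_iff) (auto intro!: exI[of _ p1])
  ultimately have "split_angle C W" using W(1,2) by (simp add: split_angle_def F)
  then have "euler_char C d W \<in> split_relations C d" by (rule split_relationsI)
  then have "euler_char C d W - (\<Sum>k\<le>Suc d. sg k (cl zob)) \<in> split_relations C d"
    using free_subgroup(4)[OF split_relations_subgroup _ euler_zob_relation] by blast
  also have "euler_char C d W - (\<Sum>k\<le>Suc d. sg k (cl zob)) =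
      (\<Sum>k\<le>Suc d. sg k (cl (Q k) - cl zob))"
    by (simp only: euler_char_sg W(2) sg_diff sum_subtractf)
  also have "\<dots> = (\<Sum>k\<in>{0, 1, 2}. sg k (cl (Q k) - cl zob))"
    by (rule sum.mono_neutral_right) (use d_pos in \<open>auto simp: Q_def\<close>)
  also have "\<dots> = cl A + cl B - cl P - cl zob"
    by (simp add: Q_def sg_diff numeral_2_eq_2)
  finally show ?thesis .
qed

text \<open>The Euler characteristic of the rotation.\<close>

abbreviation euler_rot where "euler_rot U \<equiv> euler_char C d (rotate_seq C d U)"

lemma euler_rotate: "euler_rot U = (\<Sum>k\<le>Suc d. sg k (cl (wob C d U (Suc k))))"
  by (simp add: euler_char_sg rotate_seq_def)

end

context krull_schmidt_angulated_category
begin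

text \<open>The group generated by the Euler characteristics of split and of Auslander-Reiten angles.\<close>

definition AR_relations :: "('o set \<Rightarrow>\<^sub>0 int) set" where
  "AR_relations = generate (free_ab C)
    ({euler_char C d U | U. split_angle C U} \<union> {euler_char C d U | U. AR_angle C d U})"

lemma AR_relations_gens:
  "{euler_char C d U | U. split_angle C U} \<union> {euler_char C d U | U. AR_angle C d U}
    \<subseteq> carrier (free_ab C)"
  using euler_char_closed angle_vtx unfolding split_angle_def AR_angle_def by blast

lemma AR_relations_subgroup: "subgroup AR_relations (free_ab C)"
proof -
  interpret F: comm_group "free_ab C" by (rule comm_group_free_ab)
  show ?thesis unfolding AR_relations_def by (rule F.generate_is_subgroup[OF AR_relations_gens])
qed

lemma split_le_AR_relations: "split_relations C d \<subseteq> AR_relations"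
proof -
  interpret F: comm_group "free_ab C" by (rule comm_group_free_ab)
  show ?thesis unfolding split_relations_def AR_relations_def by (rule F.mono_generate) blast
qed

text \<open>
  The objects of \<open>W\<close> are those of a mapping cone of a morphism \<open>V \<rightarrow> U\<close>, and \<open>W'\<close> differs from it by
  the summand \<open>V\<^sub>1\<close> at the indices \<open>0\<close> and \<open>1\<close>. The objects of \<open>V\<close> enter the alternating sum twice,
  with shifted indices, and telescope.
\<close>

lemma euler_cone_step:
  assumes U: "U \<in> angles C" and V: "V \<in> angles C" and W': "W' \<in> angles C" "vtx W' 0 = vtx U 0"
    and b: "\<And>k. k \<le> d \<Longrightarrow> biproduct C (wob C d V (Suc (Suc k))) (vtx U (Suc k)) (vtx W (Suc k))
        (i1 k) (i2 k) (p1 k) (p2 k)"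
    and b': "biproduct C (vtx V 1) (vtx W' 1) (vtx W 1) i1' i2' p1' p2'"
    and W'W: "\<And>k. \<lbrakk>1 \<le> k; k \<le> d\<rbrakk> \<Longrightarrow> vtx W' (Suc k) = vtx W (Suc k)"
  shows "euler_rot U - euler_rot V
    - euler_rot W' \<in> split_relations C d"
proof -
  note sub = split_relations_subgroup
  define x where "x k = cl (wob C d U (Suc k))" for k
  define y where "y k = cl (wob C d V (Suc k))" for k
  define w where "w k = cl (wob C d W' (Suc k))" for k
  define z where "z = cl zob"
  define e where "e k = (if k = 0 then y 1 else y k + y (Suc k) - z)" for k
  define e' where "e' k = (if k \<le> d then e k else y (Suc d))" for k
  have fe: "x k - y k - w k + e' k \<in> split_relations C d" if k: "k \<le> Suc d" for k
  proof -
    consider "k = 0" | "1 \<le> k" "k \<le> d" | "k = Suc d" using k by linarith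
    then show ?thesis
    proof cases
      case 1
      have "y 1 + x 0 - cl (vtx W (Suc 0)) - z \<in> split_relations C d"
        using biproduct_relation[OF b[of 0]] by (simp add: x_def y_def z_def)
      moreover have "y 0 + w 0 - cl (vtx W (Suc 0)) - z \<in> split_relations C d"
        using biproduct_relation[OF b'] by (simp add: w_def y_def z_def)
      ultimately have "(y 1 + x 0 - cl (vtx W (Suc 0)) - z) - (y 0 + w 0 - cl (vtx W (Suc 0)) - z)
          \<in> split_relations C d" by (rule free_subgroup(4)[OF sub])
      then show ?thesis using 1 by (simp add: e_def e'_def algebra_simps)
    next
      case 2
      have "y (Suc k) + x k - cl (vtx W (Suc k)) - z \<in> split_relations C d"
        using biproduct_relation[OF b[OF 2(2)]] 2 by (simp add: x_def y_def z_def)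
      then show ?thesis using 2 W'W[OF 2] by (simp add: e_def e'_def w_def algebra_simps)
    next
      case 3
      have "x (Suc d) = w (Suc d)" using W'(2) by (simp add: x_def w_def)
      then show ?thesis using 3 free_subgroup(1)[OF sub] by (simp add: e'_def)
    qed
  qed
  have "(\<Sum>k\<le>Suc d. sg k (e' k)) = (\<Sum>k\<le>d. sg k (e k)) + sg (Suc d) (y (Suc d))"
    by (simp add: e'_def)
  also have "\<dots> = z - (\<Sum>k\<le>d. sg k z)"
    unfolding e_def sum_sg_telescope by simp
  also have "\<dots> = (\<Sum>k\<le>Suc d. sg k z)" by (rule sum_sg_const)
  finally have e': "(\<Sum>k\<le>Suc d. sg k (e' k)) \<in> split_relations C d"
    using euler_zob_relation by (simp add: z_def)
  have "(\<Sum>k\<le>Suc d. sg k (x k - y k - w k + e' k)) \<in> split_relations C d"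
    by (rule free_subgroup_sum[OF sub]) (use fe free_subgroup(5)[OF sub] in auto)
  then have "(\<Sum>k\<le>Suc d. sg k (x k - y k - w k + e' k)) - (\<Sum>k\<le>Suc d. sg k (e' k))
      \<in> split_relations C d"
    using e' by (rule free_subgroup(4)[OF sub])
  moreover have "(\<Sum>k\<le>Suc d. sg k (x k - y k - w k + e' k)) - (\<Sum>k\<le>Suc d. sg k (e' k)) =
      euler_rot U - euler_rot V
      - euler_rot W'"
    unfolding euler_rotate x_def[symmetric] y_def[symmetric] w_def[symmetric]
    by (simp only: sg_diff sg_add sum.distrib sum_subtractf add_diff_cancel_right')
  ultimately show ?thesis by metis
qed

text \<open>
  The induction is on the colength of the kernel of the first morphism, as a subfunctor of
  \<open>Hom(-, Z)\<close>; the morphism \<open>g\<close> below is not in that kernel but in the one for \<open>W'\<close>.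
\<close>

lemma euler_rotate_AR_relations:
  assumes "U \<in> angles C"
  shows "euler_rot U \<in> AR_relations"
proof -
  define Z where "Z = vtx U 0"
  have Z: "Z \<in> Ob C" using angleD(1)[OF assms] by (simp add: Z_def)
  obtain M where M: "subfunctor_length Z M" using ex_subfunctor_length[OF Z] by blast
  define N where "N c Y = {f. ar f \<and> dm f = Y \<and> cd f = Z \<and> c \<star> f = zr Y (cd c)}" for c Y
  have Nf: "subfunctor Z (N c)" if "ar c" "dm c = Z" for c
    unfolding N_def by (rule subfunctor_kernel[OF that])
  let ?top = "N (zr Z Z)"
  have "euler_rot U \<in> AR_relations" if "U \<in> angles C" "vtx U 0 = Z" for U
    using that
  proof (induction "M ?top - M (N (arr U 0))" arbitrary: U rule: less_induct)
    case less
    note U = less.prems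
    note u = angleD[OF U(1)]
    have u1: "vtx U 1 \<in> Ob C" using u(1) by simp
    have c: "ar (arr U 0)" "dm (arr U 0) = Z" "cd (arr U 0) = vtx U 1" using u(2-4)[of 0] U(2) by simp_all
    show ?case
    proof (cases "arr U 0 = zr (vtx U 0) (vtx U 1)")
      case True
      have "one (vtx U 1) \<star> arr U 0 = zr (vtx U 0) (vtx U 1)" using True c by simp
      then obtain k where k: "ar k" "dm k = vtx U 2" "cd k = vtx U 1" "k \<star> arr U 1 = one (vtx U 1)"
        using cofactor[OF U(1), of "one (vtx U 1)" "vtx U 1"] u1 by auto
      have "is_section C (vtx U 1) (vtx U 2) (arr U 1)"
        by (subst is_section_iff)
          (use k u1 u(1)[of 2] u(2-4)[of 1] d_pos in \<open>auto simp: numeral_2_eq_2\<close>)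
      then have "split_angle C (rotate_seq C d U)"
        using rotate_angle[OF U(1)] d_pos by (simp add: split_angle_def numeral_2_eq_2)
      then show ?thesis using split_relationsI split_le_AR_relations by blast
    next
      case False
      obtain V g t h where V: "V \<in> angles C" "AR_angle C d (rotate_seq C d V)"
        "local_endomorphism_ring C (vtx V 0)"
        and g: "ar g" "dm g = vtx V 0" "cd g = vtx U 0" and t: "ar t" "dm t = vtx V 1" "cd t = vtx U 1"
        and h: "ar h" "dm h = vtx U 1" "cd h = vtx V 1"
        and tv: "t \<star> arr V 0 = arr U 0 \<star> g" and ht: "h \<star> t = one (vtx V 1)"
        and nz: "arr U 0 \<star> g \<noteq> zr (vtx V 0) (vtx U 1)"
        by (rule ex_AR_angle[OF U(1) False])
      obtain W W' :: "('o, 'm) susp_seq" and i1 i2 p1 p2 i1' i2' p1' p2'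
        where W': "W' \<in> angles C" "vtx W' 0 = vtx U 0"
        and b: "\<forall>k\<le>d. biproduct C (wob C d V (Suc (Suc k))) (vtx U (Suc k)) (vtx W (Suc k))
            (i1 k) (i2 k) (p1 k) (p2 k)"
        and b': "biproduct C (vtx V 1) (vtx W' 1) (vtx W 1) i1' i2' p1' p2'"
        and W'W: "\<forall>k. 1 \<le> k \<and> k \<le> d \<longrightarrow> vtx W' (Suc k) = vtx W (Suc k)"
        and mono: "\<forall>f. ar f \<and> cd f = vtx U 0 \<and> arr U 0 \<star> f = zr (dm f) (vtx U 1) \<longrightarrow>
          arr W' 0 \<star> f = zr (dm f) (vtx W' 1)"
        and new: "arr W' 0 \<star> g = zr (vtx V 0) (vtx W' 1)"
        by (rule cone_step[OF U(1) V(1) g t h tv ht])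
      have VO: "vtx V 0 \<in> Ob C" using angleD(1)[OF V(1)] by simp
      have ind: "indecomposable C (vtx V 0)" by (rule local_indecomposable[OF VO V(3)])
      have c': "ar (arr W' 0)" "dm (arr W' 0) = Z" "cd (arr W' 0) = vtx W' 1"
        using angleD(2-4)[OF W'(1), of 0] W'(2) U(2) by simp_all
      have gn: "g \<notin> N (arr U 0) (vtx V 0)" using nz c by (simp add: N_def)
      have gW: "g \<in> N (arr W' 0) (vtx V 0)" using new g c' U(2) by (simp add: N_def)
      have gt: "g \<in> ?top (vtx V 0)" using g U(2) Z by (simp add: N_def)
      have lt: "M (N (arr U 0)) < M (N (arr W' 0))"
      proof (rule subfunctor_lengthD[OF M Nf[OF c(1,2)] Nf[OF c'(1,2)] _ ind])
        show "N (arr U 0) (vtx V 0) \<noteq> N (arr W' 0) (vtx V 0)" using gn gW by metis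
        fix Y
        show "N (arr U 0) Y \<subseteq> N (arr W' 0) Y"
          using mono c c' U(2) by (auto simp: N_def)
      qed
      have lt': "M (N (arr U 0)) < M ?top"
      proof (rule subfunctor_lengthD[OF M Nf[OF c(1,2)] Nf _ ind])
        show "N (arr U 0) (vtx V 0) \<noteq> ?top (vtx V 0)" using gn gt by metis
        fix Y
        show "N (arr U 0) Y \<subseteq> ?top Y" using Z by (auto simp: N_def)
      qed (use Z in simp_all)
      have "M ?top - M (N (arr W' 0)) < M ?top - M (N (arr U 0))" using lt lt' by linarith
      then have IH: "euler_rot W' \<in> AR_relations"
        using less.hyps W' U(2) by metis
      have AR: "euler_rot V \<in> AR_relations"
        unfolding AR_relations_def using V(2) by (intro generate.incl) blast
      have "euler_rot U - euler_rot V
          - euler_rot W' \<in> AR_relations"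
        using euler_cone_step[OF U(1) V(1) W' b[rule_format] b' W'W[rule_format]] split_le_AR_relations by blast
      then have "(euler_rot U - euler_rot V
          - euler_rot W') + (euler_rot V
          + euler_rot W') \<in> AR_relations"
        using free_subgroup(2)[OF AR_relations_subgroup] IH AR by blast
      then show ?thesis by simp
    qed
  qed
  then show ?thesis using assms by (simp add: Z_def)
qed

lemma relations_le_AR_relations: "relations C d \<subseteq> AR_relations"
proof -
  interpret F: comm_group "free_ab C" by (rule comm_group_free_ab)
  have "euler_char C d U \<in> AR_relations" if U: "U \<in> angles C" for U
  proof -
    obtain V where V: "V \<in> angles C" "\<And>i. i \<le> d \<Longrightarrow> vtx V (Suc i) = vtx U i"
      "SO (vtx V 0) = vtx U (Suc d)"
      using unrotate[OF U] by metis
    have "euler_rot V = euler_char C d U"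
      unfolding euler_rotate euler_char_sg using V(2,3) by simp
    then show ?thesis using euler_rotate_AR_relations[OF V(1)] by simp
  qed
  then show ?thesis
    unfolding relations_def
    by (intro F.generate_subgroup_incl[OF _ AR_relations_subgroup]) blast
qed

end

theorem theorem3p8:
  fixes K :: "('k, 'r) ring_scheme"
    and C :: "('k, 'o, 'm, 'z) angulated_cat_scheme"
    and d :: nat
  assumes "algebraically_closed K"
    and "angulated_category K C d"
    and "hom_finite K C"
    and "krull_schmidt C"
    and "locally_finite C"
  shows "kernel (K0_split C d) (K0 C d) (canonical_epi C d) =
    generate (K0_split C d) {angle_class C d U | U. AR_angle C d U}"
proof -
  interpret angulated_category K C d by fact
  interpret krull_schmidt_angulated_category K C d
    by unfold_locales (use assms in simp_all)
  interpret F: comm_group "free_ab C" by (rule comm_group_free_ab)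
  interpret R: normal "relations C d" "free_ab C" by (rule relations_normal)
  interpret R': normal "split_relations C d" "free_ab C" by (rule split_relations_normal)
  interpret S: comm_group "K0_split C d" by (rule comm_group_K0_split)
  let ?q = "\<lambda>x. split_relations C d #>\<^bsub>free_ab C\<^esub> x"
  interpret Q: group_hom "free_ab C" "K0_split C d" ?q
    unfolding K0_split_def
    by (intro group_hom.intro group_hom_axioms.intro R'.r_coset_hom_Mod R'.factorgroup_is_group)
      (rule F.group_axioms)
  let ?AR = "{angle_class C d U | U. AR_angle C d U}"
  let ?S = "{euler_char C d U | U. split_angle C U} \<union> {euler_char C d U | U. AR_angle C d U}"
  have q_angle: "angle_class C d U = ?q (euler_char C d U)" if "U \<in> angles C" for U
    by (rule angle_class_eq_coset[OF that])
  have e_closed: "euler_char C d U \<in> carrier (free_ab C)" if "U \<in> angles C" for U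
    using euler_char_closed angle_vtx that by blast
  have AR_angles: "U \<in> angles C" if "AR_angle C d U" for U using that by (simp add: AR_angle_def)
  have AR_closed: "?AR \<subseteq> carrier (K0_split C d)"
    using q_angle Q.hom_closed e_closed AR_angles by auto
  show ?thesis
  proof
    show "kernel (K0_split C d) (K0 C d) (canonical_epi C d) \<subseteq> generate (K0_split C d) ?AR"
    proof
      fix c assume "c \<in> kernel (K0_split C d) (K0 C d) (canonical_epi C d)"
      then have cc: "c \<in> carrier (K0_split C d)" and ker: "canonical_epi C d c = \<one>\<^bsub>K0 C d\<^esub>"
        by (simp_all add: kernel_def)
      obtain x where x: "x \<in> carrier (free_ab C)" "c = ?q x"
        using cc unfolding K0_split_def carrier_FactGroup by blast
      have "relations C d #>\<^bsub>free_ab C\<^esub> x = relations C d"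
        using ker canonical_epi_coset[OF x(1)] x(2) by (simp add: K0_def)
      then have "x \<in> relations C d"
        using F.rcos_self[OF x(1) R.subgroup_axioms] by simp
      then have "x \<in> generate (free_ab C) ?S"
        using subsetD[OF relations_le_AR_relations] unfolding AR_relations_def by simp
      then have "?q x \<in> generate (K0_split C d) (?q ` ?S)"
        unfolding Q.generate_img[OF AR_relations_gens] by (rule imageI)
      also have "\<dots> \<subseteq> generate (K0_split C d) ?AR"
      proof (rule S.generate_subgroup_incl[OF _ S.generate_is_subgroup[OF AR_closed]])
        show "?q ` ?S \<subseteq> generate (K0_split C d) ?AR"
        proof
          fix a assume "a \<in> ?q ` ?S"
          then consider U where "split_angle C U" "a = ?q (euler_char C d U)"
            | U where "AR_angle C d U" "a = ?q (euler_char C d U)" by blast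
          then show "a \<in> generate (K0_split C d) ?AR"
          proof cases
            case 1
            have "U \<in> angles C" using 1(1) by (simp add: split_angle_def)
            then have "a = split_relations C d"
              unfolding 1(2)
              by (rule F.coset_join2[OF e_closed R'.subgroup_axioms split_relationsI[OF 1(1)]])
            then have a: "a = \<one>\<^bsub>K0_split C d\<^esub>" by (simp add: K0_split_def)
            show ?thesis unfolding a by (rule generate.one)
          next
            case 2
            then have "a \<in> ?AR" using q_angle[OF AR_angles] by blast
            then show ?thesis by (rule generate.incl)
          qed
        qed
      qed
      finally show "c \<in> generate (K0_split C d) ?AR" using x(2) by simp
    qed
    interpret P: group_hom "K0_split C d" "K0 C d" "canonical_epi C d"
      using canonical_epi_epi R.factorgroup_is_group S.group_axioms
      by (simp add: group_hom_def group_hom_axioms_def Group.epi_def K0_def)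
    show "generate (K0_split C d) ?AR \<subseteq> kernel (K0_split C d) (K0 C d) (canonical_epi C d)"
    proof (rule S.generate_subgroup_incl[OF _ P.subgroup_kernel])
      show "?AR \<subseteq> kernel (K0_split C d) (K0 C d) (canonical_epi C d)"
      proof
        fix a assume a: "a \<in> ?AR"
        then obtain U where U: "U \<in> angles C" "a = ?q (euler_char C d U)"
          using q_angle AR_angles by blast
        have "euler_char C d U \<in> relations C d"
          unfolding relations_def using U(1) by (intro generate.incl) blast
        then have "relations C d #>\<^bsub>free_ab C\<^esub> euler_char C d U = relations C d"
          using F.coset_join2[OF e_closed[OF U(1)] R.subgroup_axioms] by blast
        then have "canonical_epi C d a = \<one>\<^bsub>K0 C d\<^esub>"
          using canonical_epi_coset[OF e_closed[OF U(1)]] U(2) by (simp add: K0_def)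
        then show "a \<in> kernel (K0_split C d) (K0 C d) (canonical_epi C d)"
          using a AR_closed by (auto simp: kernel_def)
      qed
    qed
  qed
qed

end
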